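(* Let $X_d=\otimes_{j=1}^dX_{1,j}$, $(a_d)$ a real sequence and $(b_d)$ a positive sequence with $b_d\to\infty$. Let $G$ be a self-decomposable distribution function with Lévy triplet $(\gamma,\sigma^2,L)$ where $L(x)=0$ for $x<0$, and let $q:(0,1)\to\mathbb R$ be non-increasing with $q(\varepsilon)=G^{-1}(1-\varepsilon^2)$ for all $\varepsilon\in(0,1)$. Assume $$\lim_{d\to\infty}\max_{j=1,\dots,d}\sum_{k=1}^\infty\bar\lambda^{X_{1,j}}_k\,\mathbf 1\bigl(\bar\lambda^{X_{1,j}}_k<e^{-\tau b_d}\bigr)=0\quad\text{for all }\tau>0.$$ Let $N$ be either $\infty$ or a natural number with $\sum_{j=1}^\infty\sum_{k=N+1}^\infty\bar\lambda^{X_{1,j}}_k<\infty$, and set $M^{X_{1,j}}_{p,N}(x)=\sum_{k=1}^N|\ln\bar\lambda^{X_{1,j}}_k|^p\,\bar\lambda^{X_{1,j}}_k\,\mathbf 1(\bar\lambda^{X_{1,j}}_k\ge e^{-x})$, $x\ge0$, $p\in\{1,2\}$. Then $$\ln n^{X_d}(\varepsilon)=a_d+q(\varepsilon)b_d+o(b_d),\quad d\to\infty,\quad\text{for all }\varepsilon\in(0,1)$$ holds if and only if all of the following hold: (A) $\lim_{d\to\infty}\sum_{j=1}^d\sum_{k=1}^N\bar\lambda^{X_{1,j}}_k\mathbf 1(\bar\lambda^{X_{1,j}}_k<e^{-xb_d})=-L(x)$ for all $x>0$; (B) $\lim_{d\to\infty}\frac1{b_d}\bigl(\sum_{j=1}^dM^{X_{1,j}}_{1,N}(\tau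 b_d)-a_d\bigr)=\gamma+\int_0^\tau\frac{x^3\,dL(x)}{1+x^2}-\int_\tau^\infty\frac{x\,dL(x)}{1+x^2}$ for all $\tau>0$; (C) $\lim_{\tau\to0}\limsup_{d\to\infty}\frac1{b_d^2}\sum_{j=1}^d\bigl(M^{X_{1,j}}_{2,N}(\tau b_d)-(M^{X_{1,j}}_{1,N}(\tau b_d))^2\bigr)=\lim_{\tau\to0}\liminf_{d\to\infty}\frac1{b_d^2}\sum_{j=1}^d\bigl(M^{X_{1,j}}_{2,N}(\tau b_d)-(M^{X_{1,j}}_{1,N}(\tau b_d))^2\bigr)=\sigma^2$.
   Context: For a centered Hilbert-space random element $Z$ with finite second moment, $\lambda^Z_1\ge\lambda^Z_2\ge\dots\ge 0$ denote the eigenvalues of its covariance operator $K^Z$ with multiplicity (padded with zeros), $\Lambda^Z=\sum_k\lambda^Z_k$, $\bar\lambda^Z_k=\lambda^Z_k/\Lambda^Z$. Let $X_{1,j}$ be centered random elements of separable Hilbert spaces $H_{1,j}$ with $\mathbb E\|X_{1,j}\|^2<\infty$ and $\lambda^{X_{1,j}}_1>0$; $X_d=\otimes_{j=1}^dX_{1,j}$ means $X_d$ is a centered random element of $H_d=\otimes_{j=1}^dH_{1,j}$ with covariance operator $\otimes_{j=1}^dK^{X_{1,j}}$ (eigenvalues $\prod_j\lambda^{X_{1,j}}_{k_j}$). The complexity is $n^{X_d}(\varepsilon)=\min\{n\in\mathbb N:\sum_{k>n}\bar\lambda^{X_d}_k\le\varepsilon^2\}$, equivalently the minimal rank $n$ of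 a linear approximation $\sum_{m=1}^nl_m(X_d)\psi_m$ ($l_m\in H_d^*$, $\psi_m\in H_d$) with $\mathbb E\|X_d-\sum l_m(X_d)\psi_m\|^2\le\varepsilon^2\mathbb E\|X_d\|^2$. $f^{-1}(y)=\inf\{x:f(x)\ge y\}$. A distribution function $F$ is self-decomposable if for every $\alpha>1$ there is a distribution function $F_\alpha$ with $F(x)=\int F_\alpha(x-y)\,dF(\alpha y)$. Its characteristic function then has the Lévy representation $f(t)=\exp\{i\gamma t-\sigma^2t^2/2+\int_{|x|>0}(e^{itx}-1-\frac{itx}{1+x^2})\,dL(x)\}$; $(\gamma,\sigma^2,L)$ is its Lévy triplet, with $L$ non-decreasing on $(-\infty,0)$ and $(0,\infty)$, $L(\pm\infty)=0$, $\int_{0<|x|<\tau}x^2dL<\infty$. *)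

theory Defs
  imports "HOL-Probability.Probability" "HOL-Library.Landau_Symbols" "HOL-Library.Extended_Nat"
begin

definition gen_inv :: "(real \<Rightarrow> real) \<Rightarrow> real \<Rightarrow> real" where
  "gen_inv f y = Inf {x. f x \<ge> y}"

(* Self-decomposability of the distribution function F = cdf M:
   for every alpha > 1 there is a distribution function F_alpha = cdf K with
   F(x) = int F_alpha(x - y) dF(alpha y); the measure dF(alpha y) is the law of Y/alpha, Y ~ M. *)
definition self_decomposable :: "real measure \<Rightarrow> bool" where
  "self_decomposable M \<longleftrightarrow> real_distribution M \<and>
     (\<forall>\<alpha>>1. \<exists>K. real_distribution K \<and>
        (\<forall>x. cdf M x = (\<integral>y. cdf K (x - y) \<partial>(distr M borel (\<lambda>y. y / \<alpha>)))))"

(* nu is the Lebesgue-Stieltjes measure dL of L on (0,infinity) (L vanishes on (-infinity,0)) *)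
definition stieltjes_pos :: "(real \<Rightarrow> real) \<Rightarrow> real measure \<Rightarrow> bool" where
  "stieltjes_pos L \<nu> \<longleftrightarrow> sets \<nu> = sets borel \<and> emeasure \<nu> {..0} = 0 \<and>
     (\<forall>a b. 0 < a \<longrightarrow> a \<le> b \<longrightarrow> emeasure \<nu> {a<..b} = ennreal (L b - L a))"

definition levy_triplet :: "real measure \<Rightarrow> real \<Rightarrow> real \<Rightarrow> (real \<Rightarrow> real) \<Rightarrow> real measure \<Rightarrow> bool" where
  "levy_triplet M \<gamma> \<sigma>2 L \<nu> \<longleftrightarrow>
     \<sigma>2 \<ge> 0 \<and> (\<forall>x<0. L x = 0) \<and> mono_on {0<..} L \<and> (L \<longlongrightarrow> 0) at_top \<and>
     stieltjes_pos L \<nu> \<and>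
     (\<forall>\<tau>>0. (\<integral>\<^sup>+x\<in>{0<..<\<tau>}. ennreal (x\<^sup>2) \<partial>\<nu>) < \<infinity>) \<and>
     (\<forall>t. char M t = exp (\<i> * complex_of_real (\<gamma> * t) - complex_of_real (\<sigma>2 * t\<^sup>2 / 2)
         + (CLINT x|\<nu>. iexp (t * x) - 1 - \<i> * complex_of_real (t * x / (1 + x\<^sup>2)))))"

(* Eigenvalue sequences: lam j k is the k-th eigenvalue (k >= 1, with multiplicity, nonincreasing,
   padded with zeros) of the covariance operator of X_{1,j}, j >= 1. *)
definition trace1 :: "(nat \<Rightarrow> nat \<Rightarrow> real) \<Rightarrow> nat \<Rightarrow> real" where
  "trace1 lam j = (\<Sum>\<^sub>\<infinity>k\<in>{1..}. lam j k)"

definition barlam :: "(nat \<Rightarrow> nat \<Rightarrow> real) \<Rightarrow> nat \<Rightarrow> nat \<Rightarrow> real" where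
  "barlam lam j k = lam j k / trace1 lam j"

(* multi-indices (k_1,...,k_d), k_j >= 1, labelling the eigenvalues of the tensor product X_d *)
definition multi_idx :: "nat \<Rightarrow> (nat \<Rightarrow> nat) set" where
  "multi_idx d = PiE {1..d} (\<lambda>_. {1..})"

(* eigenvalue prod_j lam_{k_j}^{X_{1,j}} of the covariance operator of X_d *)
definition prod_eig :: "(nat \<Rightarrow> nat \<Rightarrow> real) \<Rightarrow> nat \<Rightarrow> (nat \<Rightarrow> nat) \<Rightarrow> real" where
  "prod_eig lam d \<kappa> = (\<Prod>j\<in>{1..d}. lam j (\<kappa> j))"

definition trace_d :: "(nat \<Rightarrow> nat \<Rightarrow> real) \<Rightarrow> nat \<Rightarrow> real" where
  "trace_d lam d = (\<Sum>\<^sub>\<infinity>\<kappa>\<in>multi_idx d. prod_eig lam d \<kappa>)"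

(* sum of the n largest eigenvalues lambda^{X_d}_1 + ... + lambda^{X_d}_n (with multiplicity) *)
definition top_sum :: "(nat \<Rightarrow> nat \<Rightarrow> real) \<Rightarrow> nat \<Rightarrow> nat \<Rightarrow> real" where
  "top_sum lam d n = Sup ((\<lambda>S. \<Sum>\<kappa>\<in>S. prod_eig lam d \<kappa>) `
       {S. S \<subseteq> multi_idx d \<and> finite S \<and> card S \<le> n})"

(* sum_{k>n} bar lambda^{X_d}_k *)
definition tail_d :: "(nat \<Rightarrow> nat \<Rightarrow> real) \<Rightarrow> nat \<Rightarrow> nat \<Rightarrow> real" where
  "tail_d lam d n = (trace_d lam d - top_sum lam d n) / trace_d lam d"

definition complexity :: "(nat \<Rightarrow> nat \<Rightarrow> real) \<Rightarrow> nat \<Rightarrow> real \<Rightarrow> nat" where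
  "complexity lam d \<epsilon> = (LEAST n. tail_d lam d n \<le> \<epsilon>\<^sup>2)"

definition Mfun :: "(nat \<Rightarrow> nat \<Rightarrow> real) \<Rightarrow> nat \<Rightarrow> enat \<Rightarrow> nat \<Rightarrow> real \<Rightarrow> real" where
  "Mfun lam p N j x = (\<Sum>\<^sub>\<infinity>k\<in>{k. 1 \<le> k \<and> enat k \<le> N}.
      (if barlam lam j k \<ge> exp (- x) then \<bar>ln (barlam lam j k)\<bar> ^ p * barlam lam j k else 0))"

end

theory Submission
  imports Defs
begin

text \<open>
  The normalised eigenvalues of \<open>X\<^sub>d\<close> form a product probability distribution, and the number of its atoms that
  are needed for mass \<open>1 - \<epsilon>\<^sup>2\<close> is governed by the quantile of the surprisal \<open>- ln p\<close>: there are at most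
  \<open>exp s\<close> atoms of surprisal at most \<open>s\<close>, and atoms of larger surprisal are too light to matter on the scale
  \<open>b\<^sub>d\<close>. As a self-decomposable distribution function is strictly increasing between \<open>0\<close> and \<open>1\<close>, the asymptotics
  of \<open>ln n(\<epsilon>)\<close> for all \<open>\<epsilon>\<close> amount to weak convergence of the normalised surprisal, which is a sum of
  independent non-negative variables forming a null array.

  Convergence of such row sums to the law with triplet \<open>(\<gamma>, \<sigma>\<^sup>2, L)\<close> is read off the sums of the centered laws of the
  array, tested against functions \<open>F\<close> with \<open>F x \<sim> l x\<^sup>2\<close> at \<open>0\<close>: their limit has to be
  \<open>l \<sigma>\<^sup>2 + \<integral> F dL\<close>. Tails and truncated variances yield this limit by splitting \<open>F\<close> at a small level; conversely
  averaging second differences of the accompanying exponents over \<open>[-1, 1]\<close> turns them into characteristic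
  functions of finite measures with density \<open>1 - sin x / x\<close>, to which Levy's continuity theorem applies. Tails
  converge at every \<open>x > 0\<close>, not only at continuity points of \<open>L\<close>: the summands do not depend on \<open>d\<close> before
  norming, so a jump of \<open>L\<close> would be inherited by all smaller scales.
\<close>

section \<open>Finite sums of measures\<close>

definition sum_measure :: "'a measure \<Rightarrow> 'i set \<Rightarrow> ('i \<Rightarrow> 'a measure) \<Rightarrow> 'a measure" where
  "sum_measure M I N = measure_of (space M) (sets M) (\<lambda>A. \<Sum>i\<in>I. emeasure (N i) A)"

lemma sets_sum_measure [measurable_cong, simp]: "sets (sum_measure M I N) = sets M"
  by (simp add: sum_measure_def)

lemma space_sum_measure [simp]: "space (sum_measure M I N) = space M"
  by (simp add: sum_measure_def)

lemma measurable_sum_measure [simp]: "measurable (sum_measure M I N) K = measurable M K"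
  by (rule measurable_cong_sets) simp_all

context
  fixes M :: "'a measure" and I :: "'i set" and N :: "'i \<Rightarrow> 'a measure"
  assumes sets_N: "\<And>i. i \<in> I \<Longrightarrow> sets (N i) = sets M"
begin

lemma emeasure_sum_measure:
  assumes "A \<in> sets M"
  shows "emeasure (sum_measure M I N) A = (\<Sum>i\<in>I. emeasure (N i) A)"
  unfolding sum_measure_def
proof (rule emeasure_measure_of_sigma)
  show "countably_additive (sets M) (\<lambda>A. \<Sum>i\<in>I. emeasure (N i) A)"
  proof (rule countably_additiveI)
    fix F :: "nat \<Rightarrow> 'a set"
    assume F: "range F \<subseteq> sets M" "disjoint_family F"
    have "(\<Sum>n. \<Sum>i\<in>I. emeasure (N i) (F n)) = (\<Sum>i\<in>I. \<Sum>n. emeasure (N i) (F n))"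
      by (rule suminf_sum) auto
    also have "\<dots> = (\<Sum>i\<in>I. emeasure (N i) (\<Union> (range F)))"
      using F sets_N by (intro sum.cong refl suminf_emeasure) auto
    finally show "(\<Sum>n. \<Sum>i\<in>I. emeasure (N i) (F n)) = (\<Sum>i\<in>I. emeasure (N i) (\<Union> (range F)))" .
  qed
qed (use assms in \<open>auto simp: positive_def sets.sigma_algebra_axioms\<close>)

lemma nn_integral_sum_measure:
  assumes "f \<in> borel_measurable M"
  shows "(\<integral>\<^sup>+x. f x \<partial>sum_measure M I N) = (\<Sum>i\<in>I. \<integral>\<^sup>+x. f x \<partial>N i)"
proof -
  have meas: "(borel_measurable (N i) :: ('a \<Rightarrow> ennreal) set) = borel_measurable M" if "i \<in> I" for i
    by (rule measurable_cong_sets[OF sets_N[OF that] refl])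
  have space: "space (N i) = space M" if "i \<in> I" for i
    using sets_eq_imp_space_eq[OF sets_N[OF that]] .
  show ?thesis
    using assms
  proof (induction rule: borel_measurable_induct)
    case (cong f g)
    then have "(\<integral>\<^sup>+x. f x \<partial>N i) = (\<integral>\<^sup>+x. g x \<partial>N i)" if "i \<in> I" for i
      using space[OF that] by (intro nn_integral_cong) simp
    moreover have "(\<integral>\<^sup>+x. f x \<partial>sum_measure M I N) = (\<integral>\<^sup>+x. g x \<partial>sum_measure M I N)"
      using cong by (intro nn_integral_cong) simp
    ultimately show ?case using cong by simp
  next
    case (set A)
    then show ?case by (simp add: emeasure_sum_measure sets_N)
  next
    case (mult u c)
    then show ?case by (simp add: nn_integral_cmult meas sum_distrib_left cong: sum.cong)
  next
    case (add u v)
    then show ?case by (simp add: nn_integral_add meas sum.distrib cong: sum.cong)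
  next
    case (seq U)
    have incseq_integral: "incseq (\<lambda>n. \<integral>\<^sup>+x. U n x \<partial>N i)" for i
      using seq by (auto intro!: incseq_SucI nn_integral_mono dest: incseq_SucD le_funD)
    have "(\<integral>\<^sup>+x. (SUP n. U n) x \<partial>sum_measure M I N) = (SUP n. \<Sum>i\<in>I. \<integral>\<^sup>+x. U n x \<partial>N i)"
      unfolding SUP_apply using seq by (subst nn_integral_monotone_convergence_SUP) auto
    also have "\<dots> = (\<Sum>i\<in>I. SUP n. \<integral>\<^sup>+x. U n x \<partial>N i)"
      by (intro ennreal_SUP_sum incseq_integral)
    also have "\<dots> = (\<Sum>i\<in>I. \<integral>\<^sup>+x. (SUP n. U n) x \<partial>N i)"
      unfolding SUP_apply using seq meas
      by (intro sum.cong refl nn_integral_monotone_convergence_SUP[symmetric]) auto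
    finally show ?case .
  qed
qed

lemma measure_sum_measure:
  assumes "finite I" "A \<in> sets M" "emeasure (sum_measure M I N) A \<noteq> \<infinity>"
  shows "measure (sum_measure M I N) A = (\<Sum>i\<in>I. measure (N i) A)"
  using assms by (simp add: measure_def emeasure_sum_measure enn2real_sum ennreal_sum_less_top less_top)

lemma integrable_sum_measureD:
  fixes f :: "'a \<Rightarrow> 'b::{banach, second_countable_topology}"
  assumes I: "finite I" "i \<in> I" and f: "integrable (sum_measure M I N) f"
  shows "integrable (N i) f"
proof -
  have meas [measurable]: "f \<in> borel_measurable M"
    using borel_measurable_integrable[OF f] by simp
  have "(\<Sum>i\<in>I. \<integral>\<^sup>+x. ennreal (norm (f x)) \<partial>N i) < \<infinity>"
    using f by (subst nn_integral_sum_measure[symmetric]) (auto simp: integrable_iff_bounded)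
  moreover have "f \<in> borel_measurable (N i)"
    using meas sets_N[OF I(2)] measurable_cong_sets by blast
  ultimately show ?thesis
    using I by (simp add: integrable_iff_bounded ennreal_sum_less_top less_top)
qed

lemma integral_sum_measure:
  fixes f :: "'a \<Rightarrow> 'b::{banach, second_countable_topology}"
  assumes I: "finite I" and f: "integrable (sum_measure M I N) f"
  shows "(\<integral>x. f x \<partial>sum_measure M I N) = (\<Sum>i\<in>I. \<integral>x. f x \<partial>N i)"
  using f
proof (induction rule: integrable_induct)
  case (base A c)
  then have "measure (sum_measure M I N) A = (\<Sum>i\<in>I. measure (N i) A)"
    by (intro measure_sum_measure I) auto
  moreover have "emeasure (N i) A < \<infinity>" if "i \<in> I" for i
    using base I that by (simp add: emeasure_sum_measure ennreal_sum_less_top less_top)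
  ultimately show ?case
    using base by (simp add: sets_N scaleR_sum_left cong: sum.cong)
next
  case (add f g)
  then show ?case
    by (simp add: integrable_sum_measureD[OF I] sum.distrib cong: sum.cong)
next
  case (lim f s)
  have dominated: "(\<lambda>n. \<integral>x. s n x \<partial>K) \<longlonglongrightarrow> (\<integral>x. f x \<partial>K)"
    if "integrable K f" "\<And>n. integrable K (s n)" "space K = space M" for K
    using lim that
    by (intro integral_dominated_convergence[where w="\<lambda>x. 2 * norm (f x)"] AE_I2) auto
  have "(\<lambda>n. \<integral>x. s n x \<partial>sum_measure M I N) \<longlonglongrightarrow> (\<integral>x. f x \<partial>sum_measure M I N)"
    by (rule dominated) (use lim in auto)
  moreover have "(\<lambda>n. \<Sum>i\<in>I. \<integral>x. s n x \<partial>N i) \<longlonglongrightarrow> (\<Sum>i\<in>I. \<integral>x. f x \<partial>N i)"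
    by (intro tendsto_sum dominated integrable_sum_measureD[OF I] sets_eq_imp_space_eq[OF sets_N] lim)
  ultimately show ?case
    unfolding lim.IH by (rule LIMSEQ_unique)
qed

end

lemma finite_borel_measure_sum_measure:
  assumes "finite I" "\<And>i. i \<in> I \<Longrightarrow> finite_borel_measure (N i)"
  shows "finite_borel_measure (sum_measure borel I N)"
proof (intro finite_borel_measure.intro finite_borel_measure_axioms.intro finite_measureI)
  have sets: "sets (N i) = sets borel" if "i \<in> I" for i
    using finite_borel_measure.M_is_borel[OF assms(2)[OF that]] .
  have "emeasure (N i) UNIV \<noteq> \<infinity>" if "i \<in> I" for i
    using assms(2)[OF that] finite_measure.emeasure_finite by (auto simp: finite_borel_measure_def)
  then show "emeasure (sum_measure borel I N) (space (sum_measure borel I N)) \<noteq> \<infinity>"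
    using assms(1) by (simp add: emeasure_sum_measure[OF sets])
qed simp

section \<open>Weak convergence of finite measures\<close>

lemma integral_uniform_measure:
  fixes f :: "'a \<Rightarrow> 'b::{banach, second_countable_topology}"
  assumes A: "emeasure M A \<noteq> 0" "emeasure M A \<noteq> \<infinity>" and [measurable]: "f \<in> borel_measurable M"
  shows "(\<integral>x. f x \<partial>uniform_measure M A) = (LINT x:A|M. f x) /\<^sub>R measure M A"
proof -
  have [measurable]: "A \<in> sets M" using A(1) by (rule emeasure_neq_0_sets)
  have "uniform_measure M A = density M (\<lambda>x. ennreal (indicator A x / measure M A))"
    unfolding uniform_measure_def
    using A by (intro density_cong AE_I2)
      (auto simp: emeasure_eq_ennreal_measure divide_ennreal[of 1, simplified] zero_less_measure_iff
        split: split_indicator)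
  then have "(\<integral>x. f x \<partial>uniform_measure M A) = (\<integral>x. inverse (measure M A) *\<^sub>R (indicator A x *\<^sub>R f x) \<partial>M)"
    by (simp add: integral_density divide_inverse mult.commute)
  then show ?thesis
    by (simp only: integral_scaleR_right set_lebesgue_integral_def)
qed

definition normalize_measure :: "real measure \<Rightarrow> real measure" where
  "normalize_measure M = (if measure M UNIV = 0 then return borel 0 else uniform_measure M UNIV)"

lemma real_distribution_return: "real_distribution (return borel x)"
  by (simp add: real_distribution_def real_distribution_axioms_def prob_space_return)

context finite_borel_measure
begin

lemma borel_measurable_eq: "borel_measurable M = borel_measurable borel"
  by (rule measurable_cong_sets[OF M_is_borel refl])

lemma integrable_bounded:
  fixes f :: "real \<Rightarrow> 'b::{banach, second_countable_topology}"
  assumes "f \<in> borel_measurable borel" "\<And>x. norm (f x) \<le> B"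
  shows "integrable M f"
  using assms by (intro integrable_const_bound[of _ B]) (auto simp: borel_measurable_eq)

lemma norm_integral_bounded_le:
  fixes f :: "real \<Rightarrow> 'b::{banach, second_countable_topology}"
  assumes f: "f \<in> borel_measurable borel" "\<And>x. norm (f x) \<le> B"
  shows "norm (\<integral>x. f x \<partial>M) \<le> B * measure M UNIV"
proof -
  have "norm (\<integral>x. f x \<partial>M) \<le> (\<integral>x. B \<partial>M)"
    by (intro Bochner_Integration.integral_norm_bound_integral integrable_bounded[OF f] f(2)) simp
  then show ?thesis by (simp add: borel_UNIV mult.commute)
qed

lemma real_distribution_normalize_measure: "real_distribution (normalize_measure M)"
proof (cases "measure M UNIV = 0")
  case True
  then show ?thesis by (simp add: normalize_measure_def real_distribution_return)
next
  case False
  then have "prob_space (uniform_measure M UNIV)"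
    by (intro prob_space_uniform_measure) (auto simp: emeasure_eq_measure)
  with False show ?thesis
    by (simp add: normalize_measure_def real_distribution_def real_distribution_axioms_def M_is_borel)
qed

lemma integral_normalize_measure:
  fixes f :: "real \<Rightarrow> 'b::{banach, second_countable_topology}"
  assumes "measure M UNIV \<noteq> 0" "f \<in> borel_measurable borel"
  shows "(\<integral>x. f x \<partial>normalize_measure M) = (\<integral>x. f x \<partial>M) /\<^sub>R measure M UNIV"
  using assms
  by (simp add: normalize_measure_def integral_uniform_measure emeasure_eq_measure borel_measurable_eq
      set_lebesgue_integral_def)

lemma cdf_normalize_measure:
  "measure M UNIV \<noteq> 0 \<Longrightarrow> cdf (normalize_measure M) x = cdf M x / measure M UNIV"
  by (simp add: normalize_measure_def cdf_def M_is_borel emeasure_eq_measure)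

end

context
  fixes H :: "nat \<Rightarrow> real measure" and H' :: "real measure"
  assumes finite_H: "\<And>n. finite_borel_measure (H n)" and finite_H': "finite_borel_measure H'"
begin

interpretation H: finite_borel_measure "H n" for n by (rule finite_H)
interpretation H': finite_borel_measure H' by (rule finite_H')

lemma integral_tendsto_of_weak_conv_normalize_measure:
  fixes f :: "real \<Rightarrow> 'b::{banach, second_countable_topology}"
  assumes mass: "(\<lambda>n. measure (H n) UNIV) \<longlonglongrightarrow> measure H' UNIV"
    and weak: "measure H' UNIV \<noteq> 0 \<Longrightarrow> weak_conv_m (\<lambda>n. normalize_measure (H n)) (normalize_measure H')"
    and f: "\<And>x. isCont f x" "\<And>x. norm (f x) \<le> B"
  shows "(\<lambda>n. \<integral>x. f x \<partial>H n) \<longlonglongrightarrow> (\<integral>x. f x \<partial>H')"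
proof -
  have [measurable]: "f \<in> borel_measurable borel"
    using f(1) by (intro borel_measurable_continuous_onI continuous_at_imp_continuous_on) auto
  show ?thesis
  proof (cases "measure H' UNIV = 0")
    case True
    have "(\<lambda>n. B * measure (H n) UNIV) \<longlonglongrightarrow> 0"
      using tendsto_mult_left[OF mass, of B] True by simp
    then have "(\<lambda>n. \<integral>x. f x \<partial>H n) \<longlonglongrightarrow> 0"
      by (rule Lim_null_comparison[rotated]) (simp add: H.norm_integral_bounded_le f(2))
    moreover have "(\<integral>x. f x \<partial>H') = 0"
      using H'.norm_integral_bounded_le[of f B] f(2) True by simp
    ultimately show ?thesis by simp
  next
    case False
    have "(\<lambda>n. \<integral>x. f x \<partial>normalize_measure (H n)) \<longlonglongrightarrow> (\<integral>x. f x \<partial>normalize_measure H')"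
      by (rule weak_conv_imp_integral_bdd_continuous_conv[OF H.real_distribution_normalize_measure
          H'.real_distribution_normalize_measure weak[OF False] f])
    from tendsto_scaleR[OF mass this]
    have "(\<lambda>n. measure (H n) UNIV *\<^sub>R (\<integral>x. f x \<partial>normalize_measure (H n))) \<longlonglongrightarrow> (\<integral>x. f x \<partial>H')"
      using False by (simp add: H'.integral_normalize_measure)
    moreover have "\<forall>\<^sub>F n in sequentially.
        measure (H n) UNIV *\<^sub>R (\<integral>x. f x \<partial>normalize_measure (H n)) = (\<integral>x. f x \<partial>H n)"
      using tendsto_imp_eventually_ne[OF mass False]
      by eventually_elim (simp add: H.integral_normalize_measure)
    ultimately show ?thesis by (rule Lim_transform_eventually)
  qed
qed

lemma finite_borel_measure_levy_continuity:
  fixes f :: "real \<Rightarrow> 'b::{banach, second_countable_topology}"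
  assumes conv: "\<And>t. (\<lambda>n. char (H n) t) \<longlonglongrightarrow> char H' t"
    and f: "\<And>x. isCont f x" "\<And>x. norm (f x) \<le> B"
  shows "(\<lambda>n. \<integral>x. f x \<partial>H n) \<longlonglongrightarrow> (\<integral>x. f x \<partial>H')"
proof (rule integral_tendsto_of_weak_conv_normalize_measure[OF _ _ f])
  show mass: "(\<lambda>n. measure (H n) UNIV) \<longlonglongrightarrow> measure H' UNIV"
    using tendsto_Re[OF conv[of 0]] by (simp add: char_def H.borel_UNIV H'.borel_UNIV)
  assume nonzero: "measure H' UNIV \<noteq> 0"
  show "weak_conv_m (\<lambda>n. normalize_measure (H n)) (normalize_measure H')"
  proof (rule levy_continuity[OF H.real_distribution_normalize_measure H'.real_distribution_normalize_measure])
    fix t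
    have "(\<lambda>n. char (H n) t /\<^sub>R measure (H n) UNIV) \<longlonglongrightarrow> char H' t /\<^sub>R measure H' UNIV"
      by (intro tendsto_scaleR tendsto_inverse conv mass nonzero)
    moreover have "\<forall>\<^sub>F n in sequentially. char (H n) t /\<^sub>R measure (H n) UNIV = char (normalize_measure (H n)) t"
      using tendsto_imp_eventually_ne[OF mass nonzero]
      by eventually_elim (simp add: char_def H.integral_normalize_measure)
    ultimately have "(\<lambda>n. char (normalize_measure (H n)) t) \<longlonglongrightarrow> char H' t /\<^sub>R measure H' UNIV"
      by (rule Lim_transform_eventually)
    then show "(\<lambda>n. char (normalize_measure (H n)) t) \<longlonglongrightarrow> char (normalize_measure H') t"
      using nonzero by (simp add: char_def H'.integral_normalize_measure)
  qed
qed

lemma integral_tendsto_of_cdf_tendsto: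
  fixes f :: "real \<Rightarrow> 'b::{banach, second_countable_topology}"
  assumes mass: "(\<lambda>n. measure (H n) UNIV) \<longlonglongrightarrow> measure H' UNIV"
    and conv: "\<And>x. isCont (cdf H') x \<Longrightarrow> (\<lambda>n. cdf (H n) x) \<longlonglongrightarrow> cdf H' x"
    and f: "\<And>x. isCont f x" "\<And>x. norm (f x) \<le> B"
  shows "(\<lambda>n. \<integral>x. f x \<partial>H n) \<longlonglongrightarrow> (\<integral>x. f x \<partial>H')"
proof (rule integral_tendsto_of_weak_conv_normalize_measure[OF mass _ f])
  assume nonzero: "measure H' UNIV \<noteq> 0"
  show "weak_conv_m (\<lambda>n. normalize_measure (H n)) (normalize_measure H')"
    unfolding weak_conv_m_def weak_conv_def
  proof (intro allI impI)
    fix x assume "isCont (cdf (normalize_measure H')) x"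
    then have "isCont (\<lambda>y. measure H' UNIV * cdf (normalize_measure H') y) x"
      by (intro continuous_intros)
    then have "isCont (cdf H') x"
      using nonzero by (simp add: H'.cdf_normalize_measure)
    then have "(\<lambda>n. cdf (H n) x / measure (H n) UNIV) \<longlonglongrightarrow> cdf H' x / measure H' UNIV"
      by (intro tendsto_divide conv mass nonzero)
    moreover have "\<forall>\<^sub>F n in sequentially. cdf (H n) x / measure (H n) UNIV = cdf (normalize_measure (H n)) x"
      using tendsto_imp_eventually_ne[OF mass nonzero]
      by eventually_elim (simp add: H.cdf_normalize_measure)
    ultimately have "(\<lambda>n. cdf (normalize_measure (H n)) x) \<longlonglongrightarrow> cdf H' x / measure H' UNIV"
      by (rule Lim_transform_eventually)
    then show "(\<lambda>n. cdf (normalize_measure (H n)) x) \<longlonglongrightarrow> cdf (normalize_measure H') x"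
      using nonzero by (simp add: H'.cdf_normalize_measure)
  qed
qed

end

section \<open>Characteristic functions\<close>

lemma norm_iexp_diff_le: "norm (iexp x - iexp y) \<le> \<bar>x - y\<bar>"
proof -
  have "iexp x - iexp y = iexp y * (iexp (x - y) - 1)"
    by (simp add: exp_diff algebra_simps)
  then have "norm (iexp x - iexp y) = norm (iexp (x - y) - 1)"
    by (simp add: norm_mult)
  then show ?thesis using iexp_approx1[of "x - y" 0] by simp
qed

lemma norm_iexp_diff_le_2: "norm (iexp x - iexp y) \<le> 2"
  using norm_triangle_ineq4[of "iexp x" "iexp y"] by simp

lemma norm_one_plus_minus_exp_le:
  fixes z :: complex
  assumes "norm z \<le> 1"
  shows "norm (1 + z - exp z) \<le> 3 * (norm z)\<^sup>2"
proof -
  have "exp \<bar>Re z\<bar> \<le> 3"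
    using exp_le exp_le_cancel_iff[of "\<bar>Re z\<bar>" 1] abs_Re_le_cmod[of z] assms by linarith
  have "norm (exp z - (\<Sum>i\<le>1. z ^ i / fact i)) \<le> exp \<bar>Re z\<bar> * norm z ^ Suc 1 / fact 1"
    by (rule Taylor_exp)
  also have "\<dots> \<le> 3 * (norm z)\<^sup>2"
    using mult_right_mono[OF \<open>exp \<bar>Re z\<bar> \<le> 3\<close>, of "(norm z)\<^sup>2"] by (simp add: power2_eq_square)
  finally show ?thesis by (simp add: norm_minus_commute)
qed

lemma sum_one_minus_le_ln_prod:
  fixes a :: "'a \<Rightarrow> real"
  assumes "finite I" "\<And>i. i \<in> I \<Longrightarrow> 0 \<le> a i" "0 < r" "r \<le> (\<Prod>i\<in>I. a i)"
  shows "(\<Sum>i\<in>I. 1 - a i) \<le> - ln r"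
proof -
  have "(\<Prod>i\<in>I. a i) \<noteq> 0" using assms(3,4) by linarith
  then have pos: "0 < a i" if "i \<in> I" for i
    using that assms(1,2) by (auto simp: less_le)
  have "(\<Sum>i\<in>I. 1 - a i) \<le> (\<Sum>i\<in>I. - ln (a i))"
    using ln_le_minus_one[OF pos] by (intro sum_mono) fastforce
  also have "\<dots> = - ln (\<Prod>i\<in>I. a i)"
    using pos assms(1) by (subst ln_prod) (auto simp: sum_negf less_imp_neq[THEN not_sym])
  also have "\<dots> \<le> - ln r"
    using assms(3,4) by simp
  finally show ?thesis .
qed

lemma eq_Ln_exp_of_continuous_on:
  fixes f :: "real \<Rightarrow> complex"
  assumes S: "connected S" "continuous_on S f" and "a \<in> S" "f a = 0" "t \<in> S"
    and near_1: "\<And>u. u \<in> S \<Longrightarrow> norm (exp (f u) - 1) < 1"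
  shows "f t = Ln (exp (f t))"
proof -
  define g where "g u = f u - Ln (exp (f u))" for u
  have Re_pos: "0 < Re (exp (f u))" if "u \<in> S" for u
    using near_1[OF that] abs_Re_le_cmod[of "exp (f u) - 1"] by (simp add: abs_le_iff)
  have cont: "continuous_on S g"
    unfolding g_def
  proof (intro continuous_on_diff continuous_on_Ln' continuous_on_exp S(2))
    show "exp (f u) \<notin> \<real>\<^sub>\<le>\<^sub>0" if "u \<in> S" for u
      using Re_pos[OF that] by (auto simp: complex_nonpos_Reals_iff)
  qed
  have "\<exists>n::int. g u = complex_of_real (of_int (2 * n) * pi) * \<i>" for u
  proof -
    have "exp (f u) = exp (Ln (exp (f u)))" by simp
    then obtain n :: int where "f u = Ln (exp (f u)) + complex_of_real (of_int (2 * n) * pi) * \<i>"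
      unfolding exp_eq by blast
    then have "g u = complex_of_real (of_int (2 * n) * pi) * \<i>"
      unfolding g_def by (simp only: diff_eq_eq add.commute)
    then show ?thesis ..
  qed
  then obtain n :: "real \<Rightarrow> int" where n: "\<And>u. g u = complex_of_real (of_int (2 * n u) * pi) * \<i>" by metis
  have "g constant_on S"
  proof (rule continuous_discrete_range_constant[OF S(1) cont])
    have "2 * pi \<le> norm (g v - g u)" if "g v \<noteq> g u" for u v
    proof -
      have "g v - g u = complex_of_real (2 * pi * of_int (n v - n u)) * \<i>"
        by (simp add: n algebra_simps)
      moreover have "1 \<le> \<bar>real_of_int (n v - n u)\<bar>" using that n by (cases "n v = n u") auto
      ultimately show ?thesis by (simp add: norm_mult del: of_int_diff)
    qed
    then show "\<exists>e>0. \<forall>v. v \<in> S \<and> g v \<noteq> g u \<longrightarrow> e \<le> norm (g v - g u)" for u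
      by (intro exI[of _ "2 * pi"]) auto
  qed
  then have "g t = g a" using assms(3,5) by (auto simp: constant_on_def)
  then show ?thesis using assms(4) by (simp add: g_def)
qed

lemma tendsto_0_of_exp_uniform_limit:
  fixes f :: "nat \<Rightarrow> real \<Rightarrow> complex"
  assumes cont: "\<And>n. continuous_on {-R..R} (f n)" and "\<And>n. f n 0 = 0" "\<bar>t\<bar> \<le> R"
    and lim: "uniform_limit {-R..R} (\<lambda>n u. exp (f n u)) (\<lambda>_. 1) sequentially"
  shows "(\<lambda>n. f n t) \<longlonglongrightarrow> 0"
proof -
  have "\<forall>\<^sub>F n in sequentially. \<forall>u\<in>{-R..R}. dist (exp (f n u)) 1 < 1"
    using lim by (rule uniform_limitD) simp
  then have "\<forall>\<^sub>F n in sequentially. Ln (exp (f n t)) = f n t"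
  proof eventually_elim
    case (elim n)
    show ?case
      using assms(2,3) elim
      by (intro eq_Ln_exp_of_continuous_on[OF _ cont, of 0, symmetric]) (auto simp: dist_norm abs_le_iff)
  qed
  moreover have "(\<lambda>n. Ln (exp (f n t))) \<longlonglongrightarrow> Ln 1"
    using tendsto_uniform_limitI[OF lim, of t] \<open>\<bar>t\<bar> \<le> R\<close> by (intro tendsto_Ln) (auto simp: abs_le_iff)
  ultimately show ?thesis
    using Lim_transform_eventually by fastforce
qed

lemma (in prob_space) norm_char_distr_diff_le_expectation:
  assumes [measurable]: "X \<in> borel_measurable M" "Y \<in> borel_measurable M" "g \<in> borel_measurable M"
    and bound: "\<And>\<omega>. \<omega> \<in> space M \<Longrightarrow> norm (iexp (t * X \<omega>) - iexp (t * Y \<omega>)) \<le> g \<omega>"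
      "\<And>\<omega>. \<omega> \<in> space M \<Longrightarrow> g \<omega> \<le> 2"
  shows "norm (char (distr M borel X) t - char (distr M borel Y) t) \<le> expectation g"
proof -
  have int: "complex_integrable M (\<lambda>\<omega>. iexp (t * Z \<omega>))" if "Z \<in> borel_measurable M" for Z
    using that by (intro integrable_iexp) auto
  have int_g: "integrable M g"
    using bound order_trans[OF norm_ge_zero bound(1)]
    by (intro integrable_const_bound[of _ 2] AE_I2) (auto simp: abs_le_iff intro: order_trans)
  have "char (distr M borel X) t - char (distr M borel Y) t
      = expectation (\<lambda>\<omega>. iexp (t * X \<omega>) - iexp (t * Y \<omega>))"
    by (simp add: char_def integral_distr int del: of_real_mult)
  also have "norm \<dots> \<le> expectation (\<lambda>\<omega>. norm (iexp (t * X \<omega>) - iexp (t * Y \<omega>)))"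
    by (rule integral_norm_bound)
  also have "\<dots> \<le> expectation g"
    by (rule integral_mono[OF _ int_g bound(1)]) (auto intro!: integrable_norm int simp del: of_real_mult)
  finally show ?thesis .
qed

lemma (in prob_space) norm_char_distr_diff_le_prob:
  assumes [measurable]: "X \<in> borel_measurable M" "Y \<in> borel_measurable M"
  shows "norm (char (distr M borel X) t - char (distr M borel Y) t) \<le> 2 * prob {\<omega> \<in> space M. X \<omega> \<noteq> Y \<omega>}"
proof -
  let ?D = "{\<omega> \<in> space M. X \<omega> \<noteq> Y \<omega>}"
  have "norm (char (distr M borel X) t - char (distr M borel Y) t) \<le> expectation (\<lambda>\<omega>. 2 * indicator ?D \<omega>)"
    by (rule norm_char_distr_diff_le_expectation)
      (auto simp: norm_iexp_diff_le_2 simp del: of_real_mult split: split_indicator)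
  then show ?thesis by simp
qed

lemma (in prob_space) norm_char_distr_diff_le_expectation_min:
  assumes [measurable]: "X \<in> borel_measurable M" "Y \<in> borel_measurable M" and t: "t \<in> {-R..R}"
  shows "norm (char (distr M borel X) t - char (distr M borel Y) t) \<le> expectation (\<lambda>\<omega>. min 2 (R * \<bar>X \<omega> - Y \<omega>\<bar>))"
proof (rule norm_char_distr_diff_le_expectation)
  show "norm (iexp (t * X \<omega>) - iexp (t * Y \<omega>)) \<le> min 2 (R * \<bar>X \<omega> - Y \<omega>\<bar>)" for \<omega>
  proof -
    have "\<bar>t * X \<omega> - t * Y \<omega>\<bar> \<le> R * \<bar>X \<omega> - Y \<omega>\<bar>"
      using t by (auto simp: abs_mult right_diff_distrib[symmetric] intro!: mult_right_mono)
    then show ?thesis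
      using norm_iexp_diff_le[of "t * X \<omega>" "t * Y \<omega>"] norm_iexp_diff_le_2[of "t * X \<omega>" "t * Y \<omega>"] by simp
  qed
qed auto

lemma weak_conv_m_imp_uniform_limit_char:
  assumes "\<And>n. real_distribution (P n)" "real_distribution Q" "weak_conv_m P Q"
  shows "uniform_limit {-R..R} (\<lambda>n. char (P n)) (char Q) sequentially"
proof (rule uniform_limitI)
  fix e :: real assume "e > 0"
  obtain \<Omega> :: "real measure" and X Y where \<Omega>: "prob_space \<Omega>"
    and meas: "\<And>n. X n \<in> borel_measurable \<Omega>" "Y \<in> measurable \<Omega> lborel"
    and distr: "\<And>n. distr \<Omega> borel (X n) = P n" "distr \<Omega> borel Y = Q"
    and lim: "\<And>x. x \<in> space \<Omega> \<Longrightarrow> (\<lambda>n. X n x) \<longlonglongrightarrow> Y x"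
    using Skorohod[OF assms] by blast
  note meas[simplified, measurable]
  interpret prob_space \<Omega> by fact
  define g where "g n x = min 2 (R * \<bar>X n x - Y x\<bar>)" for n x
  have [measurable]: "g n \<in> borel_measurable \<Omega>" for n unfolding g_def by measurable
  show "\<forall>\<^sub>F n in sequentially. \<forall>t\<in>{-R..R}. dist (char (P n) t) (char Q t) < e"
  proof (cases "R \<ge> 0")
    case True
    have "(\<lambda>n. expectation (g n)) \<longlonglongrightarrow> expectation (\<lambda>x. 0)"
    proof (rule integral_dominated_convergence[where w="\<lambda>_. 2"])
      have "(\<lambda>n. g n x) \<longlonglongrightarrow> min 2 (R * \<bar>Y x - Y x\<bar>)" if "x \<in> space \<Omega>" for x
        unfolding g_def using lim[OF that] by (intro tendsto_intros)
      then show "AE x in \<Omega>. (\<lambda>n. g n x) \<longlonglongrightarrow> 0" by (intro AE_I2) simp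
      show "AE x in \<Omega>. norm (g n x) \<le> 2" for n
        using True by (simp add: g_def)
    qed auto
    then have "\<forall>\<^sub>F n in sequentially. expectation (g n) < e"
      using \<open>e > 0\<close> by (simp add: order_tendstoD)
    then show ?thesis
    proof (rule eventually_mono, intro ballI)
      fix n t assume "expectation (g n) < e" and t: "t \<in> {-R..R}"
      have "norm (char (P n) t - char Q t) \<le> expectation (g n)"
        unfolding distr[symmetric] g_def using t by (intro norm_char_distr_diff_le_expectation_min) auto
      also note \<open>expectation (g n) < e\<close>
      finally show "dist (char (P n) t) (char Q t) < e" by (simp add: dist_norm)
    qed
  qed simp
qed

lemma weak_conv_m_iff_char_tendsto:
  assumes "\<And>n. real_distribution (P n)" "real_distribution Q"
  shows "weak_conv_m P Q \<longleftrightarrow> (\<forall>t. (\<lambda>n. char (P n) t) \<longlonglongrightarrow> char Q t)"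
proof (intro iffI allI)
  show "(\<lambda>n. char (P n) t) \<longlonglongrightarrow> char Q t" if "weak_conv_m P Q" for t
    by (rule levy_continuity1[OF assms that])
  show "weak_conv_m P Q" if "\<forall>t. (\<lambda>n. char (P n) t) \<longlonglongrightarrow> char Q t"
    by (rule levy_continuity[OF assms that[rule_format]])
qed

lemma weak_conv_m_cong_char:
  assumes "\<And>n. real_distribution (P n)" "\<And>n. real_distribution (P' n)" "real_distribution Q"
    and "\<And>t. (\<lambda>n. char (P n) t - char (P' n) t) \<longlonglongrightarrow> 0"
  shows "weak_conv_m P Q \<longleftrightarrow> weak_conv_m P' Q"
  unfolding weak_conv_m_iff_char_tendsto[OF assms(1,3)] weak_conv_m_iff_char_tendsto[OF assms(2,3)]
  by (intro all_cong1 Lim_transform_eq assms)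

lemma integral_convolution:
  fixes f :: "real \<Rightarrow> 'b::{banach, second_countable_topology}"
  assumes "real_distribution P" "real_distribution Q" and f: "f \<in> borel_measurable borel" "\<And>x. norm (f x) \<le> B"
  shows "(\<integral>x. f x \<partial>(P \<star> Q)) = (\<integral>x. \<integral>y. f (x + y) \<partial>Q \<partial>P)"
proof -
  interpret P: real_distribution P by fact
  interpret Q: real_distribution Q by fact
  interpret PQ: pair_prob_space P Q ..
  note f(1)[measurable]
  have "(\<integral>x. f x \<partial>(P \<star> Q)) = (\<integral>z. f (fst z + snd z) \<partial>(P \<Otimes>\<^sub>M Q))"
    unfolding convolution_def by (subst integral_distr) (auto simp: case_prod_beta)
  also have "\<dots> = (\<integral>x. \<integral>y. f (x + y) \<partial>Q \<partial>P)"
    using f(2) by (subst PQ.integral_fst'[symmetric]) (auto intro!: PQ.P.integrable_const_bound[of _ B])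
  finally show ?thesis .
qed

lemma real_distribution_convolution:
  assumes "real_distribution P" "real_distribution Q"
  shows "real_distribution (P \<star> Q)"
proof -
  interpret P: real_distribution P by fact
  interpret Q: real_distribution Q by fact
  interpret PQ: pair_prob_space P Q ..
  show ?thesis unfolding convolution_def by (rule PQ.P.real_distribution_distr) measurable
qed

lemma char_convolution:
  assumes "real_distribution P" "real_distribution Q"
  shows "char (P \<star> Q) t = char P t * char Q t"
proof -
  have "char (P \<star> Q) t = (CLINT x|P. CLINT y|Q. iexp (t * (x + y)))"
    unfolding char_def by (rule integral_convolution[OF assms, where B=1]) auto
  also have "\<dots> = (CLINT x|P. CLINT y|Q. iexp (t * x) * iexp (t * y))"
    by (simp add: distrib_left exp_add)
  finally show ?thesis by (simp add: char_def)
qed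

section \<open>Averaged second differences\<close>

definition second_difference :: "(real \<Rightarrow> complex) \<Rightarrow> real \<Rightarrow> real \<Rightarrow> complex" where
  "second_difference g t s = g t - (g (t + s) + g (t - s)) / 2"

lemma second_difference_add:
  "second_difference (\<lambda>t. f t + g t) t s = second_difference f t s + second_difference g t s"
  by (simp add: second_difference_def field_simps)

lemma second_difference_sum:
  "second_difference (\<lambda>t. \<Sum>i\<in>I. g i t) t s = (\<Sum>i\<in>I. second_difference (g i) t s)"
  by (simp add: second_difference_def sum_subtractf sum_divide_distrib[symmetric] sum.distrib)

lemma second_difference_linear: "second_difference (\<lambda>t. \<i> * complex_of_real (t * c)) t s = 0"
  by (simp add: second_difference_def field_simps)

lemma second_difference_square:
  "second_difference (\<lambda>t. complex_of_real (c * t\<^sup>2)) t s = - complex_of_real (c * s\<^sup>2)"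
  by (simp add: second_difference_def field_simps power2_eq_square)

lemma second_difference_minus_const:
  "second_difference (\<lambda>u. g u - c) t s = second_difference g t s"
  by (simp add: second_difference_def diff_divide_distrib add_divide_distrib)

lemma second_difference_const: "second_difference (\<lambda>_. c) t s = 0"
  by (simp add: second_difference_def)

lemma second_difference_iexp:
  "second_difference (\<lambda>t. iexp (t * x)) t s = iexp (t * x) * complex_of_real (1 - cos (s * x))"
proof -
  have "iexp (s * x) + iexp (- (s * x)) = 2 * complex_of_real (cos (s * x))"
    unfolding cis_conv_exp[symmetric] by (simp add: complex_eq_iff)
  moreover have "iexp ((t + s) * x) = iexp (t * x) * iexp (s * x)"
    "iexp ((t - s) * x) = iexp (t * x) * iexp (- (s * x))"
    by (simp_all add: algebra_simps exp_add[symmetric])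
  ultimately have "iexp ((t + s) * x) + iexp ((t - s) * x) = 2 * (iexp (t * x) * complex_of_real (cos (s * x)))"
    by (simp only: distrib_left[symmetric] mult.left_commute)
  then show ?thesis by (simp add: second_difference_def right_diff_distrib)
qed

lemma second_difference_integral:
  assumes "\<And>t. complex_integrable K (g t)"
  shows "second_difference (\<lambda>t. CLINT x|K. g t x) t s = (CLINT x|K. second_difference (\<lambda>t. g t x) t s)"
  using assms by (simp add: second_difference_def)

lemma norm_second_difference_le:
  assumes "\<And>u. \<bar>u\<bar> \<le> \<bar>t\<bar> + \<bar>s\<bar> \<Longrightarrow> norm (g u) \<le> B"
  shows "norm (second_difference g t s) \<le> 2 * B"
proof -
  have "norm (second_difference g t s) \<le> norm (g t) + norm (g (t + s) + g (t - s)) / 2"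
    unfolding second_difference_def by (rule order_trans[OF norm_triangle_ineq4]) (simp add: norm_divide)
  also have "\<dots> \<le> B + (B + B) / 2"
    by (intro add_mono divide_right_mono order_trans[OF norm_triangle_ineq] assms) auto
  finally show ?thesis by simp
qed

lemma continuous_second_difference:
  assumes "\<And>u. isCont g u"
  shows "isCont (second_difference g t) s"
  unfolding second_difference_def[abs_def]
  by (intro continuous_intros isCont_o2[OF _ assms]) auto

abbreviation unif :: "real measure" where
  "unif \<equiv> uniform_measure lborel {-1..1}"

interpretation unif: real_distribution unif
  by (simp add: real_distribution_def real_distribution_axioms_def prob_space_uniform_measure)

lemma AE_unif: "AE s in unif. \<bar>s\<bar> \<le> 1"
  by (rule AE_uniform_measureI) auto

lemma integral_unif:
  fixes f :: "real \<Rightarrow> real"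
  assumes "f \<in> borel_measurable borel"
  shows "(\<integral>s. f s \<partial>unif) = (\<integral>s. f s * indicator {-1..1} s \<partial>lborel) / 2"
  using assms by (simp add: integral_uniform_measure set_lebesgue_integral_def mult.commute)

definition avg_second_difference :: "(real \<Rightarrow> complex) \<Rightarrow> real \<Rightarrow> complex" where
  "avg_second_difference g t = (CLINT s|unif. second_difference g t s)"

definition one_minus_sinc :: "real \<Rightarrow> real" where
  "one_minus_sinc x = 1 - sinc x"

lemma isCont_one_minus_sinc: "isCont one_minus_sinc x"
  unfolding one_minus_sinc_def[abs_def] by (intro continuous_diff continuous_const isCont_sinc)

lemma one_minus_sinc_measurable [measurable]: "one_minus_sinc \<in> borel_measurable borel"
  unfolding one_minus_sinc_def[abs_def] by measurable

lemma one_minus_sinc_0 [simp]: "one_minus_sinc 0 = 0"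
  by (simp add: one_minus_sinc_def)

lemma integral_unif_one_minus_cos: "(\<integral>s. 1 - cos (s * x) \<partial>unif) = one_minus_sinc x"
proof (cases "x = 0")
  case False
  have "(\<integral>s. (1 - cos (s * x)) * indicator {-1..1} s \<partial>lborel) = (1 - sin (1 * x) / x) - (-1 - sin (-1 * x) / x)"
    using False by (intro integral_FTC_Icc_real[where F="\<lambda>s. s - sin (s * x) / x"])
      (auto intro!: derivative_eq_intros continuous_intros)
  then show ?thesis using False by (simp add: integral_unif one_minus_sinc_def)
qed simp

lemma integral_unif_square: "(\<integral>s. s\<^sup>2 \<partial>unif) = 1/3"
proof -
  have "(\<integral>s. s\<^sup>2 * indicator {-1..1} s \<partial>lborel) = 1^3/3 - (-1)^3/(3::real)"
    by (intro integral_FTC_Icc_real[where F="\<lambda>s. s^3/3"])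
      (auto intro!: derivative_eq_intros continuous_intros)
  then show ?thesis by (simp add: integral_unif)
qed

lemma one_minus_sinc_taylor: "\<bar>one_minus_sinc x - x\<^sup>2 / 6\<bar> \<le> x^4 / 120"
proof (cases "x = 0")
  case False
  have "{..<5} = {0, 1, 2, 3, 4::nat}" by auto
  then have partial_sum: "(\<Sum>m<5. sin_coeff m * x ^ m) = x - x^3/6"
    by (simp add: sin_coeff_def fact_numeral)
  have "\<bar>sin x - (x - x^3/6)\<bar> \<le> \<bar>x\<bar>^5 / 120"
    using Maclaurin_sin_bound[of x 5] unfolding partial_sum by (simp add: fact_numeral field_simps)
  then have "\<bar>sin x - (x - x^3/6)\<bar> / \<bar>x\<bar> \<le> \<bar>x\<bar>^5 / 120 / \<bar>x\<bar>"
    by (rule divide_right_mono) simp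
  moreover have "one_minus_sinc x - x\<^sup>2/6 = - ((sin x - (x - x^3/6)) / x)"
    using False by (simp add: one_minus_sinc_def field_simps eval_nat_numeral)
  ultimately show ?thesis
    using False by (simp add: abs_divide eval_nat_numeral)
qed simp

lemma one_minus_sinc_nonneg: "0 \<le> one_minus_sinc x"
  using abs_sin_x_le_abs_x[of x]
  by (cases "x > 0") (auto simp: one_minus_sinc_def field_simps abs_if split: if_splits)

lemma one_minus_sinc_le_2: "one_minus_sinc x \<le> 2"
proof (cases "x = 0")
  case False
  have "\<bar>sin x / x\<bar> \<le> 1" using abs_sin_x_le_abs_x[of x] False by (simp add: abs_divide)
  then have "- (sin x / x) \<le> 1" by linarith
  then show ?thesis using False by (simp add: one_minus_sinc_def)
qed simp

lemma min_1_square_le_one_minus_sinc: "min 1 (x\<^sup>2) \<le> 8 * one_minus_sinc x"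
proof (cases "\<bar>x\<bar> \<le> 2")
  case True
  then have "x\<^sup>2 \<le> 4" using abs_le_square_iff[of x 2] by simp
  then have "x^4 \<le> 4 * x\<^sup>2"
    using mult_right_mono[of "x\<^sup>2" 4 "x\<^sup>2"] by (simp add: eval_nat_numeral)
  then have "x\<^sup>2 \<le> 8 * one_minus_sinc x"
    using one_minus_sinc_taylor[of x] by linarith
  then show ?thesis by (simp add: min_def)
next
  case False
  have "\<bar>sin x / x\<bar> \<le> 1 / 2"
    unfolding abs_divide using False abs_sin_le_one[of x] by (intro frac_le) auto
  then have "1/2 \<le> one_minus_sinc x"
    using False by (auto simp: one_minus_sinc_def abs_le_iff)
  then show ?thesis by (simp add: min_def)
qed

lemma one_minus_sinc_le_min_1_square: "one_minus_sinc x \<le> 2 * min 1 (x\<^sup>2)"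
proof (cases "\<bar>x\<bar> \<le> 1")
  case True
  then have "x\<^sup>2 \<le> 1" by (simp add: abs_square_le_1)
  then have "x^4 \<le> x\<^sup>2"
    using mult_right_mono[of "x\<^sup>2" 1 "x\<^sup>2"] by (simp add: eval_nat_numeral)
  then have "one_minus_sinc x \<le> 2 * x\<^sup>2"
    using one_minus_sinc_taylor[of x] zero_le_power2[of x] by linarith
  then show ?thesis using \<open>x\<^sup>2 \<le> 1\<close> by (simp add: min_def)
next
  case False
  then have "1 \<le> x\<^sup>2" using abs_le_square_iff[of 1 x] by simp
  then show ?thesis using one_minus_sinc_le_2 by simp
qed

lemma one_minus_sinc_pos: "x \<noteq> 0 \<Longrightarrow> 0 < one_minus_sinc x"
  using min_1_square_le_one_minus_sinc[of x] by (auto simp: min_def split: if_splits) (smt (verit) zero_less_power2)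

lemma square_over_one_minus_sinc_tendsto: "((\<lambda>x. x\<^sup>2 / one_minus_sinc x) \<longlongrightarrow> 6) (at 0)"
proof -
  have "((\<lambda>x. one_minus_sinc x / x\<^sup>2) \<longlongrightarrow> 1/6) (at 0)"
  proof (rule LIM_zero_cancel, rule Lim_null_comparison)
    show "((\<lambda>x::real. x\<^sup>2 / 120) \<longlongrightarrow> 0) (at 0)"
      by (auto intro!: tendsto_eq_intros)
    have "norm (one_minus_sinc x / x\<^sup>2 - 1/6) \<le> x\<^sup>2 / 120" if "x \<noteq> 0" for x
    proof -
      have "\<bar>one_minus_sinc x - x\<^sup>2 / 6\<bar> / x\<^sup>2 \<le> x^4 / 120 / x\<^sup>2"
        by (rule divide_right_mono[OF one_minus_sinc_taylor]) simp
      moreover have "one_minus_sinc x / x\<^sup>2 - 1/6 = (one_minus_sinc x - x\<^sup>2 / 6) / x\<^sup>2"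
        using that by (simp add: field_simps)
      ultimately show ?thesis
        using that by (simp add: abs_divide eval_nat_numeral)
    qed
    then show "\<forall>\<^sub>F x in at 0. norm (one_minus_sinc x / x\<^sup>2 - 1/6) \<le> x\<^sup>2 / 120"
      by (auto simp: eventually_at_filter)
  qed
  then have "((\<lambda>x. inverse (one_minus_sinc x / x\<^sup>2)) \<longlongrightarrow> inverse (1/6)) (at 0)"
    by (rule tendsto_inverse) simp
  then show ?thesis by simp
qed

lemma integral_unif_integral_iexp_one_minus_cos:
  fixes K :: "real measure"
  assumes "sigma_finite_measure K" and sets: "sets K = sets borel" and int: "integrable K (\<lambda>x. min 1 (x\<^sup>2))"
  shows "(CLINT s|unif. CLINT x|K. iexp (t * x) * complex_of_real (1 - cos (s * x)))
      = (CLINT x|K. complex_of_real (one_minus_sinc x) * iexp (t * x))"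
proof -
  interpret K: sigma_finite_measure K by fact
  interpret P: pair_sigma_finite K unif ..
  note [measurable_cong] = sets
  let ?f = "\<lambda>x s. iexp (t * x) * complex_of_real (1 - cos (s * x))"
  have norm_f: "norm (?f x s) = 1 - cos (s * x)" for x s
    by (simp add: norm_mult del: of_real_diff)
  have "(CLINT s|unif. CLINT x|K. ?f x s) = (CLINT x|K. CLINT s|unif. ?f x s)"
  proof (rule P.Fubini_integral, rule P.Fubini_integrable)
    have "integrable K one_minus_sinc"
      using Bochner_Integration.integrable_mult_right[OF int, of 2]
      by (rule Bochner_Integration.integrable_bound)
        (auto simp: one_minus_sinc_nonneg one_minus_sinc_le_min_1_square)
    then show "integrable K (\<lambda>x. \<integral>s. norm (case (x, s) of (x, s) \<Rightarrow> ?f x s) \<partial>unif)"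
      by (simp only: prod.case norm_f integral_unif_one_minus_cos)
    show "AE x in K. complex_integrable unif (\<lambda>s. case (x, s) of (x, s) \<Rightarrow> ?f x s)"
      by (intro AE_I2 unif.integrable_const_bound[of _ 2]) (auto simp: norm_f simp del: of_real_diff of_real_mult)
  qed measurable
  also have "\<dots> = (CLINT x|K. complex_of_real (one_minus_sinc x) * iexp (t * x))"
    by (simp only: integral_mult_right_zero integral_complex_of_real integral_unif_one_minus_cos)
      (simp only: mult.commute)
  finally show ?thesis .
qed

lemma (in real_distribution) avg_second_difference_char:
  "avg_second_difference (char M) t = (CLINT x|M. complex_of_real (one_minus_sinc x) * iexp (t * x))"
proof -
  have int: "complex_integrable M (\<lambda>x. iexp (t * x))" for t
    by (rule integrable_bounded[of _ 1]) auto
  have "second_difference (char M) t s = (CLINT x|M. iexp (t * x) * complex_of_real (1 - cos (s * x)))" for s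
    unfolding char_def[abs_def] second_difference_integral[OF int] second_difference_iexp ..
  moreover have "integrable M (\<lambda>x. min 1 (x\<^sup>2))"
    by (rule integrable_bounded[of _ 1]) auto
  ultimately have "(CLINT s|unif. second_difference (char M) t s)
      = (CLINT x|M. complex_of_real (one_minus_sinc x) * iexp (t * x))"
    by (simp only: integral_unif_integral_iexp_one_minus_cos[OF sigma_finite_measure_axioms] events_eq_borel)
  then show ?thesis by (simp add: avg_second_difference_def)
qed

definition sinc_weighted :: "real measure \<Rightarrow> real measure" where
  "sinc_weighted M = density M (\<lambda>x. ennreal (one_minus_sinc x))"

lemma sets_sinc_weighted: "sets M = sets borel \<Longrightarrow> sets (sinc_weighted M) = sets borel"
  by (simp add: sinc_weighted_def)

lemma finite_borel_measure_sinc_weighted: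
  assumes sets: "sets M = sets borel" and int: "integrable M one_minus_sinc"
  shows "finite_borel_measure (sinc_weighted M)"
proof (intro finite_borel_measure.intro finite_borel_measure_axioms.intro finite_measureI)
  have "(\<integral>\<^sup>+x. ennreal (one_minus_sinc x) \<partial>M) < \<infinity>"
    using int by (simp add: integrable_iff_bounded one_minus_sinc_nonneg)
  then show "emeasure (sinc_weighted M) (space (sinc_weighted M)) \<noteq> \<infinity>"
    by (simp add: sinc_weighted_def emeasure_density measurable_cong_sets[OF sets refl] cong: nn_integral_cong)
qed (simp add: sets_sinc_weighted sets)

lemma integral_sinc_weighted:
  fixes f :: "real \<Rightarrow> 'b::{banach, second_countable_topology}"
  assumes "sets M = sets borel" "f \<in> borel_measurable borel"
  shows "(\<integral>x. f x \<partial>sinc_weighted M) = (\<integral>x. one_minus_sinc x *\<^sub>R f x \<partial>M)"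
  unfolding sinc_weighted_def
  using assms by (intro integral_density) (auto simp: measurable_cong_sets[OF assms(1) refl] one_minus_sinc_nonneg)

section \<open>The kernel of the Levy--Khintchine formula\<close>

definition levy_kernel :: "real \<Rightarrow> real \<Rightarrow> complex" where
  "levy_kernel t x = iexp (t * x) - 1 - \<i> * complex_of_real (t * (x / (1 + x\<^sup>2)))"

lemma levy_kernel_measurable [measurable]: "levy_kernel t \<in> borel_measurable borel"
  unfolding levy_kernel_def by measurable

lemma one_plus_square_pos: "0 < 1 + (x::real)\<^sup>2"
  by (simp add: add_pos_nonneg)

lemma abs_linear_ratio_le_1: "\<bar>x / (1 + x\<^sup>2)\<bar> \<le> (1::real)"
proof -
  have "\<bar>x\<bar> \<le> 1 + x\<^sup>2"
    using zero_le_power2[of "1 - \<bar>x\<bar>"] abs_ge_zero[of x] by (simp add: power2_diff)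
  then show ?thesis by (simp add: abs_divide one_plus_square_pos divide_le_eq)
qed

lemma linear_minus_linear_ratio: "x - x / (1 + x\<^sup>2) = x^3 / (1 + x\<^sup>2)" for x :: real
  using one_plus_square_pos[of x] by (simp add: field_simps eval_nat_numeral)

lemma abs_cube_ratio_le: "\<bar>x^3 / (1 + x\<^sup>2)\<bar> \<le> \<bar>x\<bar> * (x::real)\<^sup>2"
proof -
  have "x^3 = x * x\<^sup>2" by (simp add: power3_eq_cube power2_eq_square)
  then have "\<bar>x^3 / (1 + x\<^sup>2)\<bar> = \<bar>x\<bar> * x\<^sup>2 / (1 + x\<^sup>2)"
    using one_plus_square_pos[of x] by (simp add: abs_divide abs_mult)
  also have "\<dots> \<le> \<bar>x\<bar> * x\<^sup>2"
    using mult_left_mono[of 1 "1 + x\<^sup>2" "\<bar>x\<bar> * x\<^sup>2"] by (simp add: divide_le_eq one_plus_square_pos)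
  finally show ?thesis .
qed

lemma abs_linear_ratio_diff_le: "\<bar>x / (1 + x\<^sup>2) - y / (1 + y\<^sup>2)\<bar> \<le> \<bar>x - y :: real\<bar>"
proof -
  define p where "p = (1 + x\<^sup>2) * (1 + y\<^sup>2)"
  have p: "0 < p" unfolding p_def by (intro mult_pos_pos one_plus_square_pos)
  have "2 * \<bar>x * y\<bar> \<le> x\<^sup>2 + y\<^sup>2"
    using sum_squares_bound[of "\<bar>x\<bar>" "\<bar>y\<bar>"] by (simp add: abs_mult)
  moreover have "p = 1 + x\<^sup>2 + y\<^sup>2 + (x * y)\<^sup>2"
    by (simp add: p_def algebra_simps power_mult_distrib)
  ultimately have "\<bar>1 - x * y\<bar> \<le> p"
    using zero_le_power2[of "x * y"] by linarith
  then have "\<bar>x - y\<bar> * \<bar>1 - x * y\<bar> \<le> \<bar>x - y\<bar> * p"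
    by (intro mult_left_mono) auto
  moreover have "x / (1 + x\<^sup>2) - y / (1 + y\<^sup>2) = (x - y) * (1 - x * y) / p"
    using one_plus_square_pos[of x] one_plus_square_pos[of y]
    by (simp add: p_def divide_simps) (simp add: algebra_simps power2_eq_square)
  ultimately show ?thesis using p by (simp add: abs_divide abs_mult divide_le_eq)
qed

lemma norm_iexp_linear_le: "norm (iexp y - 1 - \<i> * complex_of_real y) \<le> y\<^sup>2 / 2"
  using iexp_approx1[of y 1] by (simp add: eval_nat_numeral diff_diff_eq abs_mult_self_eq)

lemma norm_iexp_quadratic_le:
  "norm (iexp y - 1 - \<i> * complex_of_real y + complex_of_real (y\<^sup>2 / 2)) \<le> \<bar>y\<bar>^3 / 6"
  using iexp_approx1[of y 2] by (simp add: eval_nat_numeral diff_diff_eq algebra_simps)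

lemma norm_iexp_minus_1_le_2: "norm (iexp y - 1) \<le> 2"
  using norm_iexp_diff_le_2[of y 0] by simp

lemma levy_kernel_eq:
  "levy_kernel t x = (iexp (t * x) - 1 - \<i> * complex_of_real (t * x)) + \<i> * complex_of_real (t * (x^3 / (1 + x\<^sup>2)))"
  unfolding linear_minus_linear_ratio[symmetric] levy_kernel_def by (simp add: algebra_simps)

lemma norm_levy_kernel_le: "norm (levy_kernel t x) \<le> (t\<^sup>2 / 2 + \<bar>t\<bar> + 2) * min 1 (x\<^sup>2)"
proof -
  have "norm (levy_kernel t x) \<le> (t\<^sup>2 / 2 + \<bar>t\<bar> + 2) * x\<^sup>2" if "\<bar>x\<bar> \<le> 1"
  proof -
    have "\<bar>x^3 / (1 + x\<^sup>2)\<bar> \<le> x\<^sup>2"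
      using abs_cube_ratio_le[of x] mult_right_mono[OF that, of "x\<^sup>2"] by simp
    then have "norm (\<i> * complex_of_real (t * (x^3 / (1 + x\<^sup>2)))) \<le> \<bar>t\<bar> * x\<^sup>2"
      by (simp only: norm_mult norm_ii norm_of_real abs_mult mult_1 mult_left_mono abs_ge_zero)
    then have "norm (levy_kernel t x) \<le> (t * x)\<^sup>2 / 2 + \<bar>t\<bar> * x\<^sup>2"
      unfolding levy_kernel_eq by (rule order_trans[OF norm_triangle_ineq add_mono[OF norm_iexp_linear_le]])
    also have "\<dots> \<le> (t\<^sup>2 / 2 + \<bar>t\<bar> + 2) * x\<^sup>2"
      by (simp add: algebra_simps power_mult_distrib)
    finally show ?thesis .
  qed
  moreover have "norm (levy_kernel t x) \<le> t\<^sup>2 / 2 + \<bar>t\<bar> + 2"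
  proof -
    have "norm (\<i> * complex_of_real (t * (x / (1 + x\<^sup>2)))) \<le> \<bar>t\<bar>"
      using mult_left_mono[OF abs_linear_ratio_le_1[of x], of "\<bar>t\<bar>"]
      by (simp add: norm_mult abs_mult del: of_real_mult of_real_divide)
    then have "norm (levy_kernel t x) \<le> 2 + \<bar>t\<bar>"
      unfolding levy_kernel_def by (rule order_trans[OF norm_triangle_ineq4 add_mono[OF norm_iexp_minus_1_le_2]])
    then show ?thesis using zero_le_power2[of t] by linarith
  qed
  moreover have "1 \<le> x\<^sup>2" if "\<not> \<bar>x\<bar> \<le> 1"
    using that abs_le_square_iff[of 1 x] by simp
  moreover have "x\<^sup>2 \<le> 1" if "\<bar>x\<bar> \<le> 1"
    using that by (simp add: abs_square_le_1)
  ultimately show ?thesis by (cases "\<bar>x\<bar> \<le> 1") auto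
qed

lemma norm_levy_kernel_diff_le: "norm (levy_kernel t x - levy_kernel t y) \<le> 2 * \<bar>t\<bar> * \<bar>x - y\<bar>"
proof -
  have "levy_kernel t x - levy_kernel t y
      = (iexp (t * x) - iexp (t * y)) - \<i> * complex_of_real (t * (x / (1 + x\<^sup>2) - y / (1 + y\<^sup>2)))"
    by (simp add: levy_kernel_def algebra_simps)
  also have "norm \<dots> \<le> \<bar>t * x - t * y\<bar> + \<bar>t * (x / (1 + x\<^sup>2) - y / (1 + y\<^sup>2))\<bar>"
    by (rule order_trans[OF norm_triangle_ineq4 add_mono[OF norm_iexp_diff_le]])
      (simp add: norm_mult del: of_real_mult of_real_diff of_real_divide)
  also have "\<dots> \<le> \<bar>t\<bar> * \<bar>x - y\<bar> + \<bar>t\<bar> * \<bar>x - y\<bar>"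
    unfolding abs_mult right_diff_distrib[symmetric]
    by (intro add_mono mult_left_mono abs_linear_ratio_diff_le) auto
  finally show ?thesis by simp
qed

lemma levy_kernel_over_square_tendsto:
  "((\<lambda>x. levy_kernel t x / complex_of_real (x\<^sup>2)) \<longlongrightarrow> - complex_of_real (t\<^sup>2 / 2)) (at 0)"
proof (rule LIM_zero_cancel, rule Lim_null_comparison)
  show "((\<lambda>x. (\<bar>t\<bar>^3 / 6 + \<bar>t\<bar>) * \<bar>x\<bar>) \<longlongrightarrow> 0) (at 0)"
    by (auto intro!: tendsto_eq_intros)
  have "norm (levy_kernel t x / complex_of_real (x\<^sup>2) - - complex_of_real (t\<^sup>2 / 2)) \<le> (\<bar>t\<bar>^3 / 6 + \<bar>t\<bar>) * \<bar>x\<bar>"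
    if "x \<noteq> 0" for x
  proof -
    have "levy_kernel t x + complex_of_real ((t * x)\<^sup>2 / 2)
        = (iexp (t * x) - 1 - \<i> * complex_of_real (t * x) + complex_of_real ((t * x)\<^sup>2 / 2))
          + \<i> * complex_of_real (t * (x^3 / (1 + x\<^sup>2)))"
      unfolding levy_kernel_eq by simp
    also have "norm \<dots> \<le> \<bar>t * x\<bar>^3 / 6 + \<bar>t\<bar> * (\<bar>x\<bar> * x\<^sup>2)"
      using abs_cube_ratio_le[of x]
      by (intro order_trans[OF norm_triangle_ineq add_mono[OF norm_iexp_quadratic_le]])
        (simp only: norm_mult norm_ii norm_of_real abs_mult[of t] mult_1 mult_left_mono abs_ge_zero)
    also have "\<dots> = (\<bar>t\<bar>^3 / 6 + \<bar>t\<bar>) * \<bar>x\<bar> * x\<^sup>2"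
      by (simp add: abs_mult power_mult_distrib power3_eq_cube power2_eq_square algebra_simps abs_mult_self_eq)
    finally have "norm (levy_kernel t x + complex_of_real ((t * x)\<^sup>2 / 2)) / x\<^sup>2 \<le> (\<bar>t\<bar>^3 / 6 + \<bar>t\<bar>) * \<bar>x\<bar>"
      using that by (simp add: divide_le_eq)
    moreover have "levy_kernel t x / complex_of_real (x\<^sup>2) - - complex_of_real (t\<^sup>2 / 2)
        = (levy_kernel t x + complex_of_real ((t * x)\<^sup>2 / 2)) / complex_of_real (x\<^sup>2)"
      using that by (simp add: field_simps)
    ultimately show ?thesis by (simp add: norm_divide norm_power)
  qed
  then show "\<forall>\<^sub>F x in at 0. norm (levy_kernel t x / complex_of_real (x\<^sup>2) - - complex_of_real (t\<^sup>2 / 2))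
      \<le> (\<bar>t\<bar>^3 / 6 + \<bar>t\<bar>) * \<bar>x\<bar>"
    by (simp add: eventually_at_filter)
qed

lemma second_difference_levy_kernel:
  "second_difference (\<lambda>t. levy_kernel t x) t s = iexp (t * x) * complex_of_real (1 - cos (s * x))"
proof -
  have "(\<lambda>t. levy_kernel t x) = (\<lambda>t. iexp (t * x) + (- 1 + \<i> * complex_of_real (t * - (x / (1 + x\<^sup>2)))))"
    by (simp add: levy_kernel_def fun_eq_iff)
  then show ?thesis
    by (simp only: second_difference_add second_difference_iexp second_difference_const
        second_difference_linear add_0_right)
qed

section \<open>Test functions\<close>

definition jump_test :: "(real \<Rightarrow> complex) \<Rightarrow> complex \<Rightarrow> bool" where
  "jump_test F l \<longleftrightarrow> uniformly_continuous_on UNIV F \<and> (\<exists>C. \<forall>x. norm (F x) \<le> C * min 1 (x\<^sup>2))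
    \<and> ((\<lambda>x. F x / complex_of_real (x\<^sup>2)) \<longlongrightarrow> l) (at 0)"

lemma uniformly_continuous_on_of_norm_diff_le:
  fixes F :: "real \<Rightarrow> 'a::real_normed_vector"
  assumes "\<And>x y. norm (F x - F y) \<le> K * \<bar>x - y\<bar>"
  shows "uniformly_continuous_on UNIV F"
proof (rule lipschitz_on_uniformly_continuous)
  show "\<bar>K\<bar>-lipschitz_on UNIV F"
  proof (rule lipschitz_onI)
    show "dist (F x) (F y) \<le> \<bar>K\<bar> * dist x y" for x y
      using assms[of x y] mult_right_mono[OF abs_ge_self[of K], of "\<bar>x - y\<bar>"]
      by (simp add: dist_norm)
  qed simp
qed

lemma ex_bound_min_1_square:
  fixes F :: "real \<Rightarrow> 'a::real_normed_vector"
  assumes bound: "\<And>x. norm (F x) \<le> A" and near_0: "\<And>x. \<bar>x\<bar> \<le> m \<Longrightarrow> norm (F x) \<le> B * x\<^sup>2" and "m > 0"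
  shows "\<exists>C. \<forall>x. norm (F x) \<le> C * min 1 (x\<^sup>2)"
proof (intro exI allI)
  fix x
  define C where "C = A + \<bar>B\<bar> + A / m\<^sup>2"
  have A: "0 \<le> A" using order_trans[OF norm_ge_zero bound] .
  have "norm (F x) \<le> C" using bound[of x] A by (simp add: C_def add_increasing2)
  moreover have "norm (F x) \<le> C * x\<^sup>2"
  proof (cases "\<bar>x\<bar> \<le> m")
    case True
    have "norm (F x) \<le> B * x\<^sup>2" by (rule near_0[OF True])
    also have "\<dots> \<le> C * x\<^sup>2" using A by (intro mult_right_mono) (auto simp: C_def add_increasing add_increasing2)
    finally show ?thesis .
  next
    case False
    then have "m\<^sup>2 \<le> x\<^sup>2" using \<open>m > 0\<close> by (intro abs_le_square_iff[THEN iffD1]) simp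
    then have "A * m\<^sup>2 \<le> A * x\<^sup>2" using A by (intro mult_left_mono)
    then have "A \<le> A / m\<^sup>2 * x\<^sup>2" using \<open>m > 0\<close> by (simp add: le_divide_eq)
    also have "\<dots> \<le> C * x\<^sup>2" using A by (intro mult_right_mono) (auto simp: C_def)
    finally show ?thesis using bound[of x] by simp
  qed
  ultimately show "norm (F x) \<le> C * min 1 (x\<^sup>2)" by (simp add: min_def)
qed

lemma jump_testI:
  assumes "\<And>x y. norm (F x - F y) \<le> K * \<bar>x - y\<bar>" "\<And>x. norm (F x) \<le> A"
    and "\<And>x. \<bar>x\<bar> \<le> m \<Longrightarrow> norm (F x) \<le> B * x\<^sup>2" "m > 0"
    and "((\<lambda>x. F x / complex_of_real (x\<^sup>2)) \<longlongrightarrow> l) (at 0)"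
  shows "jump_test F l"
  unfolding jump_test_def
  using uniformly_continuous_on_of_norm_diff_le[of F, OF assms(1)] ex_bound_min_1_square[of F, OF assms(2-4)] assms(5)
  by blast

lemma jump_testE:
  assumes "jump_test F l"
  obtains C where "C \<ge> 0" "\<And>x. norm (F x) \<le> C * min 1 (x\<^sup>2)" "\<And>x. norm (F x) \<le> C"
proof -
  obtain C where C: "\<And>x. norm (F x) \<le> C * min 1 (x\<^sup>2)"
    using assms unfolding jump_test_def by blast
  have "0 \<le> C" using order_trans[OF norm_ge_zero C[of 1]] by simp
  moreover have "norm (F x) \<le> C" for x
    using C[of x] mult_left_mono[of "min 1 (x\<^sup>2)" 1 C] \<open>0 \<le> C\<close> by simp
  ultimately show ?thesis using that C by blast
qed

lemma jump_test_isCont: "jump_test F l \<Longrightarrow> isCont F x"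
  unfolding jump_test_def
  using uniformly_continuous_imp_continuous[of UNIV F] by (auto simp: continuous_on_eq_continuous_at)

lemma jump_test_measurable: "jump_test F l \<Longrightarrow> F \<in> borel_measurable borel"
  by (intro borel_measurable_continuous_onI continuous_at_imp_continuous_on ballI jump_test_isCont)

lemma jump_test_eventually_near_0:
  assumes F: "jump_test F l" and "0 < e"
  shows "\<forall>\<^sub>F \<delta> in at_right 0. \<forall>x. \<bar>x\<bar> \<le> \<delta> \<longrightarrow> norm (F x - l * complex_of_real (x\<^sup>2)) \<le> e * x\<^sup>2"
proof -
  obtain C where "norm (F 0) \<le> C * min 1 (0\<^sup>2)" using jump_testE[OF F] by metis
  then have "F 0 = 0" by simp
  have "\<forall>\<^sub>F x in at 0. dist (F x / complex_of_real (x\<^sup>2)) l < e"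
    using F \<open>0 < e\<close> unfolding jump_test_def by (auto dest: tendstoD)
  then obtain s where s: "0 < s" "\<And>x. x \<noteq> 0 \<Longrightarrow> \<bar>x\<bar> < s \<Longrightarrow> norm (F x / complex_of_real (x\<^sup>2) - l) < e"
    by (auto simp: eventually_at dist_norm)
  have "norm (F x - l * complex_of_real (x\<^sup>2)) \<le> e * x\<^sup>2" if "\<bar>x\<bar> < s" for x
  proof (cases "x = 0")
    case False
    have "F x - l * complex_of_real (x\<^sup>2) = (F x / complex_of_real (x\<^sup>2) - l) * complex_of_real (x\<^sup>2)"
      using False by (simp add: field_simps)
    also have "norm \<dots> \<le> e * x\<^sup>2"
      unfolding norm_mult using s(2)[OF False that] \<open>0 < e\<close> by (intro mult_mono) (auto simp: norm_power)
    finally show ?thesis .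
  qed (simp add: \<open>F 0 = 0\<close>)
  then show ?thesis
    using s(1) unfolding eventually_at_right_field by (intro exI[of _ s]) auto
qed

lemma jump_test_over_one_minus_sinc:
  assumes F: "jump_test F l"
  obtains f B where "\<And>x. isCont f x" "\<And>x. norm (f x) \<le> B" "f 0 = 6 * l"
    "\<And>x. one_minus_sinc x *\<^sub>R f x = F x"
proof -
  obtain C where C: "0 \<le> C" "\<And>x. norm (F x) \<le> C * min 1 (x\<^sup>2)"
    by (rule jump_testE[OF F]) (rule that)
  define f where "f x = (if x = 0 then 6 * l else F x / complex_of_real (one_minus_sinc x))" for x
  have "f 0 = 6 * l" by (simp add: f_def)
  moreover have "one_minus_sinc x *\<^sub>R f x = F x" for x
    using C(2)[of 0] one_minus_sinc_pos[of x] by (auto simp: f_def scaleR_conv_of_real)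
  moreover have "norm (f x) \<le> 8 * C + norm (6 * l)" for x
  proof (cases "x = 0")
    case False
    have "norm (F x) \<le> C * (8 * one_minus_sinc x)"
      using C(2)[of x] mult_left_mono[OF min_1_square_le_one_minus_sinc C(1), of x] by linarith
    then have "norm (f x) \<le> 8 * C"
      using one_minus_sinc_pos[OF False] False by (simp add: f_def norm_divide divide_le_eq mult_ac)
    then show ?thesis by (simp add: add_increasing2)
  qed (use C(1) in \<open>simp add: f_def\<close>)
  moreover have "isCont f x" for x
  proof (cases "x = 0")
    case True
    have "((\<lambda>x. F x / complex_of_real (x\<^sup>2) * complex_of_real (x\<^sup>2 / one_minus_sinc x)) \<longlongrightarrow> l * complex_of_real 6) (at 0)"
      using F unfolding jump_test_def
      by (intro tendsto_mult tendsto_of_real square_over_one_minus_sinc_tendsto) auto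
    then have "(f \<longlongrightarrow> l * complex_of_real 6) (at 0)"
      by (rule Lim_transform_eventually) (simp add: eventually_at_filter f_def)
    then show ?thesis using True by (simp add: isCont_def f_def mult.commute)
  next
    case False
    have "\<forall>\<^sub>F y in nhds x. f y = F y / complex_of_real (one_minus_sinc y)"
      using t1_space_nhds[OF False] by eventually_elim (simp add: f_def)
    moreover have "isCont (\<lambda>y. F y / complex_of_real (one_minus_sinc y)) x"
      using one_minus_sinc_pos[OF False] jump_test_isCont[OF F]
      by (intro continuous_divide continuous_of_real isCont_one_minus_sinc) auto
    ultimately show ?thesis by (simp add: isCont_cong)
  qed
  ultimately show ?thesis using that by blast
qed

lemma jump_test_levy_kernel: "jump_test (levy_kernel t) (- complex_of_real (t\<^sup>2 / 2))"
proof (rule jump_testI[OF norm_levy_kernel_diff_le _ _ zero_less_one levy_kernel_over_square_tendsto])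
  show "norm (levy_kernel t x) \<le> t\<^sup>2 / 2 + \<bar>t\<bar> + 2" for x
    using norm_levy_kernel_le[of t x] mult_left_mono[of "min 1 (x\<^sup>2)" 1 "t\<^sup>2 / 2 + \<bar>t\<bar> + 2"] by simp
  show "norm (levy_kernel t x) \<le> (t\<^sup>2 / 2 + \<bar>t\<bar> + 2) * x\<^sup>2" for x
    using norm_levy_kernel_le[of t x] mult_left_mono[of "min 1 (x\<^sup>2)" "x\<^sup>2" "t\<^sup>2 / 2 + \<bar>t\<bar> + 2"] by simp
qed

definition ramp :: "real \<Rightarrow> real \<Rightarrow> real \<Rightarrow> real" where
  "ramp u v x = max 0 (min 1 ((x - u) / (v - u)))"

lemma ramp_measurable [measurable]: "ramp u v \<in> borel_measurable borel"
  unfolding ramp_def[abs_def] by measurable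

lemma ramp_nonneg: "0 \<le> ramp u v x"
  by (simp add: ramp_def)

lemma ramp_le_1: "ramp u v x \<le> 1"
  by (simp add: ramp_def)

lemma ramp_eq_0: "u < v \<Longrightarrow> x \<le> u \<Longrightarrow> ramp u v x = 0"
  by (simp add: ramp_def max_def min_def divide_le_0_iff zero_le_divide_iff)

lemma ramp_eq_1: "u < v \<Longrightarrow> v \<le> x \<Longrightarrow> ramp u v x = 1"
  by (simp add: ramp_def max_def min_def le_divide_eq)

lemma jump_test_ramp:
  assumes "0 < u" "u < v"
  shows "jump_test (\<lambda>x. complex_of_real (ramp u v x)) 0"
proof (rule jump_testI[where K="1 / (v - u)" and A=1 and m=u and B=0])
  have clamp: "\<bar>max 0 (min 1 a) - max 0 (min 1 b)\<bar> \<le> \<bar>a - b\<bar>" for a b :: real by auto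
  show "norm (complex_of_real (ramp u v x) - complex_of_real (ramp u v y)) \<le> 1 / (v - u) * \<bar>x - y\<bar>" for x y
    unfolding of_real_diff[symmetric] norm_of_real ramp_def
    by (rule order_trans[OF clamp]) (use assms in \<open>simp add: diff_divide_distrib[symmetric] abs_divide\<close>)
  show "norm (complex_of_real (ramp u v x)) \<le> 1" for x
    by (simp add: ramp_nonneg ramp_le_1)
  show "norm (complex_of_real (ramp u v x)) \<le> 0 * x\<^sup>2" if "\<bar>x\<bar> \<le> u" for x
    using that assms by (simp add: ramp_eq_0)
  show "((\<lambda>x. complex_of_real (ramp u v x) / complex_of_real (x\<^sup>2)) \<longlongrightarrow> 0) (at 0)"
    using assms
    by (intro tendsto_eventually) (auto simp: eventually_at dist_real_def ramp_eq_0 intro!: exI[of _ u])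
qed fact

definition truncated_square :: "real \<Rightarrow> real \<Rightarrow> real" where
  "truncated_square \<tau> x = (max 0 (min \<bar>x\<bar> (2 * \<tau> - \<bar>x\<bar>)))\<^sup>2"

lemma truncated_square_measurable [measurable]: "truncated_square \<tau> \<in> borel_measurable borel"
  unfolding truncated_square_def[abs_def] by measurable

lemma truncated_square_nonneg: "0 \<le> truncated_square \<tau> x"
  by (simp add: truncated_square_def)

lemma truncated_square_le: "truncated_square \<tau> x \<le> x\<^sup>2"
proof -
  have "\<bar>max 0 (min \<bar>x\<bar> (2 * \<tau> - \<bar>x\<bar>))\<bar> \<le> \<bar>x\<bar>" by auto
  then show ?thesis unfolding truncated_square_def by (simp only: abs_le_square_iff)
qed

lemma truncated_square_eq: "\<bar>x\<bar> \<le> \<tau> \<Longrightarrow> truncated_square \<tau> x = x\<^sup>2"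
  by (simp add: truncated_square_def)

lemma truncated_square_eq_0: "2 * \<tau> \<le> \<bar>x\<bar> \<Longrightarrow> truncated_square \<tau> x = 0"
  by (simp add: truncated_square_def)

lemma jump_test_truncated_square:
  assumes "0 < \<tau>"
  shows "jump_test (\<lambda>x. complex_of_real (truncated_square \<tau> x)) 1"
proof (rule jump_testI[where K="2 * \<tau>" and A="\<tau>\<^sup>2" and m=\<tau> and B=1])
  define g where "g x = max 0 (min \<bar>x\<bar> (2 * \<tau> - \<bar>x\<bar>))" for x
  have g: "0 \<le> g x" "g x \<le> \<tau>" for x
    using assms by (auto simp: g_def)
  have g_diff: "\<bar>g x - g y\<bar> \<le> \<bar>x - y\<bar>" for x y
  proof -
    have "\<bar>max 0 (min a (2 * \<tau> - a)) - max 0 (min b (2 * \<tau> - b))\<bar> \<le> \<bar>a - b\<bar>" for a b by auto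
    then show ?thesis unfolding g_def using abs_triangle_ineq3 order_trans by blast
  qed
  have sq: "truncated_square \<tau> x = (g x)\<^sup>2" for x by (simp add: truncated_square_def g_def)
  show "norm (complex_of_real (truncated_square \<tau> x) - complex_of_real (truncated_square \<tau> y)) \<le> 2 * \<tau> * \<bar>x - y\<bar>" for x y
  proof -
    have "\<bar>(g x)\<^sup>2 - (g y)\<^sup>2\<bar> = (g x + g y) * \<bar>g x - g y\<bar>"
      using g[of x] g[of y] by (simp add: power2_eq_square square_diff_square_factored abs_mult)
    also have "\<dots> \<le> (2 * \<tau>) * \<bar>x - y\<bar>"
      using g[of x] g[of y] g_diff[of x y] by (intro mult_mono) auto
    finally show ?thesis by (simp add: sq of_real_diff[symmetric] norm_of_real del: of_real_diff of_real_power)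
  qed
  show "norm (complex_of_real (truncated_square \<tau> x)) \<le> \<tau>\<^sup>2" for x
    using g[of x] by (simp add: sq power_mono del: of_real_power)
  show "norm (complex_of_real (truncated_square \<tau> x)) \<le> 1 * x\<^sup>2" for x
    using truncated_square_nonneg truncated_square_le by simp
  show "((\<lambda>x. complex_of_real (truncated_square \<tau> x) / complex_of_real (x\<^sup>2)) \<longlongrightarrow> 1) (at 0)"
    using assms
    by (intro tendsto_eventually)
      (auto simp: eventually_at dist_real_def truncated_square_eq intro!: exI[of _ \<tau>])
qed fact

definition drift_kernel :: "real \<Rightarrow> real \<Rightarrow> real" where
  "drift_kernel \<tau> x = max (- 1) (min x \<tau>) - x / (1 + x\<^sup>2)"

lemma jump_test_drift_kernel:
  assumes "0 < \<tau>"
  shows "jump_test (\<lambda>x. complex_of_real (drift_kernel \<tau> x)) 0"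
proof (rule jump_testI[where K=2 and A="2 + \<tau>" and m="min 1 \<tau>" and B=1])
  have "\<bar>max (- 1) (min x \<tau>) - max (- 1) (min y \<tau>)\<bar> \<le> \<bar>x - y\<bar>" for x y by auto
  then have "\<bar>drift_kernel \<tau> x - drift_kernel \<tau> y\<bar> \<le> 2 * \<bar>x - y\<bar>" for x y
    using abs_linear_ratio_diff_le[of x y] unfolding drift_kernel_def by (smt (verit))
  then show "norm (complex_of_real (drift_kernel \<tau> x) - complex_of_real (drift_kernel \<tau> y)) \<le> 2 * \<bar>x - y\<bar>" for x y
    unfolding of_real_diff[symmetric] norm_of_real .
  show "norm (complex_of_real (drift_kernel \<tau> x)) \<le> 2 + \<tau>" for x
    using abs_linear_ratio_le_1[of x] assms unfolding drift_kernel_def norm_of_real by (smt (verit))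
  have near_0: "\<bar>drift_kernel \<tau> x\<bar> \<le> \<bar>x\<bar> * x\<^sup>2" if "\<bar>x\<bar> \<le> min 1 \<tau>" for x
  proof -
    have "max (- 1) (min x \<tau>) = x" using that by auto
    then show ?thesis
      using abs_cube_ratio_le[of x] by (simp add: drift_kernel_def linear_minus_linear_ratio)
  qed
  show "norm (complex_of_real (drift_kernel \<tau> x)) \<le> 1 * x\<^sup>2" if "\<bar>x\<bar> \<le> min 1 \<tau>" for x
    using near_0[OF that] mult_right_mono[of "\<bar>x\<bar>" 1 "x\<^sup>2"] that by simp
  show "((\<lambda>x. complex_of_real (drift_kernel \<tau> x) / complex_of_real (x\<^sup>2)) \<longlongrightarrow> 0) (at 0)"
  proof (rule Lim_null_comparison)
    show "((\<lambda>x::real. \<bar>x\<bar>) \<longlongrightarrow> 0) (at 0)" by (auto intro!: tendsto_eq_intros)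
    have "norm (complex_of_real (drift_kernel \<tau> x) / complex_of_real (x\<^sup>2)) \<le> \<bar>x\<bar>"
      if "x \<noteq> 0" "\<bar>x\<bar> \<le> min 1 \<tau>" for x
      using near_0[OF that(2)] that(1) by (simp add: norm_divide norm_power divide_le_eq)
    then show "\<forall>\<^sub>F x in at 0. norm (complex_of_real (drift_kernel \<tau> x) / complex_of_real (x\<^sup>2)) \<le> \<bar>x\<bar>"
      using assms by (auto simp: eventually_at dist_real_def intro!: exI[of _ "min 1 \<tau>"])
  qed
qed (use assms in simp)

section \<open>Levy triplets\<close>

definition tail_part :: "real measure \<Rightarrow> real \<Rightarrow> real measure" where
  "tail_part M \<delta> = density M (indicator {\<delta><..})"

context
  fixes M :: "real measure" and \<delta> :: real
  assumes sets_M: "sets M = sets borel"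
begin

lemma sets_tail_part: "sets (tail_part M \<delta>) = sets borel"
  by (simp add: tail_part_def sets_M)

lemma space_tail_part: "space (tail_part M \<delta>) = UNIV"
  using sets_eq_imp_space_eq[OF sets_tail_part] by simp

lemma emeasure_tail_part:
  "A \<in> sets borel \<Longrightarrow> emeasure (tail_part M \<delta>) A = emeasure M ({\<delta><..} \<inter> A)"
  unfolding tail_part_def
  by (subst emeasure_density)
    (auto simp: indicator_inter_arith[symmetric] sets_M measurable_cong_sets[OF sets_M refl])

lemma measure_tail_part:
  "A \<in> sets borel \<Longrightarrow> measure (tail_part M \<delta>) A = measure M ({\<delta><..} \<inter> A)"
  by (simp add: measure_def emeasure_tail_part)

lemma finite_borel_measure_tail_part:
  assumes "emeasure M {\<delta><..} \<noteq> \<infinity>"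
  shows "finite_borel_measure (tail_part M \<delta>)"
proof (intro finite_borel_measure.intro finite_borel_measure_axioms.intro finite_measureI)
  show "emeasure (tail_part M \<delta>) (space (tail_part M \<delta>)) \<noteq> \<infinity>"
    using emeasure_tail_part[of UNIV] assms by (simp add: space_tail_part)
qed (rule sets_tail_part)

lemma integral_tail_part:
  fixes f :: "real \<Rightarrow> 'b::{banach, second_countable_topology}"
  assumes "f \<in> borel_measurable borel"
  shows "(\<integral>x. f x \<partial>tail_part M \<delta>) = (\<integral>x. indicator {\<delta><..} x *\<^sub>R f x \<partial>M)"
proof -
  have "tail_part M \<delta> = density M (\<lambda>x. ennreal (indicator {\<delta><..} x))"
    unfolding tail_part_def
    by (intro density_cong AE_I2) (auto simp: measurable_cong_sets[OF sets_M refl] split: split_indicator)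
  then show ?thesis
    using assms by (simp add: integral_density measurable_cong_sets[OF sets_M refl])
qed

end

locale levy_tail =
  fixes L :: "real \<Rightarrow> real"
  assumes L_mono: "mono_on {0<..} L" and L_tendsto_0: "(L \<longlongrightarrow> 0) at_top"
begin

lemma L_le: "0 < x \<Longrightarrow> x \<le> y \<Longrightarrow> L x \<le> L y"
  using L_mono by (simp add: mono_on_def)

lemma L_nonpos: "0 < x \<Longrightarrow> L x \<le> 0"
  by (rule tendsto_lowerbound[OF L_tendsto_0])
    (auto simp: eventually_at_top_linorder intro!: exI[of _ x] L_le)

lemma countable_not_isCont_L: "countable {x \<in> {0<..}. \<not> isCont L x}"
  by (rule mono_on_ctble_discont_open[OF _ L_mono]) simp

lemma ex_isCont_L:
  assumes "0 \<le> u" "u < v"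
  shows "\<exists>x. u < x \<and> x < v \<and> isCont L x"
proof -
  have "\<exists>x\<in>{u<..<v}. x \<notin> {x \<in> {0<..}. \<not> isCont L x}"
    by (rule open_minus_countable[OF countable_not_isCont_L]) (use assms in auto)
  then show ?thesis using assms by auto
qed

lemma ex_isCont_L_at_right:
  assumes "\<forall>\<^sub>F \<delta> in at_right 0. P \<delta>"
  obtains \<delta> where "0 < \<delta>" "isCont L \<delta>" "P \<delta>"
proof -
  obtain b where b: "0 < b" "\<And>\<delta>. 0 < \<delta> \<Longrightarrow> \<delta> < b \<Longrightarrow> P \<delta>"
    using assms unfolding eventually_at_right_field by blast
  then show ?thesis using ex_isCont_L[of 0 b] that by auto
qed

end

locale levy_characteristics = levy_tail L
  for \<gamma> \<sigma>2 :: real and L :: "real \<Rightarrow> real" and \<nu> :: "real measure" +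
  assumes sigma2_nonneg: "0 \<le> \<sigma>2"
    and stieltjes: "stieltjes_pos L \<nu>"
    and square_integrable_near_0: "\<And>\<tau>. \<tau> > 0 \<Longrightarrow> (\<integral>\<^sup>+x\<in>{0<..<\<tau>}. ennreal (x\<^sup>2) \<partial>\<nu>) < \<infinity>"
begin

lemma sets_nu [measurable_cong, simp]: "sets \<nu> = sets borel"
  using stieltjes by (simp add: stieltjes_pos_def)

lemma space_nu [simp]: "space \<nu> = UNIV"
  using sets_eq_imp_space_eq[OF sets_nu] by simp

lemma AE_nu_pos: "AE x in \<nu>. 0 < x"
proof (rule AE_I[of _ _ "{..0}"])
  show "emeasure \<nu> {..0} = 0" using stieltjes by (simp add: stieltjes_pos_def)
qed auto

lemma emeasure_nu_Ioc: "0 < x \<Longrightarrow> x \<le> y \<Longrightarrow> emeasure \<nu> {x<..y} = ennreal (L y - L x)"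
  using stieltjes by (simp add: stieltjes_pos_def)

lemma emeasure_nu_tail:
  assumes "0 < x"
  shows "emeasure \<nu> {x<..} = ennreal (- L x)"
proof -
  have tail: "(\<Union>n::nat. {x<..x + real n}) = {x<..}"
  proof safe
    fix y assume "x < y"
    moreover obtain n :: nat where "y - x \<le> real n" using real_arch_simple by blast
    ultimately show "y \<in> (\<Union>n::nat. {x<..x + real n})" by (auto intro!: exI[of _ n])
  qed auto
  have "(\<lambda>n. emeasure \<nu> {x<..x + real n}) \<longlonglongrightarrow> emeasure \<nu> (\<Union>n::nat. {x<..x + real n})"
    by (rule Lim_emeasure_incseq) (auto simp: incseq_def)
  then have "(\<lambda>n. ennreal (L (x + real n) - L x)) \<longlonglongrightarrow> emeasure \<nu> {x<..}"
    using assms by (simp add: tail emeasure_nu_Ioc)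
  moreover have "filterlim (\<lambda>n. x + real n) at_top sequentially"
    by (intro filterlim_tendsto_add_at_top[OF tendsto_const] filterlim_real_sequentially)
  then have "(\<lambda>n. ennreal (L (x + real n) - L x)) \<longlonglongrightarrow> ennreal (0 - L x)"
    by (intro tendsto_ennrealI tendsto_diff tendsto_const filterlim_compose[OF L_tendsto_0])
  ultimately show ?thesis
    using LIMSEQ_unique by fastforce
qed

lemma measure_nu_tail: "0 < x \<Longrightarrow> measure \<nu> {x<..} = - L x"
  using emeasure_nu_tail[of x] L_nonpos[of x] by (simp add: measure_def)

lemma integrable_indicator_tail: "0 < x \<Longrightarrow> integrable \<nu> (indicator {x<..} :: real \<Rightarrow> real)"
  using emeasure_nu_tail[of x] by (intro integrable_real_indicator) auto

lemma integrable_min_1_square: "integrable \<nu> (\<lambda>x. min 1 (x\<^sup>2))"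
proof (rule integrableI_bounded)
  have "(\<integral>\<^sup>+x. ennreal (norm (min 1 (x\<^sup>2))) \<partial>\<nu>)
    \<le> (\<integral>\<^sup>+x. ennreal (x\<^sup>2) * indicator {0<..<2} x + indicator {1<..} x \<partial>\<nu>)"
    using AE_nu_pos
    by (intro nn_integral_mono_AE) (auto elim!: eventually_mono split: split_indicator simp: min_def)
  also have "\<dots> = (\<integral>\<^sup>+x\<in>{0<..<2}. ennreal (x\<^sup>2) \<partial>\<nu>) + emeasure \<nu> {1<..}"
    by (subst nn_integral_add) auto
  also have "\<dots> < \<infinity>" using square_integrable_near_0[of 2] emeasure_nu_tail[of 1] by simp
  finally show "(\<integral>\<^sup>+x. ennreal (norm (min 1 (x\<^sup>2))) \<partial>\<nu>) < \<infinity>" .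
qed measurable

lemma integrable_dominated:
  fixes f :: "real \<Rightarrow> 'b::{banach, second_countable_topology}"
  assumes [measurable]: "f \<in> borel_measurable borel" and "\<And>x. norm (f x) \<le> C * min 1 (x\<^sup>2)"
  shows "integrable \<nu> f"
  using Bochner_Integration.integrable_mult_right[OF integrable_min_1_square, of C]
  by (rule Bochner_Integration.integrable_bound)
    (auto intro!: AE_I2 order_trans[OF assms(2)] simp: abs_ge_self)

lemma jump_test_integrable:
  assumes "jump_test F l"
  shows "complex_integrable \<nu> F"
  using assms by (rule jump_testE) (rule integrable_dominated[OF jump_test_measurable[OF assms]])

lemma jump_test_integrable_of_real:
  assumes "jump_test (\<lambda>x. complex_of_real (f x)) l"
  shows "integrable \<nu> f"
  using integrable_Re[OF jump_test_integrable[OF assms]] by simp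

lemma sigma_finite_nu: "sigma_finite_measure \<nu>"
proof
  let ?A = "insert {..0} (range (\<lambda>n. {1 / real (Suc n) <..}))"
  have "x \<in> \<Union> ?A" for x
  proof (cases "x \<le> 0")
    case False
    then obtain n where "1 / real (Suc n) < x"
      using reals_Archimedean[of x] by (auto simp: inverse_eq_divide)
    then show ?thesis by auto
  qed auto
  then have "\<Union> ?A = space \<nu>" by auto
  moreover have "\<forall>a\<in>?A. emeasure \<nu> a \<noteq> \<infinity>"
    using stieltjes by (auto simp: emeasure_nu_tail stieltjes_pos_def)
  ultimately show "\<exists>A. countable A \<and> A \<subseteq> sets \<nu> \<and> \<Union> A = space \<nu> \<and> (\<forall>a\<in>A. emeasure \<nu> a \<noteq> \<infinity>)"
    by (intro exI[of _ ?A]) auto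
qed

lemma small_jumps_tendsto_0:
  "((\<lambda>\<delta>. LINT x|\<nu>. indicator {0<..\<delta>} x * min 1 (x\<^sup>2)) \<longlongrightarrow> 0) (at_right 0)"
proof (rule tendsto_at_right_sequentially[of 0 1])
  fix u :: "nat \<Rightarrow> real" assume u: "\<And>n. 0 < u n" "u \<longlonglongrightarrow> 0"
  have "(\<lambda>n. LINT x|\<nu>. indicator {0<..u n} x * min 1 (x\<^sup>2)) \<longlonglongrightarrow> (LINT x|\<nu>. 0)"
  proof (rule integral_dominated_convergence[where w="\<lambda>x. min 1 (x\<^sup>2)", OF _ _ integrable_min_1_square])
    show "AE x in \<nu>. (\<lambda>n. indicator {0<..u n} x * min 1 (x\<^sup>2)) \<longlonglongrightarrow> 0"
      using AE_nu_pos
    proof eventually_elim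
      case (elim x)
      have "\<forall>\<^sub>F n in sequentially. indicator {0<..u n} x * min 1 (x\<^sup>2) = 0"
        using order_tendstoD(2)[OF u(2) elim] by eventually_elim (auto simp: indicator_def)
      then show ?case by (rule tendsto_eventually)
    qed
  qed (auto split: split_indicator)
  then show "(\<lambda>n. LINT x|\<nu>. indicator {0<..u n} x * min 1 (x\<^sup>2)) \<longlonglongrightarrow> 0" by simp
qed simp

lemma integral_jump_test_split:
  assumes F: "jump_test F l"
  shows "(\<integral>x. F x \<partial>\<nu>)
    = (\<integral>x. indicator {0<..\<delta>} x *\<^sub>R F x \<partial>\<nu>) + (\<integral>x. indicator {\<delta><..} x *\<^sub>R F x \<partial>\<nu>)"
proof -
  note [measurable] = jump_test_measurable[OF F]
  have int: "complex_integrable \<nu> (\<lambda>x. indicator S x *\<^sub>R F x)" if "S \<in> sets borel" for S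
    using that jump_test_integrable[OF F] by (intro integrable_mult_indicator) auto
  have "(\<integral>x. F x \<partial>\<nu>) = (\<integral>x. indicator {0<..\<delta>} x *\<^sub>R F x + indicator {\<delta><..} x *\<^sub>R F x \<partial>\<nu>)"
    using AE_nu_pos by (intro integral_cong_AE) (auto elim!: eventually_mono split: split_indicator)
  then show ?thesis by (simp add: int)
qed

lemma eventually_small_jump_integral_le:
  assumes F: "jump_test F l" and "0 < e"
  shows "\<forall>\<^sub>F \<delta> in at_right 0. norm (\<integral>x. indicator {0<..\<delta>} x *\<^sub>R F x \<partial>\<nu>) \<le> e"
proof -
  note [measurable] = jump_test_measurable[OF F]
  obtain C where C: "0 \<le> C" "\<And>x. norm (F x) \<le> C * min 1 (x\<^sup>2)"
    by (rule jump_testE[OF F]) (rule that)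
  have "((\<lambda>\<delta>. C * (LINT x|\<nu>. indicator {0<..\<delta>} x * min 1 (x\<^sup>2))) \<longlongrightarrow> C * 0) (at_right 0)"
    by (intro tendsto_mult tendsto_const small_jumps_tendsto_0)
  then have "\<forall>\<^sub>F \<delta> in at_right 0. C * (LINT x|\<nu>. indicator {0<..\<delta>} x * min 1 (x\<^sup>2)) < e"
    by (rule order_tendstoD(2)) (use \<open>0 < e\<close> in simp)
  moreover have "norm (\<integral>x. indicator {0<..\<delta>} x *\<^sub>R F x \<partial>\<nu>) \<le> C * (LINT x|\<nu>. indicator {0<..\<delta>} x * min 1 (x\<^sup>2))" for \<delta>
  proof -
    have "norm (\<integral>x. indicator {0<..\<delta>} x *\<^sub>R F x \<partial>\<nu>) \<le> (LINT x|\<nu>. C * (indicator {0<..\<delta>} x * min 1 (x\<^sup>2)))"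
      using C
      by (intro Bochner_Integration.integral_norm_bound_integral integrable_mult_right
          integrable_dominated[where C=C] integrable_dominated[where C=1])
        (auto split: split_indicator)
    then show ?thesis by simp
  qed
  ultimately show ?thesis by (auto elim!: eventually_mono intro: order_trans less_imp_le)
qed

lemma integral_ramp_bounds:
  assumes "0 < u" "u < v"
  shows "(LINT x|\<nu>. ramp u v x) \<le> - L u" "- L v \<le> (LINT x|\<nu>. ramp u v x)"
proof -
  note int = jump_test_integrable_of_real[OF jump_test_ramp[OF assms]]
  have "(LINT x|\<nu>. ramp u v x) \<le> (LINT x|\<nu>. indicator {u<..} x)"
    using assms ramp_le_1[of u v] ramp_eq_0[of u v]
    by (intro integral_mono int integrable_indicator_tail) (auto split: split_indicator)
  then show "(LINT x|\<nu>. ramp u v x) \<le> - L u" using assms(1) by (simp add: measure_nu_tail)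
  have "(LINT x|\<nu>. indicator {v<..} x) \<le> (LINT x|\<nu>. ramp u v x)"
    using assms ramp_nonneg[of u v] ramp_eq_1[of u v]
    by (intro integral_mono int integrable_indicator_tail) (auto split: split_indicator)
  then show "- L v \<le> (LINT x|\<nu>. ramp u v x)" using assms by (simp add: measure_nu_tail)
qed

lemma integral_truncated_square_le:
  assumes "0 < \<tau>" "\<tau> \<le> 1"
  shows "(LINT x|\<nu>. truncated_square \<tau> x) \<le> (LINT x|\<nu>. indicator {0<..2 * \<tau>} x * min 1 (x\<^sup>2))"
proof (rule integral_mono_AE)
  show "integrable \<nu> (\<lambda>x. indicator {0<..2 * \<tau>} x * min 1 (x\<^sup>2))"
    by (rule integrable_dominated[of _ 1]) (auto split: split_indicator)
  have "truncated_square \<tau> x \<le> 1" for x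
    using assms by (auto simp: truncated_square_def abs_square_le_1)
  then show "AE x in \<nu>. truncated_square \<tau> x \<le> indicator {0<..2 * \<tau>} x * min 1 (x\<^sup>2)"
    using AE_nu_pos
    by (auto elim!: eventually_mono simp: truncated_square_le truncated_square_eq_0 split: split_indicator)
qed (rule jump_test_integrable_of_real[OF jump_test_truncated_square[OF assms(1)]])

definition levy_exponent :: "real \<Rightarrow> complex" where
  "levy_exponent t = \<i> * complex_of_real (t * \<gamma>) - complex_of_real (\<sigma>2 / 2 * t\<^sup>2) + (CLINT x|\<nu>. levy_kernel t x)"

lemma levy_exponent_0 [simp]: "levy_exponent 0 = 0"
  by (simp add: levy_exponent_def levy_kernel_def)

lemma integrable_levy_kernel: "complex_integrable \<nu> (levy_kernel t)"
  by (rule jump_test_integrable[OF jump_test_levy_kernel])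

lemma isCont_levy_exponent: "isCont levy_exponent t"
proof -
  have "isCont (\<lambda>t. CLINT x|\<nu>. levy_kernel t x) t"
    unfolding continuous_at_sequentially comp_def
  proof (intro allI impI)
    fix u :: "nat \<Rightarrow> real" assume u: "u \<longlonglongrightarrow> t"
    then have "Bseq u" by (intro convergent_imp_Bseq) (auto simp: convergent_def)
    then obtain B where B: "\<And>n. \<bar>u n\<bar> \<le> B" "B > 0" by (auto simp: Bseq_def)
    show "(\<lambda>n. CLINT x|\<nu>. levy_kernel (u n) x) \<longlonglongrightarrow> (CLINT x|\<nu>. levy_kernel t x)"
    proof (rule integral_dominated_convergence[where w="\<lambda>x. (B\<^sup>2/2 + B + 2) * min 1 (x\<^sup>2)"])
      show "integrable \<nu> (\<lambda>x. (B\<^sup>2 / 2 + B + 2) * min 1 (x\<^sup>2))"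
        by (rule Bochner_Integration.integrable_mult_right[OF integrable_min_1_square])
      show "AE x in \<nu>. (\<lambda>n. levy_kernel (u n) x) \<longlonglongrightarrow> levy_kernel t x"
        unfolding levy_kernel_def by (intro AE_I2 tendsto_intros u)
      have "(u n)\<^sup>2 \<le> B\<^sup>2" for n using B(1)[of n] B(2) by (simp add: abs_le_square_iff[symmetric])
      then have "(u n)\<^sup>2 / 2 + \<bar>u n\<bar> + 2 \<le> B\<^sup>2 / 2 + B + 2" for n
        using B(1)[of n] by (intro add_mono) auto
      then show "AE x in \<nu>. norm (levy_kernel (u n) x) \<le> (B\<^sup>2 / 2 + B + 2) * min 1 (x\<^sup>2)" for n
        by (intro AE_I2 order_trans[OF norm_levy_kernel_le] mult_right_mono) auto
    qed measurable
  qed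
  then show ?thesis
    unfolding levy_exponent_def[abs_def] by (intro continuous_intros) auto
qed

lemma levy_exponent_measurable [measurable]: "levy_exponent \<in> borel_measurable borel"
  by (intro borel_measurable_continuous_onI continuous_at_imp_continuous_on ballI isCont_levy_exponent)

lemma levy_exponent_bounded:
  obtains B where "\<And>t. \<bar>t\<bar> \<le> R \<Longrightarrow> norm (levy_exponent t) \<le> B"
proof -
  have "compact (levy_exponent ` {-R..R})"
    by (intro compact_continuous_image continuous_at_imp_continuous_on ballI isCont_levy_exponent) simp
  then obtain B where "\<forall>z\<in>levy_exponent ` {-R..R}. norm z \<le> B"
    using compact_imp_bounded bounded_iff by blast
  then show ?thesis by (intro that[of B]) (auto simp: abs_le_iff)
qed

lemma second_difference_levy_exponent:
  "second_difference levy_exponent t s = complex_of_real (\<sigma>2 / 2 * s\<^sup>2)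
    + (CLINT x|\<nu>. iexp (t * x) * complex_of_real (1 - cos (s * x)))"
proof -
  have "levy_exponent = (\<lambda>t. \<i> * complex_of_real (t * \<gamma>)
      + (complex_of_real ((- (\<sigma>2 / 2)) * t\<^sup>2) + (CLINT x|\<nu>. levy_kernel t x)))"
    by (simp add: levy_exponent_def fun_eq_iff)
  then show ?thesis
    by (simp only: second_difference_add second_difference_linear second_difference_square
        second_difference_integral[OF integrable_levy_kernel] second_difference_levy_kernel) simp
qed

lemma avg_second_difference_levy_exponent:
  "avg_second_difference levy_exponent t
    = complex_of_real (\<sigma>2 / 6) + (CLINT x|\<nu>. complex_of_real (one_minus_sinc x) * iexp (t * x))"
proof -
  let ?jumps = "\<lambda>s. CLINT x|\<nu>. iexp (t * x) * complex_of_real (1 - cos (s * x))"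
  obtain B where B: "\<And>u. \<bar>u\<bar> \<le> \<bar>t\<bar> + 1 \<Longrightarrow> norm (levy_exponent u) \<le> B"
    using levy_exponent_bounded by blast
  have [measurable]: "second_difference levy_exponent t \<in> borel_measurable borel"
    unfolding second_difference_def[abs_def] by measurable
  have "complex_integrable unif (second_difference levy_exponent t)"
  proof (rule unif.integrable_const_bound[of _ "2 * B"])
    show "AE s in unif. norm (second_difference levy_exponent t s) \<le> 2 * B"
      using AE_unif by eventually_elim (auto intro!: norm_second_difference_le B)
  qed simp
  moreover have gauss: "integrable unif (\<lambda>s. \<sigma>2 / 2 * s\<^sup>2)"
  proof (rule integrable_mult_right, rule unif.integrable_const_bound[of _ 1])
    show "AE s in unif. norm (s\<^sup>2) \<le> 1"
      using AE_unif by eventually_elim (simp add: abs_square_le_1)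
  qed simp
  ultimately have "complex_integrable unif
      (\<lambda>s. second_difference levy_exponent t s - complex_of_real (\<sigma>2 / 2 * s\<^sup>2))"
    by (intro Bochner_Integration.integrable_diff integrable_of_real)
  then have "complex_integrable unif ?jumps"
    by (simp only: second_difference_levy_exponent add_diff_cancel_left')
  then have "avg_second_difference levy_exponent t
      = (CLINT s|unif. complex_of_real (\<sigma>2 / 2 * s\<^sup>2)) + (CLINT s|unif. ?jumps s)"
    unfolding avg_second_difference_def second_difference_levy_exponent
    by (intro Bochner_Integration.integral_add integrable_of_real gauss)
  also have "(CLINT s|unif. complex_of_real (\<sigma>2 / 2 * s\<^sup>2)) = complex_of_real (\<sigma>2 / 6)"
    unfolding integral_complex_of_real by (simp add: integral_unif_square)
  also have "(CLINT s|unif. ?jumps s) = (CLINT x|\<nu>. complex_of_real (one_minus_sinc x) * iexp (t * x))"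
    by (rule integral_unif_integral_iexp_one_minus_cos[OF sigma_finite_nu sets_nu integrable_min_1_square])
  finally show ?thesis .
qed

definition levy_shift :: "real \<Rightarrow> real" where
  "levy_shift \<tau> = \<gamma> + (LINT x:{0<..\<tau>}|\<nu>. x ^ 3 / (1 + x\<^sup>2)) - (LINT x:{\<tau><..}|\<nu>. x / (1 + x\<^sup>2))"

lemma integral_drift_kernel:
  assumes "0 < \<tau>"
  shows "(LINT x|\<nu>. drift_kernel \<tau> x) = levy_shift \<tau> - \<gamma> - \<tau> * L \<tau>"
proof -
  let ?small = "\<lambda>x. indicator {0<..\<tau>} x * (x^3 / (1 + x\<^sup>2)) :: real"
  let ?large = "\<lambda>x. indicator {\<tau><..} x * (x / (1 + x\<^sup>2)) :: real"
  have large: "integrable \<nu> ?large"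
    by (rule Bochner_Integration.integrable_bound[OF integrable_indicator_tail[OF assms]])
      (use abs_linear_ratio_le_1 in \<open>auto split: split_indicator simp del: abs_divide\<close>)
  have eq: "drift_kernel \<tau> x = ?small x - ?large x + \<tau> * indicator {\<tau><..} x" if "0 < x" for x
    using that assms linear_minus_linear_ratio[of x]
    by (auto simp: drift_kernel_def split: split_indicator)
  have int: "integrable \<nu> (\<lambda>x. drift_kernel \<tau> x + ?large x - \<tau> * indicator {\<tau><..} x)"
    by (intro Bochner_Integration.integrable_add Bochner_Integration.integrable_diff large
        integrable_mult_right integrable_indicator_tail assms
        jump_test_integrable_of_real[OF jump_test_drift_kernel])
  have "AE x in \<nu>. drift_kernel \<tau> x + ?large x - \<tau> * indicator {\<tau><..} x = ?small x"
    using AE_nu_pos by eventually_elim (simp add: eq)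
  then have small: "integrable \<nu> ?small"
    by (intro integrable_cong_AE_imp[OF int]) measurable
  have "(LINT x|\<nu>. drift_kernel \<tau> x) = (LINT x|\<nu>. ?small x - ?large x + \<tau> * indicator {\<tau><..} x)"
    using AE_nu_pos jump_test_integrable_of_real[OF jump_test_drift_kernel[OF assms]]
    by (intro integral_cong_AE) (auto elim!: eventually_mono simp: eq)
  also have "\<dots> = (LINT x|\<nu>. ?small x) - (LINT x|\<nu>. ?large x) + \<tau> * measure \<nu> {\<tau><..}"
    using small large integrable_indicator_tail[OF assms] by simp
  finally show ?thesis
    using measure_nu_tail[OF assms] by (simp add: levy_shift_def set_lebesgue_integral_def)
qed

context
  fixes \<delta> :: real
  assumes delta_pos: "0 < \<delta>"
begin

lemma finite_borel_measure_tail_nu: "finite_borel_measure (tail_part \<nu> \<delta>)"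
  using emeasure_nu_tail[OF delta_pos] by (intro finite_borel_measure_tail_part) auto

lemma measure_tail_nu_UNIV: "measure (tail_part \<nu> \<delta>) UNIV = - L \<delta>"
  using measure_nu_tail[OF delta_pos] by (simp add: measure_tail_part)

lemma cdf_tail_nu: "cdf (tail_part \<nu> \<delta>) x = L (max \<delta> x) - L \<delta>"
proof (cases "\<delta> < x")
  case True
  then have "{\<delta><..} \<inter> {..x} = {\<delta><..x}" by auto
  then show ?thesis
    using emeasure_nu_Ioc[of \<delta> x] L_le[of \<delta> x] True delta_pos
    by (simp add: cdf_def measure_tail_part measure_def[of \<nu>])
next
  case False
  then have "{\<delta><..} \<inter> {..x} = {}" by auto
  then show ?thesis
    using False by (simp add: cdf_def measure_tail_part max_def)
qed

lemma isCont_cdf_tail_nuD: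
  assumes "isCont (cdf (tail_part \<nu> \<delta>)) x" "\<delta> < x"
  shows "isCont L x"
proof -
  have "\<forall>\<^sub>F y in nhds x. cdf (tail_part \<nu> \<delta>) y + L \<delta> = L y"
    using eventually_nhds_in_open[of "{\<delta><..}" x] assms(2)
    by (auto elim!: eventually_mono simp: cdf_tail_nu)
  moreover have "isCont (\<lambda>y. cdf (tail_part \<nu> \<delta>) y + L \<delta>) x"
    using assms(1) by (intro continuous_intros)
  ultimately show ?thesis by (simp add: isCont_cong)
qed

end

end

section \<open>Truncated moments of nonnegative distributions\<close>

definition trunc_mean :: "real measure \<Rightarrow> real \<Rightarrow> real" where
  "trunc_mean M \<tau> = (LINT x|M. indicator {..\<tau>} x * x)"

definition trunc_second_moment :: "real measure \<Rightarrow> real \<Rightarrow> real" where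
  "trunc_second_moment M \<tau> = (LINT x|M. indicator {..\<tau>} x * x\<^sup>2)"

definition trunc_var :: "real measure \<Rightarrow> real \<Rightarrow> real" where
  "trunc_var M \<tau> = trunc_second_moment M \<tau> - (trunc_mean M \<tau>)\<^sup>2"

definition centered :: "real measure \<Rightarrow> real measure" where
  "centered M = distr M borel (\<lambda>x. x - trunc_mean M 1)"

definition spread :: "real measure \<Rightarrow> real" where
  "spread M = trunc_var M 1 + measure M {1<..}"

definition symmetrization :: "real measure \<Rightarrow> real measure" where
  "symmetrization M = (M \<star> distr M borel uminus)"

context real_distribution
begin

lemma real_distribution_M: "real_distribution M" ..

lemma prob_UNIV [simp]: "prob UNIV = 1"
  using prob_space by simp

lemma real_distribution_centered: "real_distribution (centered M)"
  unfolding centered_def by (rule real_distribution_distr) simp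

lemma integral_centered:
  fixes f :: "real \<Rightarrow> 'b::{banach, second_countable_topology}"
  shows "f \<in> borel_measurable borel \<Longrightarrow> (\<integral>x. f x \<partial>centered M) = expectation (\<lambda>x. f (x - trunc_mean M 1))"
  unfolding centered_def by (rule integral_distr) auto

lemma char_centered: "char (centered M) t = iexp (- (t * trunc_mean M 1)) * char M t"
proof -
  have "char (centered M) t = expectation (\<lambda>x. iexp (- (t * trunc_mean M 1)) * iexp (t * x))"
    unfolding char_def by (simp add: integral_centered right_diff_distrib exp_diff exp_minus field_simps)
  then show ?thesis by (simp add: char_def)
qed

lemma char_uminus: "char M (- t) = cnj (char M t)"
proof -
  have "cnj (char M t) = expectation (\<lambda>x. cnj (iexp (t * x)))"
    unfolding char_def by simp
  also have "\<dots> = char M (- t)"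
    by (simp add: char_def exp_cnj)
  finally show ?thesis by simp
qed

lemma char_symmetrization: "char (symmetrization M) t = complex_of_real ((norm (char M t))\<^sup>2)"
proof -
  have "char (distr M borel uminus) t = cnj (char M t)"
    unfolding char_uminus[symmetric] by (simp add: char_def integral_distr)
  then show ?thesis
    unfolding complex_norm_square by (simp add: symmetrization_def char_convolution[OF real_distribution_M])
qed

lemma real_distribution_symmetrization: "real_distribution (symmetrization M)"
  unfolding symmetrization_def by (intro real_distribution_convolution real_distribution_M) simp

lemma integral_unif_one_minus_norm_char_square:
  "(\<integral>s. 1 - (norm (char M s))\<^sup>2 \<partial>unif) = (\<integral>x. one_minus_sinc x \<partial>symmetrization M)"
proof -
  interpret S: real_distribution "symmetrization M" by (rule real_distribution_symmetrization)
  have "complex_of_real (1 - (norm (char M s))\<^sup>2) = second_difference (char (symmetrization M)) 0 s" for s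
    by (simp add: second_difference_def char_symmetrization char_uminus char_zero)
  then have "(CLINT s|unif. complex_of_real (1 - (norm (char M s))\<^sup>2))
      = avg_second_difference (char (symmetrization M)) 0"
    by (simp only: avg_second_difference_def)
  also have "\<dots> = (CLINT x|symmetrization M. complex_of_real (one_minus_sinc x))"
    unfolding S.avg_second_difference_char by simp
  finally show ?thesis by (simp only: integral_complex_of_real of_real_eq_iff)
qed

lemma integral_symmetrization:
  fixes f :: "real \<Rightarrow> real"
  assumes "f \<in> borel_measurable borel" "\<And>x. \<bar>f x\<bar> \<le> B"
  shows "(\<integral>x. f x \<partial>symmetrization M) = expectation (\<lambda>x. expectation (\<lambda>y. f (x - y)))"
  unfolding symmetrization_def
  using assms by (subst integral_convolution[OF real_distribution_M, where B=B]) (auto simp: integral_distr)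

end

locale nonneg_distribution = real_distribution +
  assumes AE_nonneg: "AE x in M. 0 \<le> x"
begin

lemma integrable_bounded_nonneg:
  fixes f :: "real \<Rightarrow> 'b::{banach, second_countable_topology}"
  assumes "f \<in> borel_measurable borel" "\<And>x. 0 \<le> x \<Longrightarrow> norm (f x) \<le> B"
  shows "integrable M f"
  using assms AE_nonneg by (intro integrable_const_bound[of _ B]) (auto elim: eventually_mono)

lemma expectation_mono_nonneg:
  fixes f g :: "real \<Rightarrow> real"
  assumes "integrable M f" "integrable M g" "\<And>x. 0 \<le> x \<Longrightarrow> f x \<le> g x"
  shows "expectation f \<le> expectation g"
  using assms AE_nonneg by (intro integral_mono_AE) (auto elim: eventually_mono)

lemma norm_expectation_le_nonneg:
  fixes f :: "real \<Rightarrow> 'b::{banach, second_countable_topology}"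
  assumes "integrable M f" "integrable M g" "\<And>x. 0 \<le> x \<Longrightarrow> norm (f x) \<le> g x"
  shows "norm (expectation f) \<le> expectation g"
  by (rule order_trans[OF integral_norm_bound expectation_mono_nonneg]) (use assms in auto)

lemma expectation_atMost: "expectation (indicator {..\<delta>}) = 1 - prob {\<delta><..}"
  using prob_compl[of "{\<delta><..}"] by (simp add: Compl_greaterThan[symmetric] Compl_eq_Diff_UNIV)

lemma integrable_indicators:
  "integrable M (indicator {..\<delta>} :: real \<Rightarrow> real)" "integrable M (indicator {\<delta><..} :: real \<Rightarrow> real)"
  by (auto intro!: integrable_bounded[of _ 1] simp: indicator_def)

lemma integrable_trunc:
  "integrable M (\<lambda>x. indicator {..\<delta>} x * x)" "integrable M (\<lambda>x. indicator {..\<delta>} x * x\<^sup>2)"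
proof -
  show "integrable M (\<lambda>x. indicator {..\<delta>} x * x)"
    by (rule integrable_bounded_nonneg[of _ "\<bar>\<delta>\<bar>"]) (auto split: split_indicator)
  show "integrable M (\<lambda>x. indicator {..\<delta>} x * x\<^sup>2)"
    by (rule integrable_bounded_nonneg[of _ "\<delta>\<^sup>2"]) (auto split: split_indicator intro: power_mono)
qed

lemma trunc_mean_nonneg: "0 \<le> trunc_mean M \<tau>"
  unfolding trunc_mean_def using AE_nonneg by (intro integral_nonneg_AE) (auto elim: eventually_mono)

lemma trunc_mean_le: "0 \<le> \<tau> \<Longrightarrow> trunc_mean M \<tau> \<le> \<tau>"
  using expectation_mono_nonneg[OF integrable_trunc(1)[of \<tau>], of "\<lambda>_. \<tau>"]
  by (auto simp: trunc_mean_def split: split_indicator)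

lemma trunc_mean_1_le:
  assumes "0 < \<eta>"
  shows "trunc_mean M 1 \<le> \<eta> + prob {\<eta><..}"
proof -
  have "trunc_mean M 1 \<le> expectation (\<lambda>x. \<eta> + indicator {\<eta><..} x)"
    unfolding trunc_mean_def
    using assms integrable_indicators(2)[of \<eta>]
    by (intro expectation_mono_nonneg integrable_trunc) (auto split: split_indicator)
  then show ?thesis
    using integrable_indicators(2)[of \<eta>] by simp
qed

lemma trunc_mean_mono:
  assumes "\<delta> \<le> \<tau>"
  shows "trunc_mean M \<delta> \<le> trunc_mean M \<tau>"
  unfolding trunc_mean_def
  by (rule expectation_mono_nonneg[OF integrable_trunc(1) integrable_trunc(1)])
    (use assms in \<open>auto split: split_indicator\<close>)

lemma expectation_min:
  assumes "0 \<le> \<tau>"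
  shows "expectation (\<lambda>x. min x \<tau>) = trunc_mean M \<tau> + \<tau> * prob {\<tau><..}"
proof -
  have "(\<lambda>x. min x \<tau>) = (\<lambda>x. indicator {..\<tau>} x * x + \<tau> * indicator {\<tau><..} x)"
    by (auto simp: fun_eq_iff split: split_indicator)
  then show ?thesis
    using integrable_trunc(1)[of \<tau>] integrable_indicators(2)[of \<tau>] by (simp add: trunc_mean_def)
qed

lemma expectation_min_shift:
  assumes "0 \<le> c" "0 \<le> \<tau>"
  shows "\<bar>expectation (\<lambda>x. min (x - c) \<tau>) - (trunc_mean M \<tau> + \<tau> * prob {\<tau><..} - c)\<bar> \<le> c * prob {\<tau><..}"
proof -
  have int: "integrable M (\<lambda>x. min x \<sigma>)" if "0 \<le> \<sigma>" for \<sigma>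
    using that by (intro integrable_bounded_nonneg[of _ \<sigma>]) auto
  have "(\<lambda>x. min (x - c) \<tau>) = (\<lambda>x. min x (\<tau> + c) - c)" by (auto simp: fun_eq_iff)
  then have "expectation (\<lambda>x. min (x - c) \<tau>) = expectation (\<lambda>x. min x (\<tau> + c)) - c"
    using assms int[of "\<tau> + c"] by simp
  moreover have "norm (expectation (\<lambda>x. min x (\<tau> + c) - min x \<tau>)) \<le> expectation (\<lambda>x. c * indicator {\<tau><..} x)"
    using assms
    by (intro norm_expectation_le_nonneg Bochner_Integration.integrable_diff int integrable_mult_right
        integrable_indicators) (auto split: split_indicator)
  ultimately show ?thesis
    using assms int[of "\<tau> + c"] int[of \<tau>] expectation_min[of \<tau>] by simp
qed

lemma trunc_mean_diff_le:
  assumes "\<delta> \<le> \<tau>" "0 \<le> \<tau>"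
  shows "trunc_mean M \<tau> - trunc_mean M \<delta> \<le> \<tau> * prob {\<delta><..}"
proof -
  have "trunc_mean M \<tau> \<le> expectation (\<lambda>x. indicator {..\<delta>} x * x + \<tau> * indicator {\<delta><..} x)"
    unfolding trunc_mean_def
    using assms integrable_indicators(2)[of \<delta>] integrable_trunc(1)[of \<delta>]
    by (intro expectation_mono_nonneg integrable_trunc) (auto split: split_indicator)
  then show ?thesis
    using integrable_indicators(2)[of \<delta>] integrable_trunc(1)[of \<delta>] by (simp add: trunc_mean_def)
qed

lemma expectation_trunc_minus_const:
  "integrable M (\<lambda>x. indicator {..\<delta>} x * (x - c))"
  "expectation (\<lambda>x. indicator {..\<delta>} x * (x - c)) = trunc_mean M \<delta> - c * (1 - prob {\<delta><..})"
proof -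
  have eq: "(\<lambda>x. indicator {..\<delta>} x * (x - c)) = (\<lambda>x. indicator {..\<delta>} x * x - c * indicator {..\<delta>} x)"
    by (simp add: fun_eq_iff algebra_simps)
  show "integrable M (\<lambda>x. indicator {..\<delta>} x * (x - c))"
    unfolding eq using integrable_indicators(1) integrable_trunc(1)
    by (intro Bochner_Integration.integrable_diff integrable_mult_right)
  show "expectation (\<lambda>x. indicator {..\<delta>} x * (x - c)) = trunc_mean M \<delta> - c * (1 - prob {\<delta><..})"
    unfolding eq expectation_atMost[symmetric] trunc_mean_def
    using integrable_indicators(1)[of \<delta>] integrable_trunc(1)[of \<delta>] by simp
qed

lemma trunc_second_moment_about:
  "integrable M (\<lambda>x. indicator {..\<delta>} x * (x - c)\<^sup>2)"
  "expectation (\<lambda>x. indicator {..\<delta>} x * (x - c)\<^sup>2)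
    = trunc_var M \<delta> + (trunc_mean M \<delta> - c)\<^sup>2 - c\<^sup>2 * prob {\<delta><..}"
proof -
  have eq: "(\<lambda>x. indicator {..\<delta>} x * (x - c)\<^sup>2)
    = (\<lambda>x. indicator {..\<delta>} x * x\<^sup>2 - (2 * c) * (indicator {..\<delta>} x * x) + c\<^sup>2 * indicator {..\<delta>} x)"
    by (simp add: fun_eq_iff power2_diff algebra_simps)
  show "integrable M (\<lambda>x. indicator {..\<delta>} x * (x - c)\<^sup>2)"
    unfolding eq using integrable_indicators(1) integrable_trunc
    by (intro Bochner_Integration.integrable_add Bochner_Integration.integrable_diff integrable_mult_right)
  have "expectation (\<lambda>x. indicator {..\<delta>} x * (x - c)\<^sup>2)
      = trunc_second_moment M \<delta> - 2 * c * trunc_mean M \<delta> + c\<^sup>2 * (1 - prob {\<delta><..})"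
    unfolding eq trunc_mean_def trunc_second_moment_def expectation_atMost[symmetric]
    using integrable_indicators(1)[of \<delta>] integrable_trunc[of \<delta>] by simp
  also have "\<dots> = trunc_var M \<delta> + (trunc_mean M \<delta> - c)\<^sup>2 - c\<^sup>2 * prob {\<delta><..}"
    by (simp add: trunc_var_def power2_diff algebra_simps)
  finally show "expectation (\<lambda>x. indicator {..\<delta>} x * (x - c)\<^sup>2)
      = trunc_var M \<delta> + (trunc_mean M \<delta> - c)\<^sup>2 - c\<^sup>2 * prob {\<delta><..}" .
qed

lemma trunc_var_nonneg: "0 \<le> trunc_var M \<delta>"
proof -
  have "0 \<le> expectation (\<lambda>x. indicator {..\<delta>} x * (x - trunc_mean M \<delta>)\<^sup>2)"
    by (rule integral_nonneg_AE) simp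
  moreover have "0 \<le> (trunc_mean M \<delta>)\<^sup>2 * prob {\<delta><..}" by simp
  ultimately show ?thesis
    unfolding trunc_second_moment_about(2) diff_self power_zero_numeral by linarith
qed

lemma trunc_second_moment_1_le: "trunc_second_moment M 1 \<le> trunc_mean M 1"
  unfolding trunc_second_moment_def trunc_mean_def
  by (rule expectation_mono_nonneg[OF integrable_trunc(2,1)])
    (auto simp: power2_eq_square mult_left_le split: split_indicator)

lemma trunc_var_1_le:
  assumes "\<tau> \<le> 1"
  shows "trunc_var M 1 \<le> trunc_var M \<tau> + prob {\<tau><..}"
proof -
  have "trunc_second_moment M 1 \<le> expectation (\<lambda>x. indicator {..\<tau>} x * x\<^sup>2 + indicator {\<tau><..} x)"
    unfolding trunc_second_moment_def
    using assms integrable_indicators(2) integrable_trunc(2)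
    by (intro expectation_mono_nonneg Bochner_Integration.integrable_add)
      (auto split: split_indicator intro: power_le_one)
  also have "\<dots> = trunc_second_moment M \<tau> + prob {\<tau><..}"
    using integrable_indicators(2)[of \<tau>] integrable_trunc(2)[of \<tau>] by (simp add: trunc_second_moment_def)
  finally have "trunc_second_moment M 1 \<le> trunc_second_moment M \<tau> + prob {\<tau><..}" .
  moreover have "(trunc_mean M \<tau>)\<^sup>2 \<le> (trunc_mean M 1)\<^sup>2"
    by (intro power_mono trunc_mean_mono trunc_mean_nonneg assms)
  ultimately show ?thesis by (simp add: trunc_var_def)
qed

lemma prob_tail_antimono: "\<sigma> \<le> \<tau> \<Longrightarrow> prob {\<tau><..} \<le> prob {\<sigma><..}"
  by (rule finite_measure_mono) auto

lemma spread_nonneg: "0 \<le> spread M"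
  using trunc_var_nonneg by (simp add: spread_def)

lemma spread_le_trunc_var:
  "\<tau> \<le> 1 \<Longrightarrow> spread M \<le> trunc_var M \<tau> + 2 * prob {\<tau><..}"
  using trunc_var_1_le[of \<tau>] prob_tail_antimono[of \<tau> 1] by (simp add: spread_def)

lemma spread_le:
  assumes "0 < \<eta>" "\<eta> \<le> 1"
  shows "spread M \<le> \<eta> + 2 * prob {\<eta><..}"
proof -
  have "trunc_var M 1 \<le> trunc_second_moment M 1" by (simp add: trunc_var_def)
  then show ?thesis
    using trunc_second_moment_1_le trunc_mean_1_le[OF assms(1)] prob_tail_antimono[OF assms(2)]
    by (simp add: spread_def)
qed

definition centered_remainder :: "real \<Rightarrow> real \<Rightarrow> complex" where
  "centered_remainder t x = iexp (t * (x - trunc_mean M 1)) - 1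
    - \<i> * complex_of_real (t * (indicator {..1} x * (x - trunc_mean M 1)))"

lemma integrable_trunc_linear: "integrable M (\<lambda>x. t * (indicator {..1} x * (x - c)))"
  by (intro integrable_mult_right expectation_trunc_minus_const)

lemma integrable_iexp_centered: "complex_integrable M (\<lambda>x. iexp (t * (x - c)))"
  by (rule integrable_bounded[of _ 1]) auto

lemma integrable_centered_remainder: "complex_integrable M (centered_remainder t)"
  unfolding centered_remainder_def[abs_def]
  by (intro Bochner_Integration.integrable_diff integrable_iexp_centered integrable_mult_right integrable_of_real
      integrable_trunc_linear) simp

lemma char_centered_minus_1_eq:
  "char (centered M) t - 1
    = expectation (centered_remainder t) + \<i> * complex_of_real (t * (trunc_mean M 1 * prob {1<..}))"
proof -
  define c where "c = trunc_mean M 1"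
  have "expectation (centered_remainder t)
      = char (centered M) t - 1 - \<i> * complex_of_real (LINT x|M. t * (indicator {..1} x * (x - c)))"
    unfolding centered_remainder_def using integrable_iexp_centered[of t c] integrable_trunc_linear[of t c]
    by (simp add: char_def integral_centered c_def del: of_real_mult of_real_diff)
  also have "(LINT x|M. t * (indicator {..1} x * (x - c))) = t * (c * prob {1<..})"
    unfolding integral_mult_right_zero expectation_trunc_minus_const by (simp add: c_def algebra_simps)
  finally show ?thesis by (simp add: c_def)
qed

lemma norm_expectation_centered_remainder_le:
  "norm (expectation (centered_remainder t)) \<le> t\<^sup>2 / 2 * trunc_var M 1 + 2 * prob {1<..}"
proof -
  define c where "c = trunc_mean M 1"
  have "norm (expectation (centered_remainder t))
      \<le> expectation (\<lambda>x. t\<^sup>2 / 2 * (indicator {..1} x * (x - c)\<^sup>2) + 2 * indicator {1<..} x)"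
  proof (rule norm_expectation_le_nonneg[OF integrable_centered_remainder])
    show "integrable M (\<lambda>x. t\<^sup>2 / 2 * (indicator {..1} x * (x - c)\<^sup>2) + 2 * indicator {1<..} x)"
      by (intro Bochner_Integration.integrable_add integrable_mult_right trunc_second_moment_about
          integrable_indicators)
    show "norm (centered_remainder t x) \<le> t\<^sup>2 / 2 * (indicator {..1} x * (x - c)\<^sup>2) + 2 * indicator {1<..} x" for x
      using norm_iexp_linear_le[of "t * (x - c)"] norm_iexp_minus_1_le_2[of "t * (x - c)"]
      by (auto simp: centered_remainder_def c_def power_mult_distrib simp del: of_real_mult of_real_diff
          split: split_indicator)
  qed
  also have "\<dots> = t\<^sup>2 / 2 * (trunc_var M 1 - c\<^sup>2 * prob {1<..}) + 2 * prob {1<..}"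
    using trunc_second_moment_about[of 1 c] integrable_indicators(2)[of 1] by (simp add: c_def)
  also have "\<dots> \<le> t\<^sup>2 / 2 * trunc_var M 1 + 2 * prob {1<..}"
    by (intro add_right_mono mult_left_mono) auto
  finally show ?thesis .
qed

lemma norm_char_centered_minus_1_le:
  "norm (char (centered M) t - 1) \<le> (t\<^sup>2 / 2 + \<bar>t\<bar> + 2) * spread M"
proof -
  define T where "T = prob {1<..}"
  have T: "0 \<le> T" by (simp add: T_def)
  have "trunc_mean M 1 * T \<le> T"
    using mult_right_mono[OF trunc_mean_le[of 1] T] by simp
  then have "norm (\<i> * complex_of_real (t * (trunc_mean M 1 * T))) \<le> \<bar>t\<bar> * T"
    using T trunc_mean_nonneg[of 1]
    by (simp only: norm_mult norm_ii norm_of_real abs_mult mult_1) (intro mult_left_mono; simp)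
  then have "norm (char (centered M) t - 1) \<le> (t\<^sup>2 / 2 * trunc_var M 1 + 2 * T) + \<bar>t\<bar> * T"
    unfolding char_centered_minus_1_eq T_def by (intro norm_triangle_mono norm_expectation_centered_remainder_le)
  also have "\<dots> \<le> (t\<^sup>2 / 2 + \<bar>t\<bar> + 2) * spread M"
  proof -
    have "0 \<le> t\<^sup>2 / 2 * T" "0 \<le> \<bar>t\<bar> * trunc_var M 1" "0 \<le> trunc_var M 1"
      using T trunc_var_nonneg by auto
    then show ?thesis unfolding spread_def T_def[symmetric] distrib_left distrib_right by linarith
  qed
  finally show ?thesis .
qed

text \<open>The spread is controlled by the symmetrised law: \<open>(x - y)\<^sup>2\<close> integrated over \<open>[0, 1]\<^sup>2\<close>
  controls the truncated variance, and a point above \<open>1\<close> is at distance \<open>1 / 2\<close> from at least half of the mass.\<close>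

lemma integrable_one_minus_sinc:
  assumes "f \<in> borel_measurable borel"
  shows "integrable M (\<lambda>y. one_minus_sinc (f y))"
  using assms by (intro integrable_bounded[of _ 2]) (auto simp: one_minus_sinc_nonneg one_minus_sinc_le_2)

lemma double_expectation_le_symmetrization:
  assumes h: "integrable M h"
    and le: "\<And>x. 0 \<le> x \<Longrightarrow> h x \<le> expectation (\<lambda>y. C * one_minus_sinc (x - y))"
  shows "expectation h \<le> C * (\<integral>x. one_minus_sinc x \<partial>symmetrization M)"
proof -
  have "integrable M (\<lambda>x. expectation (\<lambda>y. one_minus_sinc (x - y)))"
  proof (rule integrable_bounded[of _ 2])
    show "norm (expectation (\<lambda>y. one_minus_sinc (x - y))) \<le> 2" for x
      using norm_integral_bounded_le[of "\<lambda>y. one_minus_sinc (x - y)" 2]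
      by (simp add: one_minus_sinc_nonneg one_minus_sinc_le_2)
  qed measurable
  then have "expectation h \<le> expectation (\<lambda>x. C * expectation (\<lambda>y. one_minus_sinc (x - y)))"
    using h le by (intro expectation_mono_nonneg integrable_mult_right) auto
  also have "\<dots> = C * (\<integral>x. one_minus_sinc x \<partial>symmetrization M)"
    by (subst integral_symmetrization[where B=2]) (auto simp: one_minus_sinc_nonneg one_minus_sinc_le_2)
  finally show ?thesis .
qed

lemma prob_tail_le_symmetrization:
  assumes "prob {1/2<..} \<le> 1/2"
  shows "prob {1<..} \<le> 64 * (\<integral>x. one_minus_sinc x \<partial>symmetrization M)"
proof -
  have "expectation (\<lambda>x. 1/2 * indicator {1<..} x) \<le> 32 * (\<integral>x. one_minus_sinc x \<partial>symmetrization M)"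
  proof (rule double_expectation_le_symmetrization)
    show "integrable M (\<lambda>x. 1/2 * indicator {1<..} x :: real)"
      by (intro integrable_mult_right integrable_indicators)
    fix x :: real
    have "1/2 * indicator {1<..} x \<le> indicator {1<..} x * expectation (indicator {..1/2} :: real \<Rightarrow> real)"
      unfolding expectation_atMost using assms by (auto split: split_indicator)
    also have "\<dots> = expectation (\<lambda>y. indicator {1<..} x * indicator {..1/2} y)" by simp
    also have "\<dots> \<le> expectation (\<lambda>y. 32 * one_minus_sinc (x - y))"
    proof (intro expectation_mono_nonneg integrable_mult_right integrable_indicators integrable_one_minus_sinc)
      fix y :: real
      have "1/4 \<le> min 1 ((x - y)\<^sup>2)" if "1 < x" "y \<le> 1/2"
        using power_mono[of "1/2" "x - y" 2] that by (simp add: power_divide)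
      then show "indicator {1<..} x * indicator {..1/2} y \<le> 32 * one_minus_sinc (x - y)"
        using min_1_square_le_one_minus_sinc[of "x - y"] one_minus_sinc_nonneg[of "x - y"]
        by (auto split: split_indicator)
    qed simp
    finally show "1/2 * indicator {1<..} x \<le> expectation (\<lambda>y. 32 * one_minus_sinc (x - y))" .
  qed
  then show ?thesis by simp
qed

lemma trunc_var_le_symmetrization:
  "trunc_var M 1 \<le> 4 * (\<integral>x. one_minus_sinc x \<partial>symmetrization M) + prob {1<..}"
proof -
  define m where "m = trunc_mean M 1"
  define s where "s = trunc_second_moment M 1"
  define T where "T = prob {1<..}"
  define h where "h x = indicator {..1} x * (s - m\<^sup>2 + (m - x)\<^sup>2 - x\<^sup>2 * T)" for x
  have h_eq: "h = (\<lambda>x. s * indicator {..1} x - 2 * m * (indicator {..1} x * x) + (1 - T) * (indicator {..1} x * x\<^sup>2))"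
    by (simp add: h_def fun_eq_iff power2_diff algebra_simps)
  have "expectation h \<le> 8 * (\<integral>x. one_minus_sinc x \<partial>symmetrization M)"
  proof (rule double_expectation_le_symmetrization)
    show "integrable M h"
      unfolding h_eq using integrable_indicators(1) integrable_trunc
      by (intro Bochner_Integration.integrable_add Bochner_Integration.integrable_diff integrable_mult_right)
    fix x :: real assume x: "0 \<le> x"
    have "h x = indicator {..1} x * expectation (\<lambda>y. indicator {..1} y * (y - x)\<^sup>2)"
      unfolding trunc_second_moment_about(2) by (simp add: h_def trunc_var_def m_def s_def T_def)
    also have "\<dots> = expectation (\<lambda>y. indicator {..1} x * (indicator {..1} y * (y - x)\<^sup>2))" by simp
    also have "\<dots> \<le> expectation (\<lambda>y. 8 * one_minus_sinc (x - y))"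
    proof (intro expectation_mono_nonneg integrable_mult_right trunc_second_moment_about integrable_one_minus_sinc)
      fix y :: real assume y: "0 \<le> y"
      have "(y - x)\<^sup>2 \<le> min 1 ((x - y)\<^sup>2)" if "x \<le> 1" "y \<le> 1"
        using that x y abs_square_le_1[of "x - y"] by (simp add: power2_commute abs_le_iff)
      then show "indicator {..1} x * (indicator {..1} y * (y - x)\<^sup>2) \<le> 8 * one_minus_sinc (x - y)"
        using min_1_square_le_one_minus_sinc[of "x - y"] one_minus_sinc_nonneg[of "x - y"]
        by (auto split: split_indicator)
    qed simp
    finally show "h x \<le> expectation (\<lambda>y. 8 * one_minus_sinc (x - y))" .
  qed
  moreover have "expectation h = 2 * (s * (1 - T) - m\<^sup>2)"
  proof -
    have "expectation h = s * (1 - T) - 2 * m * m + (1 - T) * s"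
      unfolding h_eq using integrable_indicators(1)[of 1] integrable_trunc[of 1] expectation_atMost[of 1]
      by (simp add: m_def s_def T_def trunc_mean_def trunc_second_moment_def)
    then show ?thesis by (simp add: power2_eq_square algebra_simps)
  qed
  moreover have "s * T \<le> 1 * T"
    using trunc_second_moment_1_le trunc_mean_le[of 1]
    by (intro mult_right_mono) (auto simp: s_def T_def)
  ultimately show ?thesis
    by (simp add: trunc_var_def m_def s_def T_def algebra_simps)
qed

lemma spread_le_symmetrization:
  "prob {1/2<..} \<le> 1/2 \<Longrightarrow> spread M \<le> 132 * (\<integral>x. one_minus_sinc x \<partial>symmetrization M)"
  using prob_tail_le_symmetrization trunc_var_le_symmetrization by (simp add: spread_def)

end

section \<open>Null arrays\<close>

locale null_array =
  fixes I :: "nat \<Rightarrow> 'i set" and Q :: "nat \<Rightarrow> 'i \<Rightarrow> real measure" and A :: "nat \<Rightarrow> real"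
  assumes finite_I: "\<And>d. finite (I d)"
    and nonneg_Q: "\<And>d i. nonneg_distribution (Q d i)"
    and null: "\<And>\<tau> e. 0 < \<tau> \<Longrightarrow> 0 < e \<Longrightarrow> \<forall>\<^sub>F d in sequentially. \<forall>i\<in>I d. measure (Q d i) {\<tau><..} \<le> e"
begin

sublocale Q: nonneg_distribution "Q d i" for d i
  by (rule nonneg_Q)

abbreviation center :: "nat \<Rightarrow> 'i \<Rightarrow> real" where
  "center d i \<equiv> trunc_mean (Q d i) 1"

definition tail_sum :: "nat \<Rightarrow> real \<Rightarrow> real" where
  "tail_sum d x = (\<Sum>i\<in>I d. measure (Q d i) {x<..})"

definition mean_sum :: "nat \<Rightarrow> real \<Rightarrow> real" where
  "mean_sum d \<tau> = (\<Sum>i\<in>I d. trunc_mean (Q d i) \<tau>)"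

definition var_sum :: "nat \<Rightarrow> real \<Rightarrow> real" where
  "var_sum d \<tau> = (\<Sum>i\<in>I d. trunc_var (Q d i) \<tau>)"

definition spread_sum :: "nat \<Rightarrow> real" where
  "spread_sum d = (\<Sum>i\<in>I d. spread (Q d i))"

definition centered_sum :: "nat \<Rightarrow> (real \<Rightarrow> 'b) \<Rightarrow> 'b::{banach, second_countable_topology}" where
  "centered_sum d f = (\<Sum>i\<in>I d. \<integral>x. f x \<partial>centered (Q d i))"

definition centered_second_moment :: "nat \<Rightarrow> real \<Rightarrow> real" where
  "centered_second_moment d \<tau> = (\<Sum>i\<in>I d. LINT x|Q d i. indicator {..\<tau>} x * (x - center d i)\<^sup>2)"

definition row_law :: "nat \<Rightarrow> real measure" where
  "row_law d = distr (PiM (I d) (Q d)) borel (\<lambda>x. (\<Sum>i\<in>I d. x i) - A d)"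

definition accompanying_exponent :: "nat \<Rightarrow> real \<Rightarrow> complex" where
  "accompanying_exponent d t
    = (\<Sum>i\<in>I d. char (centered (Q d i)) t - 1) + \<i> * complex_of_real (t * (mean_sum d 1 - A d))"

definition drift :: "nat \<Rightarrow> real" where
  "drift d = mean_sum d 1 - A d + centered_sum d (\<lambda>x. x / (1 + x\<^sup>2))"

sublocale centered: real_distribution "centered (Q d i)" for d i
  by (rule Q.real_distribution_centered)

lemma center_nonneg: "0 \<le> center d i"
  by (rule Q.trunc_mean_nonneg)

lemma center_le_1: "center d i \<le> 1"
  using Q.trunc_mean_le[of 1] by simp

lemma tail_sum_antimono: "x \<le> y \<Longrightarrow> tail_sum d y \<le> tail_sum d x"
  unfolding tail_sum_def by (intro sum_mono Q.prob_tail_antimono)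

lemma spread_null:
  assumes "0 < e"
  shows "\<forall>\<^sub>F d in sequentially. \<forall>i\<in>I d. spread (Q d i) \<le> e"
proof -
  define \<eta> where "\<eta> = min 1 (e/3)"
  have \<eta>: "0 < \<eta>" "\<eta> \<le> 1" "3 * \<eta> \<le> e" using assms by (auto simp: \<eta>_def)
  show ?thesis
    using null[OF \<eta>(1,1)]
  proof eventually_elim
    case (elim d)
    then have "spread (Q d i) \<le> e" if "i \<in> I d" for i
      using that Q.spread_le[OF \<eta>(1,2), of d i] \<eta>(3) by fastforce
    then show ?case by blast
  qed
qed

lemma center_null:
  assumes "0 < e"
  shows "\<forall>\<^sub>F d in sequentially. \<forall>i\<in>I d. center d i \<le> e"
proof -
  have "0 < e/2" using assms by simp
  from null[OF this this] show ?thesis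
  proof eventually_elim
    case (elim d)
    then have "center d i \<le> e" if "i \<in> I d" for i
      using that Q.trunc_mean_1_le[OF \<open>0 < e/2\<close>, of d i] by fastforce
    then show ?case by blast
  qed
qed

lemma sum_tendsto_0_of_null_multiple_of_tail:
  fixes v :: "nat \<Rightarrow> 'i \<Rightarrow> 'b::real_normed_vector"
  assumes B: "\<forall>\<^sub>F d in sequentially. tail_sum d \<delta> \<le> B"
    and v: "\<And>e. 0 < e \<Longrightarrow> \<forall>\<^sub>F d in sequentially. \<forall>i\<in>I d. norm (v d i) \<le> e * measure (Q d i) {\<delta><..}"
  shows "(\<lambda>d. \<Sum>i\<in>I d. v d i) \<longlonglongrightarrow> 0"
proof (rule tendstoI)
  fix e :: real assume "0 < e"
  define \<eta> where "\<eta> = e / (\<bar>B\<bar> + 1)"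
  have "0 < \<eta>" using \<open>0 < e\<close> by (simp add: \<eta>_def)
  from v[OF this] B show "\<forall>\<^sub>F d in sequentially. dist (\<Sum>i\<in>I d. v d i) 0 < e"
  proof eventually_elim
    case (elim d)
    have "norm (\<Sum>i\<in>I d. v d i) \<le> (\<Sum>i\<in>I d. \<eta> * measure (Q d i) {\<delta><..})"
      using elim(1) by (intro sum_norm_le) auto
    also have "\<dots> = \<eta> * tail_sum d \<delta>" by (simp add: tail_sum_def sum_distrib_left)
    also have "\<dots> < \<eta> * (\<bar>B\<bar> + 1)"
      using elim(2) \<open>0 < \<eta>\<close> by (intro mult_strict_left_mono) auto
    also have "\<dots> = e" by (simp add: \<eta>_def)
    finally show ?case by simp
  qed
qed

lemma centered_second_moment_minus_var_sum_tendsto_0: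
  assumes \<tau>: "0 < \<tau>" "\<tau> \<le> 1" and B: "\<forall>\<^sub>F d in sequentially. tail_sum d \<tau> \<le> B"
  shows "(\<lambda>d. centered_second_moment d \<tau> - var_sum d \<tau>) \<longlonglongrightarrow> 0"
proof -
  let ?T = "\<lambda>d i. measure (Q d i) {\<tau><..}"
  have mean_le: "(trunc_mean (Q d i) \<tau> - center d i)\<^sup>2 \<le> ?T d i * ?T d i" for d i
  proof -
    have "\<bar>trunc_mean (Q d i) \<tau> - center d i\<bar> \<le> \<bar>?T d i\<bar>"
      using Q.trunc_mean_mono[OF \<tau>(2), of d i] Q.trunc_mean_diff_le[OF \<tau>(2), of d i] by simp
    then show ?thesis by (simp only: abs_le_square_iff power2_eq_square)
  qed
  have "(\<lambda>d. \<Sum>i\<in>I d. (trunc_mean (Q d i) \<tau> - center d i)\<^sup>2) \<longlonglongrightarrow> 0"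
  proof (rule sum_tendsto_0_of_null_multiple_of_tail[OF B])
    fix e :: real assume "0 < e"
    from null[OF \<tau>(1) this]
    show "\<forall>\<^sub>F d in sequentially. \<forall>i\<in>I d. norm ((trunc_mean (Q d i) \<tau> - center d i)\<^sup>2) \<le> e * ?T d i"
      by eventually_elim (auto intro!: order_trans[OF mean_le] mult_right_mono)
  qed
  moreover have center_le: "(center d i)\<^sup>2 \<le> center d i" for d i
    using mult_left_le[OF center_le_1 center_nonneg, of d i d i] by (simp add: power2_eq_square)
  have "(\<lambda>d. \<Sum>i\<in>I d. (center d i)\<^sup>2 * ?T d i) \<longlonglongrightarrow> 0"
  proof (rule sum_tendsto_0_of_null_multiple_of_tail[OF B])
    fix e :: real assume "0 < e"
    from center_null[OF this]
    show "\<forall>\<^sub>F d in sequentially. \<forall>i\<in>I d. norm ((center d i)\<^sup>2 * ?T d i) \<le> e * ?T d i"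
      by eventually_elim (auto intro!: mult_right_mono order_trans[OF center_le])
  qed
  moreover have "centered_second_moment d \<tau> - var_sum d \<tau>
      = (\<Sum>i\<in>I d. (trunc_mean (Q d i) \<tau> - center d i)\<^sup>2) - (\<Sum>i\<in>I d. (center d i)\<^sup>2 * ?T d i)" for d
    by (simp add: centered_second_moment_def var_sum_def Q.trunc_second_moment_about(2) sum.distrib sum_subtractf)
  ultimately show ?thesis
    using tendsto_diff by fastforce
qed

lemma char_row_law: "char (row_law d) t = (\<Prod>i\<in>I d. char (Q d i) t) * iexp (- (t * A d))"
proof -
  interpret P: product_prob_space "Q d" "I d"
    by unfold_locales
  have [measurable]: "(\<lambda>x. (\<Sum>i\<in>I d. x i) - A d) \<in> borel_measurable (PiM (I d) (Q d))"
    by measurable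
  have "iexp (t * ((\<Sum>i\<in>I d. x i) - A d)) = (\<Prod>i\<in>I d. iexp (t * x i)) * iexp (- (t * A d))" for x
    by (simp add: exp_sum[OF finite_I, symmetric] sum_distrib_left right_diff_distrib exp_diff exp_minus divide_inverse)
  then have "char (row_law d) t = (CLINT x|PiM (I d) (Q d). \<Prod>i\<in>I d. iexp (t * x i)) * iexp (- (t * A d))"
    unfolding char_def row_law_def by (subst integral_distr) (auto simp del: of_real_mult of_real_minus)
  also have "(CLINT x|PiM (I d) (Q d). \<Prod>i\<in>I d. iexp (t * x i)) = (\<Prod>i\<in>I d. char (Q d i) t)"
    unfolding char_def
    by (intro P.product_integral_prod finite_I Q.integrable_bounded[of _ 1]) auto
  finally show ?thesis .
qed

lemma real_distribution_row_law: "real_distribution (row_law d)"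
proof -
  interpret P: product_prob_space "Q d" "I d"
    by unfold_locales
  show ?thesis
    unfolding row_law_def by (rule P.P.real_distribution_distr) measurable
qed

lemma char_row_law_centered:
  "char (row_law d) t = (\<Prod>i\<in>I d. char (centered (Q d i)) t) * iexp (t * (mean_sum d 1 - A d))"
proof -
  have "(\<Prod>i\<in>I d. iexp (- (t * center d i))) = iexp (- (t * mean_sum d 1))"
    by (simp add: exp_sum[OF finite_I, symmetric] mean_sum_def sum_distrib_left sum_negf)
  moreover have "iexp (- (t * mean_sum d 1)) * iexp (t * (mean_sum d 1 - A d)) = iexp (- (t * A d))"
    by (simp add: exp_add[symmetric] algebra_simps)
  ultimately show ?thesis
    by (simp add: char_row_law Q.char_centered prod.distrib mult_ac)
qed

lemma exp_accompanying_exponent: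
  "exp (accompanying_exponent d t)
    = (\<Prod>i\<in>I d. exp (char (centered (Q d i)) t - 1)) * iexp (t * (mean_sum d 1 - A d))"
  by (simp add: accompanying_exponent_def exp_add exp_sum[OF finite_I])

lemma isCont_accompanying_exponent: "isCont (accompanying_exponent d) t"
  unfolding accompanying_exponent_def[abs_def]
  by (intro continuous_intros centered.isCont_char)

lemma norm_char_row_law_minus_exp_le:
  assumes K: "t\<^sup>2 / 2 + \<bar>t\<bar> + 2 \<le> K" and \<eta>: "\<forall>i\<in>I d. spread (Q d i) \<le> \<eta>" "K * \<eta> \<le> 1"
  shows "norm (char (row_law d) t - exp (accompanying_exponent d t)) \<le> 3 * K\<^sup>2 * \<eta> * spread_sum d"
proof -
  define z where "z i = char (centered (Q d i)) t - 1" for i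
  have K0: "0 \<le> K" using order_trans[OF _ K] by simp
  have z_le: "norm (1 + z i - exp (z i)) \<le> 3 * K\<^sup>2 * \<eta> * spread (Q d i)" if "i \<in> I d" for i
  proof -
    have s: "0 \<le> spread (Q d i)" "spread (Q d i) \<le> \<eta>" using \<eta>(1) that Q.spread_nonneg by auto
    have z: "norm (z i) \<le> K * spread (Q d i)"
      unfolding z_def by (rule order_trans[OF Q.norm_char_centered_minus_1_le mult_right_mono[OF K s(1)]])
    also have "\<dots> \<le> K * \<eta>" using s K0 by (intro mult_left_mono)
    finally have "norm (1 + z i - exp (z i)) \<le> 3 * (norm (z i))\<^sup>2"
      using \<eta>(2) by (intro norm_one_plus_minus_exp_le) simp
    also have "(norm (z i))\<^sup>2 \<le> (K * spread (Q d i)) * (K * \<eta>)"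
      unfolding power2_eq_square using z s K0 by (intro mult_mono order_trans[OF z] mult_left_mono) auto
    finally show ?thesis by (simp add: power2_eq_square mult_ac)
  qed
  have Re_z: "Re (z i) \<le> 0" for i
    using complex_Re_le_cmod[of "1 + z i"] centered.cmod_char_le_1[of d i t] by (simp add: z_def)
  have "norm (char (row_law d) t - exp (accompanying_exponent d t))
      = norm ((\<Prod>i\<in>I d. 1 + z i) - (\<Prod>i\<in>I d. exp (z i)))"
    unfolding char_row_law_centered exp_accompanying_exponent left_diff_distrib[symmetric] norm_mult
    by (simp add: z_def)
  also have "\<dots> \<le> (\<Sum>i\<in>I d. norm (1 + z i - exp (z i)))"
    by (rule norm_prod_diff) (auto simp: z_def centered.cmod_char_le_1 Re_z[unfolded z_def, simplified])
  also have "\<dots> \<le> 3 * K\<^sup>2 * \<eta> * spread_sum d"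
    unfolding spread_sum_def sum_distrib_left by (intro sum_mono z_le)
  finally show ?thesis .
qed

lemma char_row_law_minus_exp_uniform_limit:
  assumes B: "\<forall>\<^sub>F d in sequentially. spread_sum d \<le> B"
  shows "uniform_limit {-R..R} (\<lambda>d t. char (row_law d) t - exp (accompanying_exponent d t)) (\<lambda>_. 0) sequentially"
proof (rule uniform_limitI)
  fix e :: real assume "0 < e"
  define K where "K = R\<^sup>2 / 2 + \<bar>R\<bar> + 2"
  have K: "2 \<le> K" by (simp add: K_def)
  define \<eta> where "\<eta> = min (1/K) (e / (3 * K\<^sup>2 * (\<bar>B\<bar> + 1)))"
  have \<eta>: "0 < \<eta>" "K * \<eta> \<le> 1" "3 * K\<^sup>2 * \<eta> * (\<bar>B\<bar> + 1) \<le> e"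
  proof -
    have pos: "0 < 3 * K\<^sup>2 * (\<bar>B\<bar> + 1)" using K by (intro mult_pos_pos) auto
    then show "0 < \<eta>" using K \<open>0 < e\<close> by (simp add: \<eta>_def)
    have "\<eta> \<le> 1/K" "\<eta> \<le> e / (3 * K\<^sup>2 * (\<bar>B\<bar> + 1))" by (auto simp: \<eta>_def)
    then show "K * \<eta> \<le> 1" "3 * K\<^sup>2 * \<eta> * (\<bar>B\<bar> + 1) \<le> e"
      using K pos by (simp_all add: le_divide_eq mult_ac)
  qed
  show "\<forall>\<^sub>F d in sequentially. \<forall>t\<in>{-R..R}. dist (char (row_law d) t - exp (accompanying_exponent d t)) 0 < e"
    using B spread_null[OF \<eta>(1)]
  proof (rule eventually_elim2, intro ballI)
    fix d t assume spread: "spread_sum d \<le> B" "\<forall>i\<in>I d. spread (Q d i) \<le> \<eta>" and t: "t \<in> {-R..R}"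
    have "t\<^sup>2 \<le> R\<^sup>2" using t by (simp add: abs_le_square_iff[symmetric] abs_le_iff)
    then have "t\<^sup>2 / 2 + \<bar>t\<bar> + 2 \<le> K" using t by (auto simp: K_def)
    then have "norm (char (row_law d) t - exp (accompanying_exponent d t)) \<le> 3 * K\<^sup>2 * \<eta> * spread_sum d"
      using spread(2) \<eta>(2) by (rule norm_char_row_law_minus_exp_le)
    also have "\<dots> < 3 * K\<^sup>2 * \<eta> * (\<bar>B\<bar> + 1)"
      using spread(1) K \<eta>(1) by (intro mult_strict_left_mono) auto
    finally show "dist (char (row_law d) t - exp (accompanying_exponent d t)) 0 < e"
      using \<eta>(3) by simp
  qed
qed

lemma centered_sum_of_real:
  "centered_sum d (\<lambda>x. complex_of_real (f x)) = complex_of_real (centered_sum d f)"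
  by (simp add: centered_sum_def)

lemma accompanying_exponent_eq:
  "accompanying_exponent d t = \<i> * complex_of_real (t * drift d) + centered_sum d (levy_kernel t)"
proof -
  have kernel: "(CLINT x|centered (Q d i). levy_kernel t x)
      = char (centered (Q d i)) t - 1 - \<i> * complex_of_real (t * (LINT x|centered (Q d i). x / (1 + x\<^sup>2)))" for i
  proof -
    have "integrable (centered (Q d i)) (\<lambda>x. t * (x / (1 + x\<^sup>2)))"
      by (intro integrable_mult_right centered.integrable_bounded[of _ 1])
        (auto simp: abs_linear_ratio_le_1 simp del: abs_divide)
    moreover have "complex_integrable (centered (Q d i)) (\<lambda>x. iexp (t * x))"
      by (rule centered.integrable_bounded[of _ 1]) auto
    ultimately show ?thesis
      unfolding levy_kernel_def char_def
      by (simp del: of_real_mult of_real_divide times_divide_eq_right)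
  qed
  show ?thesis
    unfolding accompanying_exponent_def drift_def centered_sum_def kernel sum_subtractf
    by (simp add: sum_distrib_left algebra_simps)
qed

end

section \<open>Convergence of the row sums of a null array\<close>

locale null_array_limit = levy_characteristics \<gamma> \<sigma>2 L \<nu> + null_array I Q A
  for \<gamma> \<sigma>2 :: real and L :: "real \<Rightarrow> real" and \<nu> :: "real measure"
    and I :: "nat \<Rightarrow> 'i set" and Q :: "nat \<Rightarrow> 'i \<Rightarrow> real measure" and A :: "nat \<Rightarrow> real"
begin

definition tail_convergence :: bool where
  "tail_convergence \<longleftrightarrow> (\<forall>x>0. isCont L x \<longrightarrow> (\<lambda>d. tail_sum d x) \<longlonglongrightarrow> - L x)"

definition mean_convergence :: bool where
  "mean_convergence \<longleftrightarrow> (\<forall>\<tau>>0. isCont L \<tau> \<longrightarrow> (\<lambda>d. mean_sum d \<tau> - A d) \<longlonglongrightarrow> levy_shift \<tau>)"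

definition variance_convergence :: bool where
  "variance_convergence \<longleftrightarrow>
    (\<forall>e>0. \<forall>\<^sub>F \<tau> in at_right 0. \<forall>\<^sub>F d in sequentially. \<bar>var_sum d \<tau> - \<sigma>2\<bar> \<le> e)"

text \<open>Vague convergence on the punctured line of the sums of the centered laws, together with the mass \<open>\<sigma>2\<close>
  that \<open>x\<^sup>2\<close> times these sums leaves at the origin.\<close>

definition jump_convergence :: bool where
  "jump_convergence \<longleftrightarrow>
    (\<forall>F l. jump_test F l \<longrightarrow> (\<lambda>d. centered_sum d F) \<longlonglongrightarrow> l * complex_of_real \<sigma>2 + (CLINT x|\<nu>. F x))"

definition small_jump_sum :: "nat \<Rightarrow> real \<Rightarrow> (real \<Rightarrow> complex) \<Rightarrow> complex" where
  "small_jump_sum d \<delta> F = (\<Sum>i\<in>I d. \<integral>x. indicator {..\<delta>} x *\<^sub>R F (x - center d i) \<partial>Q d i)"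

definition large_jump_sum :: "nat \<Rightarrow> real \<Rightarrow> (real \<Rightarrow> complex) \<Rightarrow> complex" where
  "large_jump_sum d \<delta> F = (\<Sum>i\<in>I d. \<integral>x. indicator {\<delta><..} x *\<^sub>R F (x - center d i) \<partial>Q d i)"

lemma tail_sum_bounded:
  assumes tail_convergence "0 < \<delta>"
  obtains B where "\<forall>\<^sub>F d in sequentially. tail_sum d \<delta> \<le> B"
proof -
  obtain x where x: "0 < x" "x < \<delta>" "isCont L x" using ex_isCont_L[of 0 \<delta>] assms(2) by auto
  then have "(\<lambda>d. tail_sum d x) \<longlonglongrightarrow> - L x" using assms(1) by (simp add: tail_convergence_def)
  then have "\<forall>\<^sub>F d in sequentially. tail_sum d x < - L x + 1" by (rule order_tendstoD(2)) simp
  then have "\<forall>\<^sub>F d in sequentially. tail_sum d \<delta> \<le> - L x + 1"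
    by eventually_elim (use tail_sum_antimono[of x \<delta>] x in \<open>auto intro: order_trans less_imp_le\<close>)
  then show ?thesis by (rule that)
qed

lemma spread_sum_bounded:
  assumes tail_convergence variance_convergence
  obtains B where "\<forall>\<^sub>F d in sequentially. spread_sum d \<le> B"
proof -
  have "\<forall>\<^sub>F \<tau> in at_right 0. \<forall>\<^sub>F d in sequentially. \<bar>var_sum d \<tau> - \<sigma>2\<bar> \<le> 1"
    using assms(2) by (simp add: variance_convergence_def)
  moreover have "\<forall>\<^sub>F \<tau> in at_right 0. \<tau> \<in> {0<..<1::real}"
    by (rule eventually_at_right_real) simp
  ultimately have "\<forall>\<^sub>F \<tau> in at_right 0. (\<forall>\<^sub>F d in sequentially. \<bar>var_sum d \<tau> - \<sigma>2\<bar> \<le> 1) \<and> \<tau> \<in> {0<..<1}"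
    by (rule eventually_conj)
  then obtain \<tau> where \<tau>: "\<forall>\<^sub>F d in sequentially. \<bar>var_sum d \<tau> - \<sigma>2\<bar> \<le> 1" "0 < \<tau>" "\<tau> \<le> 1"
    by (rule ex_isCont_L_at_right) auto
  obtain B where "\<forall>\<^sub>F d in sequentially. tail_sum d \<tau> \<le> B" using tail_sum_bounded[OF assms(1) \<tau>(2)] .
  with \<tau>(1) have "\<forall>\<^sub>F d in sequentially. spread_sum d \<le> (\<sigma>2 + 1) + 2 * B"
  proof eventually_elim
    case (elim d)
    have "spread_sum d \<le> var_sum d \<tau> + 2 * tail_sum d \<tau>"
      unfolding spread_sum_def var_sum_def tail_sum_def sum_distrib_left sum.distrib[symmetric]
      by (intro sum_mono Q.spread_le_trunc_var \<tau>(3))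
    also have "\<dots> \<le> (\<sigma>2 + 1) + 2 * B" using elim by (intro add_mono) auto
    finally show ?case .
  qed
  then show ?thesis by (rule that)
qed

subsection \<open>From tails and variances to all test functions\<close>

lemma tail_integral_tendsto:
  fixes f :: "real \<Rightarrow> complex"
  assumes tail: tail_convergence and \<delta>: "0 < \<delta>" "isCont L \<delta>"
    and f: "\<And>x. isCont f x" "\<And>x. norm (f x) \<le> B"
  shows "(\<lambda>d. \<Sum>i\<in>I d. \<integral>x. indicator {\<delta><..} x *\<^sub>R f x \<partial>Q d i) \<longlonglongrightarrow> (\<integral>x. indicator {\<delta><..} x *\<^sub>R f x \<partial>\<nu>)"
proof -
  define H where "H d = sum_measure borel (I d) (\<lambda>i. tail_part (Q d i) \<delta>)" for d
  have sets_part: "sets (tail_part (Q d i) \<delta>) = sets borel" for d i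
    by (simp add: sets_tail_part)
  have finite_H: "finite_borel_measure (H d)" for d
    unfolding H_def
    by (intro finite_borel_measure_sum_measure finite_I finite_borel_measure_tail_part)
      (auto simp: Q.emeasure_eq_measure)
  interpret H: finite_borel_measure "H d" for d by (rule finite_H)
  have [measurable]: "f \<in> borel_measurable borel"
    using f(1) by (intro borel_measurable_continuous_onI continuous_at_imp_continuous_on) auto
  have measure_H: "measure (H d) S = (\<Sum>i\<in>I d. measure (Q d i) ({\<delta><..} \<inter> S))" if "S \<in> sets borel" for d S
    using that finite_I H.emeasure_finite[of d S]
    unfolding H_def by (subst measure_sum_measure) (auto simp: sets_part measure_tail_part)
  have cdf_H: "cdf (H d) x = tail_sum d \<delta> - tail_sum d (max \<delta> x)" for d x
  proof -
    have "measure (Q d i) ({\<delta><..} \<inter> {..x}) = measure (Q d i) {\<delta><..} - measure (Q d i) {max \<delta> x<..}" for i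
      by (subst Q.finite_measure_Diff[symmetric]) (auto intro!: arg_cong[of _ _ "measure (Q d i)"])
    then show ?thesis by (simp add: cdf_def measure_H tail_sum_def sum_subtractf)
  qed
  have "(\<lambda>d. \<integral>x. f x \<partial>H d) \<longlonglongrightarrow> (\<integral>x. f x \<partial>tail_part \<nu> \<delta>)"
  proof (rule integral_tendsto_of_cdf_tendsto[OF finite_H finite_borel_measure_tail_nu[OF \<delta>(1)] _ _ f])
    show "(\<lambda>d. measure (H d) UNIV) \<longlonglongrightarrow> measure (tail_part \<nu> \<delta>) UNIV"
      using tail \<delta> by (simp add: measure_H measure_tail_nu_UNIV tail_convergence_def tail_sum_def)
    fix x assume cont: "isCont (cdf (tail_part \<nu> \<delta>)) x"
    have "(\<lambda>d. tail_sum d \<delta> - tail_sum d (max \<delta> x)) \<longlonglongrightarrow> - L \<delta> - - L (max \<delta> x)"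
      using tail \<delta> isCont_cdf_tail_nuD[OF \<delta>(1) cont]
      by (intro tendsto_diff; cases "\<delta> < x") (auto simp: tail_convergence_def max_def)
    then show "(\<lambda>d. cdf (H d) x) \<longlonglongrightarrow> cdf (tail_part \<nu> \<delta>) x"
      by (simp add: cdf_H cdf_tail_nu[OF \<delta>(1)])
  qed
  moreover have "(\<integral>x. f x \<partial>H d) = (\<Sum>i\<in>I d. \<integral>x. indicator {\<delta><..} x *\<^sub>R f x \<partial>Q d i)" for d
    using H.integrable_bounded[of f B d] f(2) unfolding H_def
    by (simp add: integral_sum_measure[OF sets_part finite_I] integral_tail_part)
  ultimately show ?thesis by (simp add: integral_tail_part)
qed

lemma large_jump_sum_tendsto:
  assumes tail: tail_convergence and \<delta>: "0 < \<delta>" "isCont L \<delta>" and F: "jump_test F l"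
  shows "(\<lambda>d. large_jump_sum d \<delta> F) \<longlonglongrightarrow> (\<integral>x. indicator {\<delta><..} x *\<^sub>R F x \<partial>\<nu>)"
proof -
  note [measurable] = jump_test_measurable[OF F]
  obtain C where C: "\<And>x. norm (F x) \<le> C" using jump_testE[OF F] by metis
  have int: "complex_integrable (Q d i) (\<lambda>x. indicator {\<delta><..} x *\<^sub>R F (x - c))" for d i c
    using C order_trans[OF norm_ge_zero C] by (intro Q.integrable_bounded[of _ C]) (auto split: split_indicator)
  obtain B where B: "\<forall>\<^sub>F d in sequentially. tail_sum d \<delta> \<le> B" using tail_sum_bounded[OF tail \<delta>(1)] .
  have "(\<lambda>d. \<Sum>i\<in>I d. \<integral>x. indicator {\<delta><..} x *\<^sub>R (F (x - center d i) - F x) \<partial>Q d i) \<longlonglongrightarrow> 0"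
  proof (rule sum_tendsto_0_of_null_multiple_of_tail[OF B])
    fix e :: real assume "0 < e"
    then obtain s where s: "0 < s" "\<And>x y. dist x y < s \<Longrightarrow> dist (F x) (F y) < e"
      using F unfolding jump_test_def uniformly_continuous_on_def by blast
    have "0 < s/2" using s(1) by simp
    from center_null[OF this] show "\<forall>\<^sub>F d in sequentially. \<forall>i\<in>I d.
        norm (\<integral>x. indicator {\<delta><..} x *\<^sub>R (F (x - center d i) - F x) \<partial>Q d i) \<le> e * measure (Q d i) {\<delta><..}"
    proof (eventually_elim, intro ballI)
      fix d i assume "\<forall>i\<in>I d. center d i \<le> s/2" and "i \<in> I d"
      then have "norm (F (x - center d i) - F x) \<le> e" for x
        using s(2)[of "x - center d i" x] center_nonneg[of d i] s(1) by (force simp: dist_norm)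
      then have "norm (\<integral>x. indicator {\<delta><..} x *\<^sub>R (F (x - center d i) - F x) \<partial>Q d i)
          \<le> (\<integral>x. e * indicator {\<delta><..} x \<partial>Q d i)"
        using int[of d i 0] int[of d i "center d i"] Q.integrable_indicators(2)[of d i \<delta>]
        by (intro Q.norm_expectation_le_nonneg) (auto simp: scaleR_diff_right split: split_indicator)
      then show "norm (\<integral>x. indicator {\<delta><..} x *\<^sub>R (F (x - center d i) - F x) \<partial>Q d i)
          \<le> e * measure (Q d i) {\<delta><..}" by simp
    qed
  qed
  from tendsto_add[OF this tail_integral_tendsto[OF tail \<delta> jump_test_isCont[OF F] C]]
  show ?thesis
    using int[of _ _ 0] int by (simp add: large_jump_sum_def scaleR_diff_right sum.distrib[symmetric])
qed

lemma norm_small_jump_sum_minus_le: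
  assumes F: "jump_test F l" and near_0: "\<forall>x. \<bar>x\<bar> \<le> \<delta> \<longrightarrow> norm (F x - l * complex_of_real (x\<^sup>2)) \<le> e * x\<^sup>2"
    and c: "\<forall>i\<in>I d. center d i \<le> \<delta>"
  shows "norm (small_jump_sum d \<delta> F - l * complex_of_real (centered_second_moment d \<delta>))
    \<le> e * centered_second_moment d \<delta>"
proof -
  note [measurable] = jump_test_measurable[OF F]
  obtain C where C: "\<And>x. norm (F x) \<le> C" using jump_testE[OF F] by metis
  define g where "g i x = indicator {..\<delta>} x * (x - center d i)\<^sup>2" for i x
  have int_g: "integrable (Q d i) (g i)" for i
    unfolding g_def by (rule Q.trunc_second_moment_about)
  have int_F: "complex_integrable (Q d i) (\<lambda>x. indicator {..\<delta>} x *\<^sub>R F (x - center d i))" for i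
    using C order_trans[OF norm_ge_zero C] by (intro Q.integrable_bounded[of _ C]) (auto split: split_indicator)
  have "norm ((\<integral>x. indicator {..\<delta>} x *\<^sub>R F (x - center d i) \<partial>Q d i) - l * complex_of_real (\<integral>x. g i x \<partial>Q d i))
      \<le> e * (\<integral>x. g i x \<partial>Q d i)" if i: "i \<in> I d" for i
  proof -
    have "norm (\<integral>x. indicator {..\<delta>} x *\<^sub>R F (x - center d i) - l * complex_of_real (g i x) \<partial>Q d i)
        \<le> (\<integral>x. e * g i x \<partial>Q d i)"
    proof (rule Q.norm_expectation_le_nonneg)
      show "norm (indicator {..\<delta>} x *\<^sub>R F (x - center d i) - l * complex_of_real (g i x)) \<le> e * g i x"
        if "0 \<le> x" for x
        using near_0[rule_format, of "x - center d i"] that c i center_nonneg[of d i]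
        by (auto simp: g_def abs_le_iff split: split_indicator)
    qed (intro Bochner_Integration.integrable_diff int_F integrable_mult_right integrable_of_real int_g)+
    then show ?thesis
      using int_F int_g by simp
  qed
  then have "norm (\<Sum>i\<in>I d. (\<integral>x. indicator {..\<delta>} x *\<^sub>R F (x - center d i) \<partial>Q d i)
      - l * complex_of_real (\<integral>x. g i x \<partial>Q d i)) \<le> (\<Sum>i\<in>I d. e * (\<integral>x. g i x \<partial>Q d i))"
    by (rule sum_norm_le)
  then show ?thesis
    unfolding small_jump_sum_def centered_second_moment_def g_def[symmetric]
    by (simp add: sum_subtractf sum_distrib_left)
qed

lemma centered_sum_split:
  assumes F: "jump_test F l"
  shows "centered_sum d F = small_jump_sum d \<delta> F + large_jump_sum d \<delta> F"
proof -
  note [measurable] = jump_test_measurable[OF F]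
  obtain C where C: "0 \<le> C" "\<And>x. norm (F x) \<le> C" using jump_testE[OF F] by metis
  have int: "complex_integrable (Q d i) (\<lambda>x. indicator S x *\<^sub>R F (x - center d i))" if "S \<in> sets borel" for S i
    using that C by (intro Q.integrable_bounded[of _ C]) (auto split: split_indicator)
  have "(\<integral>x. F (x - center d i) \<partial>Q d i)
      = (\<integral>x. indicator {..\<delta>} x *\<^sub>R F (x - center d i) + indicator {\<delta><..} x *\<^sub>R F (x - center d i) \<partial>Q d i)" for i
    by (intro Bochner_Integration.integral_cong) (auto split: split_indicator)
  also have "\<dots> i = (\<integral>x. indicator {..\<delta>} x *\<^sub>R F (x - center d i) \<partial>Q d i)
      + (\<integral>x. indicator {\<delta><..} x *\<^sub>R F (x - center d i) \<partial>Q d i)" for i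
    by (intro Bochner_Integration.integral_add int) auto
  finally show ?thesis
    by (simp add: centered_sum_def Q.integral_centered small_jump_sum_def large_jump_sum_def sum.distrib)
qed

lemma ex_truncation_level:
  assumes var: variance_convergence and F: "jump_test F l" and "0 < e"
  obtains \<delta> where "0 < \<delta>" "isCont L \<delta>" "\<delta> \<le> 1"
    "\<forall>\<^sub>F d in sequentially. \<bar>var_sum d \<delta> - \<sigma>2\<bar> \<le> e"
    "\<forall>x. \<bar>x\<bar> \<le> \<delta> \<longrightarrow> norm (F x - l * complex_of_real (x\<^sup>2)) \<le> e * x\<^sup>2"
    "norm (\<integral>x. indicator {0<..\<delta>} x *\<^sub>R F x \<partial>\<nu>) \<le> e"
proof -
  have "\<forall>\<^sub>F \<delta> in at_right 0. \<forall>\<^sub>F d in sequentially. \<bar>var_sum d \<delta> - \<sigma>2\<bar> \<le> e"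
    using var \<open>0 < e\<close> by (simp add: variance_convergence_def)
  moreover have "\<forall>\<^sub>F \<delta> in at_right 0. \<delta> \<in> {0<..<1::real}"
    by (rule eventually_at_right_real) simp
  ultimately have "\<forall>\<^sub>F \<delta> in at_right 0.
      (\<forall>\<^sub>F d in sequentially. \<bar>var_sum d \<delta> - \<sigma>2\<bar> \<le> e) \<and> \<delta> \<in> {0<..<1}
      \<and> (\<forall>x. \<bar>x\<bar> \<le> \<delta> \<longrightarrow> norm (F x - l * complex_of_real (x\<^sup>2)) \<le> e * x\<^sup>2)
      \<and> norm (\<integral>x. indicator {0<..\<delta>} x *\<^sub>R F x \<partial>\<nu>) \<le> e"
    using jump_test_eventually_near_0[OF F \<open>0 < e\<close>] eventually_small_jump_integral_le[OF F \<open>0 < e\<close>]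
    by (intro eventually_conj)
  then obtain \<delta> where "0 < \<delta>" "isCont L \<delta>" and
    "(\<forall>\<^sub>F d in sequentially. \<bar>var_sum d \<delta> - \<sigma>2\<bar> \<le> e) \<and> \<delta> \<in> {0<..<1}
      \<and> (\<forall>x. \<bar>x\<bar> \<le> \<delta> \<longrightarrow> norm (F x - l * complex_of_real (x\<^sup>2)) \<le> e * x\<^sup>2)
      \<and> norm (\<integral>x. indicator {0<..\<delta>} x *\<^sub>R F x \<partial>\<nu>) \<le> e"
    by (rule ex_isCont_L_at_right)
  then show ?thesis by (intro that[of \<delta>]) auto
qed

lemma norm_centered_sum_minus_limit_le:
  assumes F: "jump_test F l" and near_0: "\<forall>x. \<bar>x\<bar> \<le> \<delta> \<longrightarrow> norm (F x - l * complex_of_real (x\<^sup>2)) \<le> \<eta> * x\<^sup>2"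
    and \<eta>: "0 \<le> \<eta>" "\<eta> \<le> 1" and c: "\<forall>i\<in>I d. center d i \<le> \<delta>"
    and moment: "\<bar>centered_second_moment d \<delta> - \<sigma>2\<bar> \<le> 2 * \<eta>"
    and small_nu: "norm (\<integral>x. indicator {0<..\<delta>} x *\<^sub>R F x \<partial>\<nu>) \<le> \<eta>"
    and large: "norm (large_jump_sum d \<delta> F - (\<integral>x. indicator {\<delta><..} x *\<^sub>R F x \<partial>\<nu>)) \<le> \<eta>"
  shows "norm (centered_sum d F - (l * complex_of_real \<sigma>2 + (CLINT x|\<nu>. F x))) \<le> \<eta> * (\<sigma>2 + 2 * norm l + 4)"
proof -
  define W where "W = centered_second_moment d \<delta>"
  have "norm (small_jump_sum d \<delta> F - l * complex_of_real W) \<le> \<eta> * W"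
    unfolding W_def by (intro norm_small_jump_sum_minus_le[OF F near_0 c])
  also have "\<dots> \<le> \<eta> * (\<sigma>2 + 2)" using moment \<eta> by (intro mult_left_mono) (auto simp: W_def)
  finally have small: "norm (small_jump_sum d \<delta> F - l * complex_of_real W) \<le> \<eta> * (\<sigma>2 + 2)" .
  have gauss: "norm (l * complex_of_real (W - \<sigma>2)) \<le> norm l * (2 * \<eta>)"
    unfolding norm_mult norm_of_real using moment by (intro mult_left_mono) (auto simp: W_def)
  have "centered_sum d F - (l * complex_of_real \<sigma>2 + (CLINT x|\<nu>. F x))
      = (small_jump_sum d \<delta> F - l * complex_of_real W) + l * complex_of_real (W - \<sigma>2)
        + (large_jump_sum d \<delta> F - (\<integral>x. indicator {\<delta><..} x *\<^sub>R F x \<partial>\<nu>)) - (\<integral>x. indicator {0<..\<delta>} x *\<^sub>R F x \<partial>\<nu>)"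
    using centered_sum_split[OF F, of d \<delta>] integral_jump_test_split[OF F, of \<delta>] by (simp add: algebra_simps)
  also have "norm \<dots> \<le> \<eta> * (\<sigma>2 + 2) + norm l * (2 * \<eta>) + \<eta> + \<eta>"
    by (intro norm_triangle_le_diff norm_triangle_le add_mono small gauss small_nu large)
  also have "\<dots> = \<eta> * (\<sigma>2 + 2 * norm l + 4)"
    by (simp add: algebra_simps)
  finally show ?thesis .
qed

lemma jump_convergence_of_tail_variance:
  assumes tail: tail_convergence and var: variance_convergence
  shows jump_convergence
  unfolding jump_convergence_def
proof (intro allI impI tendstoI)
  fix F l and e :: real assume F: "jump_test F l" and "0 < e"
  define \<eta> where "\<eta> = min 1 (e / (\<sigma>2 + 2 * norm l + 5))"
  have pos: "0 < \<sigma>2 + 2 * norm l + 5" using sigma2_nonneg by (intro add_nonneg_pos add_nonneg_nonneg) auto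
  have "\<eta> \<le> e / (\<sigma>2 + 2 * norm l + 5)" by (simp add: \<eta>_def)
  then have \<eta>: "0 < \<eta>" "\<eta> \<le> 1" "\<eta> * (\<sigma>2 + 2 * norm l + 5) \<le> e"
    using pos \<open>0 < e\<close> by (auto simp: \<eta>_def le_divide_eq)
  obtain \<delta> where \<delta>: "0 < \<delta>" "isCont L \<delta>" "\<delta> \<le> 1"
    and var_\<delta>: "\<forall>\<^sub>F d in sequentially. \<bar>var_sum d \<delta> - \<sigma>2\<bar> \<le> \<eta>"
    and near_0: "\<forall>x. \<bar>x\<bar> \<le> \<delta> \<longrightarrow> norm (F x - l * complex_of_real (x\<^sup>2)) \<le> \<eta> * x\<^sup>2"
    and small_nu: "norm (\<integral>x. indicator {0<..\<delta>} x *\<^sub>R F x \<partial>\<nu>) \<le> \<eta>"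
    using ex_truncation_level[OF var F \<eta>(1)] .
  obtain B where B: "\<forall>\<^sub>F d in sequentially. tail_sum d \<delta> \<le> B" using tail_sum_bounded[OF tail \<delta>(1)] .
  have "\<forall>\<^sub>F d in sequentially. norm (large_jump_sum d \<delta> F - (\<integral>x. indicator {\<delta><..} x *\<^sub>R F x \<partial>\<nu>)) < \<eta>"
    using tendstoD[OF large_jump_sum_tendsto[OF tail \<delta>(1,2) F] \<eta>(1)] by (simp add: dist_norm)
  moreover have "\<forall>\<^sub>F d in sequentially. \<bar>centered_second_moment d \<delta> - var_sum d \<delta>\<bar> < \<eta>"
    using tendstoD[OF centered_second_moment_minus_var_sum_tendsto_0[OF \<delta>(1,3) B] \<eta>(1)] by (simp add: dist_real_def)
  ultimately show "\<forall>\<^sub>F d in sequentially. dist (centered_sum d F) (l * complex_of_real \<sigma>2 + (CLINT x|\<nu>. F x)) < e"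
    using var_\<delta> center_null[OF \<delta>(1)]
  proof eventually_elim
    case (elim d)
    then have "\<bar>centered_second_moment d \<delta> - \<sigma>2\<bar> \<le> 2 * \<eta>" by linarith
    then have "norm (centered_sum d F - (l * complex_of_real \<sigma>2 + (CLINT x|\<nu>. F x))) \<le> \<eta> * (\<sigma>2 + 2 * norm l + 4)"
      using elim \<eta> by (intro norm_centered_sum_minus_limit_le[OF F near_0 _ _ _ _ small_nu]) auto
    also have "\<dots> < \<eta> * (\<sigma>2 + 2 * norm l + 5)" using \<eta>(1) by simp
    finally show ?case using \<eta>(3) by (simp add: dist_norm)
  qed
qed

subsection \<open>From all test functions to tails, variances and means\<close>

lemma jump_convergence_real:
  assumes jump_convergence "jump_test (\<lambda>x. complex_of_real (f x)) (complex_of_real l)"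
  shows "(\<lambda>d. centered_sum d f) \<longlonglongrightarrow> l * \<sigma>2 + (LINT x|\<nu>. f x)"
proof -
  have "(\<lambda>d. complex_of_real (centered_sum d f)) \<longlonglongrightarrow> complex_of_real (l * \<sigma>2 + (LINT x|\<nu>. f x))"
    using assms(1)[unfolded jump_convergence_def, rule_format, OF assms(2)] by (simp add: centered_sum_of_real)
  then show ?thesis by (simp only: tendsto_of_real_iff)
qed

lemma centered_sum_ramp_le_tail_sum:
  assumes "u < v"
  shows "centered_sum d (ramp u v) \<le> tail_sum d u"
proof -
  have "(LINT x|centered (Q d i). ramp u v x) \<le> measure (Q d i) {u<..}" for i
  proof -
    have "Q.expectation d i (\<lambda>x. ramp u v (x - center d i)) \<le> Q.expectation d i (indicator {u<..})"
      using assms ramp_eq_0[of u v] center_nonneg[of d i]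
      by (intro Q.expectation_mono_nonneg Q.integrable_indicators Q.integrable_bounded[of _ 1])
        (auto simp: ramp_nonneg ramp_le_1 split: split_indicator)
    then show ?thesis by (simp add: Q.integral_centered)
  qed
  then show ?thesis unfolding centered_sum_def tail_sum_def by (intro sum_mono)
qed

lemma tail_sum_le_centered_sum_ramp:
  assumes "u < v" and c: "\<forall>i\<in>I d. center d i \<le> c"
  shows "tail_sum d (v + c) \<le> centered_sum d (ramp u v)"
proof -
  have "measure (Q d i) {v + c<..} \<le> (LINT x|centered (Q d i). ramp u v x)" if "i \<in> I d" for i
  proof -
    have "Q.expectation d i (indicator {v + c<..}) \<le> Q.expectation d i (\<lambda>x. ramp u v (x - center d i))"
      using assms(1) c that ramp_eq_1[of u v]
      by (intro Q.expectation_mono_nonneg Q.integrable_indicators Q.integrable_bounded[of _ 1])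
        (force simp: ramp_nonneg ramp_le_1 split: split_indicator)+
    then show ?thesis by (simp add: Q.integral_centered)
  qed
  then show ?thesis unfolding centered_sum_def tail_sum_def by (intro sum_mono)
qed

lemma tail_convergence_of_jump:
  assumes jump: jump_convergence
  shows tail_convergence
  unfolding tail_convergence_def
proof (intro allI impI order_tendstoI)
  have ramp: "(\<lambda>d. centered_sum d (ramp u v)) \<longlonglongrightarrow> (LINT x|\<nu>. ramp u v x)" if "0 < u" "u < v" for u v
    using jump_convergence_real[OF jump, of "ramp u v" 0] jump_test_ramp[OF that] by simp
  fix y a :: real assume y: "0 < y" "isCont L y"
  {
    assume "a < - L y"
    then have "L y < - a" by simp
    with y(2) have "\<forall>\<^sub>F x in at y. L x < - a" unfolding isCont_def by (rule order_tendstoD(2))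
    then obtain s where s: "0 < s" "\<And>x. x \<noteq> y \<Longrightarrow> \<bar>x - y\<bar> < s \<Longrightarrow> L x < - a"
      by (auto simp: eventually_at dist_real_def)
    define v where "v = y + s/2"
    have v: "y < v" "a < - L v" using s(1) s(2)[of v] by (auto simp: v_def)
    have "a < (LINT x|\<nu>. ramp y v x)" using v integral_ramp_bounds(2)[of y v] y(1) by linarith
    then have "\<forall>\<^sub>F d in sequentially. a < centered_sum d (ramp y v)"
      by (rule order_tendstoD(1)[OF ramp[OF y(1) v(1)]])
    then show "\<forall>\<^sub>F d in sequentially. a < tail_sum d y"
      by eventually_elim (rule less_le_trans[OF _ centered_sum_ramp_le_tail_sum[OF v(1)]])
  next
    assume "- L y < a"
    then have "- a < L y" by simp
    with y(2) have "\<forall>\<^sub>F x in at y. - a < L x" unfolding isCont_def by (rule order_tendstoD(1))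
    then obtain s where s: "0 < s" "\<And>x. x \<noteq> y \<Longrightarrow> \<bar>x - y\<bar> < s \<Longrightarrow> - a < L x"
      by (auto simp: eventually_at dist_real_def)
    define u where "u = max (y/2) (y - s/2)"
    have u: "0 < u" "u < y" "\<bar>u - y\<bar> < s" using s(1) y(1) by (auto simp: u_def)
    then have "- L u < a" using s(2)[of u] by simp
    define v where "v = (u + y) / 2"
    have v: "u < v" "0 < y - v" using u by (auto simp: v_def)
    have "(LINT x|\<nu>. ramp u v x) < a" using \<open>- L u < a\<close> integral_ramp_bounds(1)[OF u(1) v(1)] by linarith
    then have "\<forall>\<^sub>F d in sequentially. centered_sum d (ramp u v) < a"
      by (rule order_tendstoD(2)[OF ramp[OF u(1) v(1)]])
    then show "\<forall>\<^sub>F d in sequentially. tail_sum d y < a"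
      using center_null[OF v(2)]
      by eventually_elim (use tail_sum_le_centered_sum_ramp[OF v(1), of _ "y - v"] in \<open>auto intro: le_less_trans\<close>)
  }
qed

lemma centered_second_moment_bounds:
  assumes \<tau>: "0 < \<tau>" and c: "\<forall>i\<in>I d. center d i \<le> \<tau>/2"
  shows "centered_sum d (truncated_square (\<tau>/4)) \<le> centered_second_moment d \<tau>"
    "centered_second_moment d \<tau> \<le> centered_sum d (truncated_square \<tau>)"
proof -
  let ?f = "\<lambda>i x. indicator {..\<tau>} x * (x - center d i)\<^sup>2"
  have int: "integrable (Q d i) (\<lambda>x. truncated_square \<delta> (x - center d i))" if \<delta>: "0 < \<delta>" for \<delta> i
  proof -
    obtain C where "\<And>x. norm (complex_of_real (truncated_square \<delta> x)) \<le> C"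
      by (rule jump_testE[OF jump_test_truncated_square[OF \<delta>]]) (rule that)
    then show ?thesis
      by (intro Q.integrable_bounded[of _ C]) auto
  qed
  have "Q.expectation d i (\<lambda>x. truncated_square (\<tau>/4) (x - center d i)) \<le> Q.expectation d i (?f i)"
    and "Q.expectation d i (?f i) \<le> Q.expectation d i (\<lambda>x. truncated_square \<tau> (x - center d i))"
    if i: "i \<in> I d" for i
  proof -
    show "Q.expectation d i (\<lambda>x. truncated_square (\<tau>/4) (x - center d i)) \<le> Q.expectation d i (?f i)"
    proof (intro Q.expectation_mono_nonneg int Q.trunc_second_moment_about)
      fix x assume "0 \<le> (x::real)"
      then show "truncated_square (\<tau>/4) (x - center d i) \<le> ?f i x"
        using \<tau> c i truncated_square_le[of "\<tau>/4" "x - center d i"] truncated_square_eq_0[of "\<tau>/4" "x - center d i"]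
        by (force split: split_indicator)
    qed (use \<tau> in simp)
    show "Q.expectation d i (?f i) \<le> Q.expectation d i (\<lambda>x. truncated_square \<tau> (x - center d i))"
    proof (intro Q.expectation_mono_nonneg int Q.trunc_second_moment_about)
      fix x assume "0 \<le> (x::real)"
      then show "?f i x \<le> truncated_square \<tau> (x - center d i)"
        using \<tau> c i center_nonneg[of d i] truncated_square_eq[of "x - center d i" \<tau>]
        by (force simp: truncated_square_nonneg abs_le_iff split: split_indicator)
    qed fact
  qed
  then show "centered_sum d (truncated_square (\<tau>/4)) \<le> centered_second_moment d \<tau>"
    "centered_second_moment d \<tau> \<le> centered_sum d (truncated_square \<tau>)"
    unfolding centered_sum_def centered_second_moment_def
    by (auto intro!: sum_mono simp: Q.integral_centered truncated_square_def)
qed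

lemma variance_convergence_of_jump:
  assumes jump: jump_convergence
  shows variance_convergence
  unfolding variance_convergence_def
proof (intro allI impI)
  fix e :: real assume e: "0 < e"
  have lim: "(\<lambda>d. centered_sum d (truncated_square \<tau>)) \<longlonglongrightarrow> \<sigma>2 + (LINT x|\<nu>. truncated_square \<tau> x)" if "0 < \<tau>" for \<tau>
    using jump_convergence_real[OF jump, of "truncated_square \<tau>" 1] jump_test_truncated_square[OF that] by simp
  have nonneg: "0 \<le> (LINT x|\<nu>. truncated_square \<tau> x)" for \<tau>
    by (simp add: truncated_square_nonneg)
  have "\<forall>\<^sub>F \<delta> in at_right 0. (LINT x|\<nu>. indicator {0<..\<delta>} x * min 1 (x\<^sup>2)) < e/3"
    by (rule order_tendstoD(2)[OF small_jumps_tendsto_0]) (use e in simp)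
  then obtain b where b: "0 < b" "\<And>\<delta>. 0 < \<delta> \<Longrightarrow> \<delta> < b \<Longrightarrow> (LINT x|\<nu>. indicator {0<..\<delta>} x * min 1 (x\<^sup>2)) < e/3"
    unfolding eventually_at_right_field by blast
  have "\<forall>\<^sub>F d in sequentially. \<bar>var_sum d \<tau> - \<sigma>2\<bar> \<le> e" if \<tau>: "0 < \<tau>" "\<tau> < min 1 (b/2)" for \<tau>
  proof -
    have small: "(LINT x|\<nu>. truncated_square \<tau> x) < e/3"
      using b(2)[of "2 * \<tau>"] \<tau> integral_truncated_square_le[of \<tau>] by simp
    obtain B where B: "\<forall>\<^sub>F d in sequentially. tail_sum d \<tau> \<le> B"
      using tail_sum_bounded[OF tail_convergence_of_jump[OF jump] \<tau>(1)] .
    have "\<forall>\<^sub>F d in sequentially. \<bar>centered_second_moment d \<tau> - var_sum d \<tau>\<bar> < e/3"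
      using tendstoD[OF centered_second_moment_minus_var_sum_tendsto_0[OF \<tau>(1) _ B], of "e/3"] \<tau>(2) e
      by (simp add: dist_real_def)
    moreover have "\<forall>\<^sub>F d in sequentially. centered_sum d (truncated_square \<tau>) < \<sigma>2 + 2 * e/3"
      using order_tendstoD(2)[OF lim[OF \<tau>(1)], of "\<sigma>2 + 2 * e/3"] small e by simp
    moreover have "\<forall>\<^sub>F d in sequentially. \<sigma>2 - e/3 < centered_sum d (truncated_square (\<tau>/4))"
      using order_tendstoD(1)[OF lim[of "\<tau>/4"], of "\<sigma>2 - e/3"] \<tau>(1) nonneg[of "\<tau>/4"] e by simp
    moreover have "\<forall>\<^sub>F d in sequentially. \<forall>i\<in>I d. center d i \<le> \<tau>/2"
      using \<tau>(1) by (intro center_null) simp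
    ultimately show ?thesis
    proof eventually_elim
      case (elim d)
      then show ?case using centered_second_moment_bounds[OF \<tau>(1) elim(4)] by linarith
    qed
  qed
  then show "\<forall>\<^sub>F \<tau> in at_right 0. \<forall>\<^sub>F d in sequentially. \<bar>var_sum d \<tau> - \<sigma>2\<bar> \<le> e"
    using b(1) unfolding eventually_at_right_field by (intro exI[of _ "min 1 (b/2)"]) auto
qed

lemma centered_sum_drift_kernel:
  assumes "0 < \<tau>"
  shows "centered_sum d (drift_kernel \<tau>)
    = (\<Sum>i\<in>I d. Q.expectation d i (\<lambda>x. min (x - center d i) \<tau>)) - centered_sum d (\<lambda>x. x / (1 + x\<^sup>2))"
proof -
  have "(LINT x|centered (Q d i). drift_kernel \<tau> x)
      = Q.expectation d i (\<lambda>x. min (x - center d i) \<tau>) - (LINT x|centered (Q d i). x / (1 + x\<^sup>2))" for i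
  proof -
    have clamp: "integrable (centered (Q d i)) (\<lambda>x. max (- 1) (min x \<tau>))"
      using assms by (intro centered.integrable_bounded[of _ "1 + \<tau>"]) auto
    have ratio: "integrable (centered (Q d i)) (\<lambda>x. x / (1 + x\<^sup>2))"
      by (intro centered.integrable_bounded[of _ 1]) (auto simp: abs_linear_ratio_le_1 simp del: abs_divide)
    have "(LINT x|centered (Q d i). max (- 1) (min x \<tau>)) = Q.expectation d i (\<lambda>x. max (- 1) (min (x - center d i) \<tau>))"
      by (simp add: Q.integral_centered)
    also have "\<dots> = Q.expectation d i (\<lambda>x. min (x - center d i) \<tau>)"
      using Q.AE_nonneg[of d i] center_le_1[of d i] assms
      by (intro integral_cong_AE) (auto elim!: eventually_mono)
    finally show ?thesis
      unfolding drift_kernel_def using clamp ratio by simp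
  qed
  then show ?thesis by (simp add: centered_sum_def sum_subtractf)
qed

lemma mean_sum_minus_drift_tendsto:
  assumes jump: jump_convergence and \<tau>: "0 < \<tau>" "isCont L \<tau>"
  shows "(\<lambda>d. mean_sum d \<tau> - A d - drift d) \<longlonglongrightarrow> levy_shift \<tau> - \<gamma>"
proof -
  have tail: tail_convergence by (rule tail_convergence_of_jump[OF jump])
  obtain B where B: "\<forall>\<^sub>F d in sequentially. tail_sum d \<tau> \<le> B" using tail_sum_bounded[OF tail \<tau>(1)] .
  define err where "err d i = Q.expectation d i (\<lambda>x. min (x - center d i) \<tau>)
    - (trunc_mean (Q d i) \<tau> + \<tau> * measure (Q d i) {\<tau><..} - center d i)" for d i
  have "(\<lambda>d. \<Sum>i\<in>I d. err d i) \<longlonglongrightarrow> 0"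
  proof (rule sum_tendsto_0_of_null_multiple_of_tail[OF B])
    fix e :: real assume "0 < e"
    from center_null[OF this] show "\<forall>\<^sub>F d in sequentially. \<forall>i\<in>I d. norm (err d i) \<le> e * measure (Q d i) {\<tau><..}"
    proof eventually_elim
      case (elim d)
      have "norm (err d i) \<le> center d i * measure (Q d i) {\<tau><..}" for i
        unfolding err_def real_norm_def using \<tau>(1) by (intro Q.expectation_min_shift center_nonneg) simp
      then show ?case using elim by (fastforce intro: order_trans mult_right_mono)
    qed
  qed
  moreover have "(\<lambda>d. centered_sum d (drift_kernel \<tau>)) \<longlonglongrightarrow> (LINT x|\<nu>. drift_kernel \<tau> x)"
    using jump_convergence_real[OF jump, of "drift_kernel \<tau>" 0] jump_test_drift_kernel[OF \<tau>(1)] by simp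
  moreover have "(\<lambda>d. tail_sum d \<tau>) \<longlonglongrightarrow> - L \<tau>"
    using tail \<tau> by (simp add: tail_convergence_def)
  ultimately have "(\<lambda>d. centered_sum d (drift_kernel \<tau>) - \<tau> * tail_sum d \<tau> - (\<Sum>i\<in>I d. err d i))
      \<longlonglongrightarrow> (LINT x|\<nu>. drift_kernel \<tau> x) - \<tau> * - L \<tau> - 0"
    by (intro tendsto_diff tendsto_mult tendsto_const)
  moreover have "centered_sum d (drift_kernel \<tau>) - \<tau> * tail_sum d \<tau> - (\<Sum>i\<in>I d. err d i)
      = mean_sum d \<tau> - A d - drift d" for d
    unfolding centered_sum_drift_kernel[OF \<tau>(1)] err_def drift_def mean_sum_def tail_sum_def
    by (simp add: sum_subtractf sum.distrib sum_distrib_left)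
  ultimately show ?thesis by (simp add: integral_drift_kernel[OF \<tau>(1)])
qed

lemma mean_convergence_iff_drift:
  assumes jump_convergence
  shows "mean_convergence \<longleftrightarrow> drift \<longlonglongrightarrow> \<gamma>"
proof
  note lim = mean_sum_minus_drift_tendsto[OF assms]
  show "drift \<longlonglongrightarrow> \<gamma>" if mean_convergence
  proof -
    obtain \<tau> where \<tau>: "0 < \<tau>" "isCont L \<tau>" using ex_isCont_L[of 0 1] by auto
    then have "(\<lambda>d. mean_sum d \<tau> - A d) \<longlonglongrightarrow> levy_shift \<tau>"
      using that by (simp add: mean_convergence_def)
    from tendsto_diff[OF this lim[OF \<tau>]] show ?thesis by simp
  qed
  show mean_convergence if "drift \<longlonglongrightarrow> \<gamma>"
    unfolding mean_convergence_def using tendsto_add[OF lim that] by simp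
qed

lemma accompanying_exponent_minus_drift_tendsto:
  assumes jump_convergence
  shows "(\<lambda>d. accompanying_exponent d t - \<i> * complex_of_real (t * drift d))
    \<longlonglongrightarrow> levy_exponent t - \<i> * complex_of_real (t * \<gamma>)"
proof -
  have "(\<lambda>d. centered_sum d (levy_kernel t))
      \<longlonglongrightarrow> - complex_of_real (t\<^sup>2 / 2) * complex_of_real \<sigma>2 + (CLINT x|\<nu>. levy_kernel t x)"
    using assms jump_test_levy_kernel unfolding jump_convergence_def by blast
  then show ?thesis by (simp add: accompanying_exponent_eq levy_exponent_def mult_ac)
qed

subsection \<open>From exponents to all test functions\<close>

definition row_measure :: "nat \<Rightarrow> real measure" where
  "row_measure d = sum_measure borel (I d) (\<lambda>i. sinc_weighted (centered (Q d i)))"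

definition limit_measure :: "real measure" where
  "limit_measure = sum_measure borel UNIV
    (\<lambda>b. if b then sinc_weighted \<nu> else density (return borel 0) (\<lambda>_. ennreal (\<sigma>2 / 6)))"

lemma finite_borel_measure_row_measure: "finite_borel_measure (row_measure d)"
  unfolding row_measure_def
  by (intro finite_borel_measure_sum_measure finite_I finite_borel_measure_sinc_weighted
      centered.integrable_bounded[of _ 2]) (auto simp: one_minus_sinc_nonneg one_minus_sinc_le_2)

lemma integral_row_measure:
  assumes f: "f \<in> borel_measurable borel" "\<And>x. norm (f x :: complex) \<le> B"
  shows "(\<integral>x. f x \<partial>row_measure d) = centered_sum d (\<lambda>x. one_minus_sinc x *\<^sub>R f x)"
proof -
  interpret H: finite_borel_measure "row_measure d" by (rule finite_borel_measure_row_measure)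
  show ?thesis
    using H.integrable_bounded[OF f] f(1)
    by (simp add: row_measure_def integral_sum_measure finite_I sets_sinc_weighted integral_sinc_weighted
        centered_sum_def)
qed

lemma integrable_one_minus_sinc_nu: "integrable \<nu> one_minus_sinc"
  using one_minus_sinc_le_min_1_square by (intro integrable_dominated[of _ 2]) (auto simp: one_minus_sinc_nonneg)

lemma finite_borel_measure_limit_measure: "finite_borel_measure limit_measure"
  unfolding limit_measure_def
proof (intro finite_borel_measure_sum_measure)
  have "finite_borel_measure (density (return borel 0) (\<lambda>_. ennreal (\<sigma>2 / 6)))"
    by (intro finite_borel_measure.intro finite_borel_measure_axioms.intro finite_measureI)
      (auto simp: emeasure_density_const)
  then show "finite_borel_measure
      (if b then sinc_weighted \<nu> else density (return borel 0) (\<lambda>_. ennreal (\<sigma>2 / 6)))" for b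
    using finite_borel_measure_sinc_weighted[OF sets_nu integrable_one_minus_sinc_nu] by simp
qed simp

lemma integral_limit_measure:
  assumes f: "f \<in> borel_measurable borel" "\<And>x. norm (f x :: complex) \<le> B"
  shows "(\<integral>x. f x \<partial>limit_measure) = (\<integral>x. one_minus_sinc x *\<^sub>R f x \<partial>\<nu>) + complex_of_real (\<sigma>2 / 6) * f 0"
proof -
  interpret H: finite_borel_measure limit_measure by (rule finite_borel_measure_limit_measure)
  have "(\<integral>x. f x \<partial>density (return borel 0) (\<lambda>_. ennreal (\<sigma>2 / 6))) = complex_of_real (\<sigma>2 / 6) * f 0"
    using f(1) sigma2_nonneg by (subst integral_density) (auto simp: integral_return scaleR_conv_of_real)
  then show ?thesis
    using H.integrable_bounded[OF f] f(1)
    by (simp add: limit_measure_def integral_sum_measure sets_sinc_weighted integral_sinc_weighted UNIV_bool)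
qed

lemma second_difference_accompanying_exponent:
  "second_difference (accompanying_exponent d) t s
    = (\<Sum>i\<in>I d. second_difference (\<lambda>u. char (centered (Q d i)) u - 1) t s)"
  unfolding accompanying_exponent_def[abs_def] second_difference_add second_difference_linear
    second_difference_sum by simp

lemma avg_second_difference_accompanying_exponent:
  "avg_second_difference (accompanying_exponent d) t = char (row_measure d) t"
proof -
  have cont: "isCont (second_difference (char (centered (Q d i))) t) s" for i s
    by (intro continuous_second_difference centered.isCont_char)
  have "complex_integrable unif (second_difference (char (centered (Q d i))) t)" for i
  proof (rule unif.integrable_const_bound[of _ 2])
    show "AE s in unif. norm (second_difference (char (centered (Q d i))) t s) \<le> 2"
      using norm_second_difference_le[of t _ "char (centered (Q d i))" 1] centered.cmod_char_le_1 by auto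
    have "second_difference (char (centered (Q d i))) t \<in> borel_measurable borel"
      by (intro borel_measurable_continuous_onI continuous_at_imp_continuous_on ballI cont)
    then show "second_difference (char (centered (Q d i))) t \<in> borel_measurable unif" by simp
  qed
  then have "avg_second_difference (accompanying_exponent d) t
      = (\<Sum>i\<in>I d. avg_second_difference (char (centered (Q d i))) t)"
    unfolding avg_second_difference_def second_difference_accompanying_exponent second_difference_minus_const
    by simp
  also have "\<dots> = centered_sum d (\<lambda>x. one_minus_sinc x *\<^sub>R iexp (t * x))"
    unfolding centered_sum_def centered.avg_second_difference_char by (simp add: scaleR_conv_of_real)
  also have "\<dots> = char (row_measure d) t"
    unfolding char_def by (rule integral_row_measure[of _ 1, symmetric]) auto
  finally show ?thesis .
qed

lemma norm_second_difference_accompanying_exponent_le: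
  assumes "\<bar>s\<bar> \<le> 1"
  shows "norm (second_difference (accompanying_exponent d) t s)
    \<le> 2 * ((\<bar>t\<bar> + 1)\<^sup>2 / 2 + (\<bar>t\<bar> + 1) + 2) * spread_sum d"
proof -
  define K where "K = (\<bar>t\<bar> + 1)\<^sup>2 / 2 + (\<bar>t\<bar> + 1) + 2"
  have "norm (char (centered (Q d i)) u - 1) \<le> K * spread (Q d i)" if "\<bar>u\<bar> \<le> \<bar>t\<bar> + \<bar>s\<bar>" for i u
  proof -
    have "\<bar>u\<bar> \<le> \<bar>t\<bar> + 1" using that assms by simp
    then have "u\<^sup>2 / 2 + \<bar>u\<bar> + 2 \<le> K"
      unfolding K_def using abs_le_square_iff[of u "\<bar>t\<bar> + 1"] by (intro add_mono) auto
    then show ?thesis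
      using Q.norm_char_centered_minus_1_le[of d i u] Q.spread_nonneg[of d i] by (meson mult_right_mono order_trans)
  qed
  then have "norm (second_difference (\<lambda>u. char (centered (Q d i)) u - 1) t s) \<le> 2 * (K * spread (Q d i))" for i
    by (rule norm_second_difference_le)
  then have "norm (second_difference (accompanying_exponent d) t s) \<le> (\<Sum>i\<in>I d. 2 * (K * spread (Q d i)))"
    unfolding second_difference_accompanying_exponent by (rule sum_norm_le)
  then show ?thesis
    by (simp add: K_def[symmetric] spread_sum_def sum_distrib_left mult.assoc)
qed

lemma char_row_measure_tendsto:
  assumes conv: "\<And>t. (\<lambda>d. accompanying_exponent d t) \<longlonglongrightarrow> levy_exponent t"
    and B: "\<forall>\<^sub>F d in sequentially. spread_sum d \<le> B"
  shows "(\<lambda>d. char (row_measure d) t) \<longlonglongrightarrow> char limit_measure t"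
proof -
  define K where "K = 2 * ((\<bar>t\<bar> + 1)\<^sup>2 / 2 + (\<bar>t\<bar> + 1) + 2)"
  have K: "0 \<le> K" by (simp add: K_def)
  obtain D where D: "\<And>d. D \<le> d \<Longrightarrow> spread_sum d \<le> B" using B by (auto simp: eventually_sequentially)
  have "(\<lambda>d. avg_second_difference (accompanying_exponent (d + D)) t) \<longlonglongrightarrow> avg_second_difference levy_exponent t"
    unfolding avg_second_difference_def
  proof (rule integral_dominated_convergence[where w="\<lambda>_. K * B"])
    have "second_difference g t \<in> borel_measurable borel" if "\<And>u. isCont g u" for g
      by (intro borel_measurable_continuous_onI continuous_at_imp_continuous_on ballI continuous_second_difference that)
    then show "second_difference levy_exponent t \<in> borel_measurable unif"
      "second_difference (accompanying_exponent (d + D)) t \<in> borel_measurable unif" for d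
      using isCont_levy_exponent isCont_accompanying_exponent by simp_all
    show "AE s in unif. (\<lambda>d. second_difference (accompanying_exponent (d + D)) t s) \<longlonglongrightarrow> second_difference levy_exponent t s"
      unfolding second_difference_def
      by (intro AE_I2 tendsto_intros LIMSEQ_ignore_initial_segment[OF conv]) auto
    show "AE s in unif. norm (second_difference (accompanying_exponent (d + D)) t s) \<le> K * B" for d
      using AE_unif
    proof eventually_elim
      case (elim s)
      have "norm (second_difference (accompanying_exponent (d + D)) t s) \<le> K * spread_sum (d + D)"
        unfolding K_def by (rule norm_second_difference_accompanying_exponent_le[OF elim])
      also have "\<dots> \<le> K * B" using D K by (intro mult_left_mono) auto
      finally show ?case .
    qed
  qed simp
  moreover have "avg_second_difference levy_exponent t = char limit_measure t"
    unfolding avg_second_difference_levy_exponent char_def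
    by (subst integral_limit_measure[of _ 1]) (auto simp: scaleR_conv_of_real)
  ultimately have "(\<lambda>d. char (row_measure (d + D)) t) \<longlonglongrightarrow> char limit_measure t"
    by (simp add: avg_second_difference_accompanying_exponent)
  then show ?thesis by (rule LIMSEQ_offset)
qed

lemma jump_convergence_of_exponents:
  assumes "\<And>t. (\<lambda>d. accompanying_exponent d t) \<longlonglongrightarrow> levy_exponent t"
    and "\<forall>\<^sub>F d in sequentially. spread_sum d \<le> B"
  shows jump_convergence
  unfolding jump_convergence_def
proof (intro allI impI)
  fix F l assume "jump_test F l"
  then obtain f C where f: "\<And>x. isCont f x" "\<And>x. norm (f x) \<le> C" "f 0 = 6 * l"
    and F: "\<And>x. one_minus_sinc x *\<^sub>R f x = F x"
    by (rule jump_test_over_one_minus_sinc) (rule that)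
  have meas: "f \<in> borel_measurable borel"
    using f(1) by (intro borel_measurable_continuous_onI continuous_at_imp_continuous_on) auto
  have "(\<lambda>d. \<integral>x. f x \<partial>row_measure d) \<longlonglongrightarrow> (\<integral>x. f x \<partial>limit_measure)"
    using finite_borel_measure_row_measure finite_borel_measure_limit_measure char_row_measure_tendsto[OF assms] f(1,2)
    by (rule finite_borel_measure_levy_continuity)
  then show "(\<lambda>d. centered_sum d F) \<longlonglongrightarrow> l * complex_of_real \<sigma>2 + (CLINT x|\<nu>. F x)"
    by (simp add: integral_row_measure[OF meas f(2)] integral_limit_measure[OF meas f(2)] F f(3) add.commute mult.commute)
qed

subsection \<open>From weak convergence to exponents\<close>

lemma sum_one_minus_norm_char_square_le:
  assumes "0 < r" "r \<le> norm (char (row_law d) t)"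
  shows "(\<Sum>i\<in>I d. 1 - (norm (char (Q d i) t))\<^sup>2) \<le> - ln (r\<^sup>2)"
proof (rule sum_one_minus_le_ln_prod[OF finite_I])
  have "norm (char (row_law d) t) = (\<Prod>i\<in>I d. norm (char (Q d i) t))"
    by (simp add: char_row_law norm_mult prod_norm)
  then show "r\<^sup>2 \<le> (\<Prod>i\<in>I d. (norm (char (Q d i) t))\<^sup>2)"
    using assms by (simp add: prod_power_distrib[symmetric] power_mono)
qed (use assms(1) in auto)

lemma spread_sum_le:
  assumes median: "\<forall>i\<in>I d. measure (Q d i) {1/2<..} \<le> 1/2"
    and r: "0 < r" "\<And>t. \<bar>t\<bar> \<le> 1 \<Longrightarrow> r \<le> norm (char (row_law d) t)"
  shows "spread_sum d \<le> 132 * - ln (r\<^sup>2)"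
proof -
  have int: "integrable unif (\<lambda>s. 1 - (norm (char (Q d i) s))\<^sup>2)" for i
    using Q.cmod_char_le_1[of d i]
    by (intro unif.integrable_const_bound[of _ 1]) (auto simp: power_le_one)
  have "spread_sum d \<le> (\<Sum>i\<in>I d. 132 * (\<integral>x. one_minus_sinc x \<partial>symmetrization (Q d i)))"
    unfolding spread_sum_def using median by (intro sum_mono Q.spread_le_symmetrization) auto
  also have "\<dots> = 132 * (\<integral>s. (\<Sum>i\<in>I d. 1 - (norm (char (Q d i) s))\<^sup>2) \<partial>unif)"
    using int by (simp add: Q.integral_unif_one_minus_norm_char_square[symmetric] sum_distrib_left)
  also have "(\<integral>s. (\<Sum>i\<in>I d. 1 - (norm (char (Q d i) s))\<^sup>2) \<partial>unif) \<le> (\<integral>s. - ln (r\<^sup>2) \<partial>unif)"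
    using int AE_unif sum_one_minus_norm_char_square_le[OF r]
    by (intro integral_mono_AE) (auto elim!: eventually_mono)
  finally show ?thesis using unif.prob_space by simp
qed

lemma spread_sum_bounded_of_uniform_limit:
  assumes lim: "uniform_limit {-1..1} (\<lambda>d. char (row_law d)) (\<lambda>t. exp (levy_exponent t)) sequentially"
  obtains B where "\<forall>\<^sub>F d in sequentially. spread_sum d \<le> B"
proof -
  obtain K where K: "\<And>t. \<bar>t\<bar> \<le> 1 \<Longrightarrow> norm (levy_exponent t) \<le> K" using levy_exponent_bounded by blast
  define r where "r = exp (- K) / 2"
  have r: "0 < r" "2 * r = exp (- K)" by (auto simp: r_def)
  have "\<forall>\<^sub>F d in sequentially. \<forall>t\<in>{-1..1}. dist (char (row_law d) t) (exp (levy_exponent t)) < r"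
    using lim r(1) by (rule uniform_limitD)
  moreover have "\<forall>\<^sub>F d in sequentially. \<forall>i\<in>I d. measure (Q d i) {1/2<..} \<le> 1/2"
    by (rule null) auto
  ultimately have "\<forall>\<^sub>F d in sequentially. spread_sum d \<le> 132 * - ln (r\<^sup>2)"
  proof eventually_elim
    case (elim d)
    have "r \<le> norm (char (row_law d) t)" if t: "\<bar>t\<bar> \<le> 1" for t
    proof -
      have "2 * r \<le> norm (exp (levy_exponent t))"
        using K[OF t] abs_Re_le_cmod[of "levy_exponent t"] by (simp add: r(2) abs_le_iff)
      then show ?thesis
        using elim(1)[rule_format, of t] t norm_triangle_ineq2[of "exp (levy_exponent t)" "char (row_law d) t"]
        by (simp add: dist_norm norm_minus_commute abs_le_iff)
    qed
    then show ?case using elim(2) r(1) by (intro spread_sum_le)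
  qed
  then show ?thesis by (rule that)
qed

lemma exponents_tendsto_of_uniform_limit:
  assumes lim: "uniform_limit {-R..R} (\<lambda>d. char (row_law d)) (\<lambda>t. exp (levy_exponent t)) sequentially"
    and B: "\<forall>\<^sub>F d in sequentially. spread_sum d \<le> B" and t: "\<bar>t\<bar> \<le> R"
  shows "(\<lambda>d. accompanying_exponent d t) \<longlonglongrightarrow> levy_exponent t"
proof -
  have "uniform_limit {-R..R} (\<lambda>d t. exp (accompanying_exponent d t)) (\<lambda>t. exp (levy_exponent t)) sequentially"
    using uniform_limit_minus[OF lim char_row_law_minus_exp_uniform_limit[OF B]] by simp
  moreover have "bounded ((\<lambda>t. exp (- levy_exponent t)) ` {-R..R})"
    by (intro compact_imp_bounded compact_continuous_image continuous_at_imp_continuous_on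
        ballI continuous_intros isCont_levy_exponent) simp
  moreover have "bounded ((\<lambda>t. exp (levy_exponent t)) ` {-R..R})"
    by (intro compact_imp_bounded compact_continuous_image continuous_at_imp_continuous_on
        ballI continuous_intros isCont_levy_exponent) simp
  ultimately have "uniform_limit {-R..R} (\<lambda>d t. exp (accompanying_exponent d t) * exp (- levy_exponent t))
      (\<lambda>t. exp (levy_exponent t) * exp (- levy_exponent t)) sequentially"
    by (intro uniform_lim_mult uniform_limit_const)
  then have "uniform_limit {-R..R} (\<lambda>d t. exp (accompanying_exponent d t - levy_exponent t)) (\<lambda>_. 1) sequentially"
    by (simp add: exp_diff exp_minus divide_inverse)
  then have "(\<lambda>d. accompanying_exponent d t - levy_exponent t) \<longlonglongrightarrow> 0"
    using t
    by (intro tendsto_0_of_exp_uniform_limit[of R] continuous_on_diff continuous_at_imp_continuous_on ballI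
        isCont_accompanying_exponent isCont_levy_exponent)
      (auto simp: accompanying_exponent_def centered.char_zero)
  then show ?thesis by (rule LIM_zero_cancel)
qed

theorem weak_conv_m_row_law_iff:
  assumes M: "real_distribution M" "\<And>t. char M t = exp (levy_exponent t)"
  shows "weak_conv_m row_law M \<longleftrightarrow> tail_convergence \<and> mean_convergence \<and> variance_convergence"
proof
  assume "weak_conv_m row_law M"
  then have uniform: "uniform_limit {-R..R} (\<lambda>d. char (row_law d)) (\<lambda>t. exp (levy_exponent t)) sequentially" for R
    using weak_conv_m_imp_uniform_limit_char[OF real_distribution_row_law M(1), where R=R] by (simp add: M(2)[abs_def])
  obtain B where B: "\<forall>\<^sub>F d in sequentially. spread_sum d \<le> B"
    by (rule spread_sum_bounded_of_uniform_limit[OF uniform])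
  have exponents: "(\<lambda>d. accompanying_exponent d t) \<longlonglongrightarrow> levy_exponent t" for t
    by (rule exponents_tendsto_of_uniform_limit[OF uniform B order_refl])
  then have jump: jump_convergence using B by (rule jump_convergence_of_exponents)
  have "(\<lambda>d. \<i> * complex_of_real (drift d)) \<longlonglongrightarrow> \<i> * complex_of_real \<gamma>"
    using tendsto_diff[OF exponents[of 1] accompanying_exponent_minus_drift_tendsto[OF jump, of 1]] by simp
  then have "drift \<longlonglongrightarrow> \<gamma>" using tendsto_Im by fastforce
  then show "tail_convergence \<and> mean_convergence \<and> variance_convergence"
    using tail_convergence_of_jump variance_convergence_of_jump mean_convergence_iff_drift jump by blast
next
  assume conv: "tail_convergence \<and> mean_convergence \<and> variance_convergence"
  then have jump: jump_convergence by (blast intro: jump_convergence_of_tail_variance)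
  obtain B where "\<forall>\<^sub>F d in sequentially. spread_sum d \<le> B" using spread_sum_bounded conv by blast
  then have uniform:
    "uniform_limit {-R..R} (\<lambda>d t. char (row_law d) t - exp (accompanying_exponent d t)) (\<lambda>_. 0) sequentially" for R
    by (rule char_row_law_minus_exp_uniform_limit)
  have "(\<lambda>d. char (row_law d) t) \<longlonglongrightarrow> char M t" for t
  proof -
    have "drift \<longlonglongrightarrow> \<gamma>" using conv mean_convergence_iff_drift[OF jump] by simp
    then have "(\<lambda>d. \<i> * complex_of_real (t * drift d)) \<longlonglongrightarrow> \<i> * complex_of_real (t * \<gamma>)"
      by (intro tendsto_intros)
    from tendsto_add[OF accompanying_exponent_minus_drift_tendsto[OF jump, of t] this]
    have "(\<lambda>d. accompanying_exponent d t) \<longlonglongrightarrow> levy_exponent t" by simp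
    then have "(\<lambda>d. exp (accompanying_exponent d t)) \<longlonglongrightarrow> char M t" unfolding M(2) by (rule tendsto_exp)
    moreover have "(\<lambda>d. char (row_law d) t - exp (accompanying_exponent d t)) \<longlonglongrightarrow> 0"
      using tendsto_uniform_limitI[OF uniform[of "\<bar>t\<bar>"], of t]
      by (auto simp: abs_ge_self abs_ge_minus_self minus_le_iff)
    ultimately show ?thesis using tendsto_add by fastforce
  qed
  then show "weak_conv_m row_law M"
    by (simp add: weak_conv_m_iff_char_tendsto[OF real_distribution_row_law M(1)])
qed

end

section \<open>Tails of the normalised sums of a single sequence\<close>

context levy_tail
begin

lemma isCont_L_iff:
  assumes "0 < x"
  shows "isCont L x \<longleftrightarrow> (\<forall>e>0. \<exists>u v. 0 < u \<and> u < x \<and> x < v \<and> L v - L u < e)"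
proof (intro iffI allI impI)
  fix e :: real assume "isCont L x" "0 < e"
  then have "\<forall>\<^sub>F y in at x. dist (L y) (L x) < e/2"
    unfolding isCont_def by (intro tendstoD) auto
  then obtain s where s: "0 < s" "\<And>y. y \<noteq> x \<Longrightarrow> \<bar>y - x\<bar> < s \<Longrightarrow> \<bar>L y - L x\<bar> < e/2"
    by (auto simp: eventually_at dist_real_def)
  define u where "u = max (x/2) (x - s/2)"
  have u: "0 < u" "u < x" "\<bar>u - x\<bar> < s" using s(1) assms by (auto simp: u_def)
  have "\<bar>L u - L x\<bar> < e/2" "\<bar>L (x + s/2) - L x\<bar> < e/2" using s u by auto
  then have "L (x + s/2) - L u < e" by linarith
  then show "\<exists>u v. 0 < u \<and> u < x \<and> x < v \<and> L v - L u < e"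
    using u s(1) by (intro exI[of _ u] exI[of _ "x + s/2"]) auto
next
  assume small: "\<forall>e>0. \<exists>u v. 0 < u \<and> u < x \<and> x < v \<and> L v - L u < e"
  show "isCont L x"
    unfolding isCont_def
  proof (rule tendstoI)
    fix e :: real assume "0 < e"
    then obtain u v where uv: "0 < u" "u < x" "x < v" "L v - L u < e" using small by blast
    have "\<forall>\<^sub>F y in at x. y \<in> {u<..<v}"
      using uv by (intro eventually_at_in_open') auto
    then show "\<forall>\<^sub>F y in at x. dist (L y) (L x) < e"
    proof eventually_elim
      case (elim y)
      then show ?case
        using uv L_le[of u y] L_le[of y v] L_le[of u x] L_le[of x v] by (auto simp: dist_real_def)
    qed
  qed
qed

end

lemma ex_first_passage:
  fixes b :: "nat \<Rightarrow> real"
  assumes "filterlim b at_top sequentially" "b m < c" and step: "\<And>n. m \<le> n \<Longrightarrow> b (Suc n) < \<rho> * b n" and "0 \<le> \<rho>"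
  shows "\<exists>n\<ge>m. c \<le> b n \<and> b n \<le> \<rho> * c"
proof -
  have "\<forall>\<^sub>F n in sequentially. c \<le> b n" using assms(1) unfolding filterlim_at_top by blast
  then obtain k where "c \<le> b k" "m \<le> k" unfolding eventually_sequentially by (meson linear order_refl)
  define n where "n = (LEAST n. m \<le> n \<and> c \<le> b n)"
  have n: "m \<le> n \<and> c \<le> b n" unfolding n_def by (rule LeastI[of _ k]) (simp add: \<open>c \<le> b k\<close> \<open>m \<le> k\<close>)
  then have "n \<noteq> m" using assms(2) by auto
  with n obtain l where l: "n = Suc l" "m \<le> l" by (metis Suc_leD le_SucE not0_implies_Suc le_0_eq)
  then have "b l < c" using not_less_Least[of l "\<lambda>n. m \<le> n \<and> c \<le> b n"] by (simp add: n_def)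
  then have "\<rho> * b l \<le> \<rho> * c" using \<open>0 \<le> \<rho>\<close> by (intro mult_left_mono) auto
  then show ?thesis using n step[OF l(2)] l(1) by force
qed

locale normed_tail_limit = levy_tail L
  for L :: "real \<Rightarrow> real" +
  fixes b :: "nat \<Rightarrow> real" and T :: "nat \<Rightarrow> real \<Rightarrow> real"
  assumes b_pos: "\<And>d. 0 < b d" and b_at_top: "filterlim b at_top sequentially"
    and T_antimono: "\<And>j s t. s \<le> t \<Longrightarrow> T j t \<le> T j s"
    and sum_tendsto: "\<And>x. 0 < x \<Longrightarrow> isCont L x \<Longrightarrow> (\<lambda>d. \<Sum>j=1..d. T j (x * b d)) \<longlonglongrightarrow> - L x"
    and negligible: "\<And>x. 0 < x \<Longrightarrow> (\<lambda>d. T d (x * b d)) \<longlonglongrightarrow> 0"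
begin

lemma sum_Suc_scale_tendsto:
  assumes "0 < x" "isCont L x"
  shows "(\<lambda>d. \<Sum>j=1..d. T j (x * b (Suc d))) \<longlonglongrightarrow> - L x"
  using tendsto_diff[OF LIMSEQ_Suc[OF sum_tendsto[OF assms]] LIMSEQ_Suc[OF negligible[OF assms(1)]]] by simp

lemma L_le_of_frequent_ratio:
  assumes freq: "\<exists>\<^sub>F d in sequentially. r * b d \<le> b (Suc d)"
    and y: "0 < y" "isCont L y" and z: "0 < z" "isCont L z" "z \<le> r * y"
  shows "L z \<le> L y"
proof (rule ccontr)
  assume "\<not> ?thesis"
  then obtain m where m: "- L z < m" "m < - L y" using dense[of "- L z" "- L y"] by auto
  have "\<forall>\<^sub>F d in sequentially. (\<Sum>j=1..d. T j (z * b d)) < (\<Sum>j=1..d. T j (y * b (Suc d)))"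
    using order_tendstoD(2)[OF sum_tendsto[OF z(1,2)] m(1)] order_tendstoD(1)[OF sum_Suc_scale_tendsto[OF y] m(2)]
    by eventually_elim simp
  with freq obtain d where d: "r * b d \<le> b (Suc d)"
      "(\<Sum>j=1..d. T j (z * b d)) < (\<Sum>j=1..d. T j (y * b (Suc d)))"
    using frequently_ex[OF frequently_eventually_conj] by blast
  have "y * (r * b d) \<le> y * b (Suc d)" using y(1) d(1) by (intro mult_left_mono) auto
  moreover have "z * b d \<le> (r * y) * b d" using z(3) b_pos[of d] by (intro mult_right_mono) auto
  ultimately have "z * b d \<le> y * b (Suc d)" by (simp add: mult_ac)
  then have "(\<Sum>j=1..d. T j (y * b (Suc d))) \<le> (\<Sum>j=1..d. T j (z * b d))"
    by (intro sum_mono T_antimono)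
  with d(2) show False by simp
qed

lemma L_eq_0_of_frequent_ratio:
  assumes r: "1 < r" and freq: "\<exists>\<^sub>F d in sequentially. r * b d \<le> b (Suc d)" and "0 < x"
  shows "L x = 0"
proof -
  define s where "s = (1 + r) / 2"
  have s: "1 < s" "s < r" using r by (auto simp: s_def)
  have scale_le: "L (s * y) \<le> L y" if y: "0 < y" for y
  proof -
    have "s * y / r < y" using s y by (simp add: divide_less_eq mult.commute)
    then obtain y' where y': "s * y / r < y'" "y' < y" "isCont L y'" using ex_isCont_L[of "s * y / r" y] s y by auto
    have pos: "0 < s * y" "0 < s * y / r" using s y by auto
    then have "0 < y'" using y'(1) by linarith
    have "s * y < r * y'" using y'(1) s by (simp add: divide_less_eq mult.commute)
    then obtain z where z: "s * y < z" "z < r * y'" "isCont L z" using ex_isCont_L[of "s * y" "r * y'"] pos by auto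
    have "L (s * y) \<le> L z" using z pos by (intro L_le) auto
    also have "\<dots> \<le> L y'" using z y' pos \<open>0 < y'\<close> by (intro L_le_of_frequent_ratio[OF freq]) auto
    also have "\<dots> \<le> L y" using y' \<open>0 < y'\<close> by (intro L_le) auto
    finally show ?thesis .
  qed
  have "L (s ^ n * x) \<le> L x" for n
  proof (induction n)
    case (Suc n)
    have "L (s * (s ^ n * x)) \<le> L (s ^ n * x)" using s \<open>0 < x\<close> by (intro scale_le) simp
    with Suc show ?case by (simp add: mult.assoc)
  qed simp
  moreover have "filterlim (\<lambda>n. s ^ n * x) at_top sequentially"
    using s \<open>0 < x\<close> by real_asymp
  ultimately have "0 \<le> L x"
    by (intro tendsto_upperbound[OF filterlim_compose[OF L_tendsto_0]]) auto
  with L_nonpos[OF \<open>0 < x\<close>] show ?thesis by simp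
qed

lemma L_increment_le_isCont:
  assumes r: "0 < r" "r < 1" and nonzero: "0 < x" "L x \<noteq> 0"
    and u: "0 < u" "isCont L u" and v: "u \<le> v" "isCont L v"
    and p: "0 < p" "p < u * r" "isCont L p" and q: "v * r \<le> q" "isCont L q"
  shows "L v - L u \<le> L q - L p"
proof (rule ccontr)
  assume "\<not> ?thesis"
  then obtain m where m: "L q - L p < m" "m < L v - L u" using dense[of "L q - L p" "L v - L u"] by auto
  have "0 < v" using u v by linarith
  then have "0 < q" using q r by (intro less_le_trans[OF _ q(1)]) simp
  define \<rho> where "\<rho> = u * r / p"
  have \<rho>: "1 < \<rho>" "p * \<rho> = u * r" using p by (auto simp: \<rho>_def)
  have "\<forall>\<^sub>F d in sequentially. \<not> \<rho> * b d \<le> b (Suc d)"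
    using L_eq_0_of_frequent_ratio[OF \<rho>(1) _ nonzero(1)] nonzero(2) unfolding not_frequently[symmetric] by blast
  moreover have "\<forall>\<^sub>F d in sequentially. m < (\<Sum>j=1..d. T j (u * b d)) - (\<Sum>j=1..d. T j (v * b d))"
    using order_tendstoD(1)[OF tendsto_diff[OF sum_tendsto[OF u] sum_tendsto[OF \<open>0 < v\<close> v(2)]]] m(2) by simp
  moreover have "\<forall>\<^sub>F d in sequentially. (\<Sum>j=1..d. T j (p * b d)) - (\<Sum>j=1..d. T j (q * b d)) < m"
    using order_tendstoD(2)[OF tendsto_diff[OF sum_tendsto[OF p(1,3)] sum_tendsto[OF \<open>0 < q\<close> q(2)]]] m(1) by simp
  ultimately have "\<forall>\<^sub>F d in sequentially. b (Suc d) < \<rho> * b d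
      \<and> m < (\<Sum>j=1..d. T j (u * b d) - T j (v * b d)) \<and> (\<Sum>j=1..d. T j (p * b d) - T j (q * b d)) < m"
    by eventually_elim (simp add: sum_subtractf not_le)
  then obtain k where k: "\<And>d. k \<le> d \<Longrightarrow> b (Suc d) < \<rho> * b d"
      "\<And>d. k \<le> d \<Longrightarrow> m < (\<Sum>j=1..d. T j (u * b d) - T j (v * b d))"
      "\<And>d. k \<le> d \<Longrightarrow> (\<Sum>j=1..d. T j (p * b d) - T j (q * b d)) < m"
    unfolding eventually_sequentially by blast
  have "b k < b k / r" using r b_pos[of k] by (simp add: less_divide_eq)
  then obtain d where d: "k \<le> d" "b k / r \<le> b d" "b d \<le> \<rho> * (b k / r)"
    using ex_first_passage[OF b_at_top _ k(1)] \<rho>(1) by fastforce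
  have "p * b d \<le> p * (\<rho> * (b k / r))" using d(3) p(1) by (intro mult_left_mono) auto
  also have "\<dots> = u * b k" unfolding mult.assoc[symmetric] \<rho>(2) using r by simp
  finally have pu: "p * b d \<le> u * b k" .
  have "v * b k = v * r * (b k / r)" using r by simp
  also have "\<dots> \<le> q * b d" using q(1) d(2) r b_pos[of k] \<open>0 < q\<close> by (intro mult_mono) auto
  finally have vq: "v * b k \<le> q * b d" .
  have "(\<Sum>j=1..k. T j (u * b k) - T j (v * b k)) \<le> (\<Sum>j=1..d. T j (u * b k) - T j (v * b k))"
    using v(1) b_pos[of k] d(1) by (intro sum_mono2) (auto intro: T_antimono)
  also have "\<dots> \<le> (\<Sum>j=1..d. T j (p * b d) - T j (q * b d))"
    by (intro sum_mono diff_mono T_antimono pu vq)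
  finally show False using k(2)[of k] k(3)[OF d(1)] by simp
qed

lemma L_increment_le:
  assumes r: "0 < r" "r < 1" and nonzero: "0 < x" "L x \<noteq> 0"
    and u: "0 < u" "u < v" and p: "0 < p" "p < u * r" and q: "v * r < q"
  shows "L v - L u \<le> L q - L p"
proof -
  have "p / r < u" using p r by (simp add: divide_less_eq)
  then obtain u' where u': "p / r < u'" "u' < u" "isCont L u'" using ex_isCont_L[of "p / r" u] p r by auto
  have "v < q / r" using q r by (simp add: less_divide_eq)
  then obtain v' where v': "v < v'" "v' < q / r" "isCont L v'" using ex_isCont_L[of v "q / r"] u by auto
  have "p < u' * r" using u' r by (simp add: divide_less_eq)
  then obtain p' where p': "p < p'" "p' < u' * r" "isCont L p'" using ex_isCont_L[of p "u' * r"] p by auto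
  have "v' * r < q" using v' r by (simp add: less_divide_eq)
  then obtain q' where q': "v' * r < q'" "q' < q" "isCont L q'" using ex_isCont_L[of "v' * r" q] v' u r by auto
  have pos: "0 < p / r" "0 < v' * r" using p r v' u by auto
  have "L v - L u \<le> L v' - L u'"
    using u u' v' pos by (intro diff_mono L_le) auto
  also have "\<dots> \<le> L q' - L p'"
    using u u' v' p p' q' pos by (intro L_increment_le_isCont[OF r nonzero]) auto
  also have "\<dots> \<le> L q - L p"
    using p p' q' pos by (intro diff_mono L_le) auto
  finally show ?thesis .
qed

text \<open>A jump at \<open>x\<close> is inherited by every smaller point, whereas \<open>L\<close> has only countably many jumps.\<close>

theorem isCont_L:
  assumes "0 < x"
  shows "isCont L x"
proof (rule ccontr)
  assume "\<not> isCont L x"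
  then obtain \<kappa> where \<kappa>: "0 < \<kappa>" and no_small: "\<not> (\<exists>u v. 0 < u \<and> u < x \<and> x < v \<and> L v - L u < \<kappa>)"
    unfolding isCont_L_iff[OF assms] by blast
  have jump: "\<kappa> \<le> L v - L u" if "0 < u" "u < x" "x < v" for u v
    using no_small that not_less by blast
  have "L (x/2) \<noteq> 0"
    using \<kappa> jump[of "x/2" "2 * x"] L_nonpos[of "2 * x"] assms by simp
  have "\<not> isCont L y" if y: "0 < y" "y < x" for y
  proof
    assume "isCont L y"
    then obtain p q where pq: "0 < p" "p < y" "y < q" "L q - L p < \<kappa>"
      using \<kappa> isCont_L_iff[OF y(1)] by blast
    define r where "r = y / x"
    have r: "0 < r" "r < 1" "x * r = y" using y by (auto simp: r_def)
    have "p / r < x" "x < q / r" using pq r by (simp_all add: divide_less_eq less_divide_eq)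
    then obtain u v where uv: "p / r < u" "u < x" "x < v" "v < q / r" using dense by meson
    have "0 < u" using uv(1) pq(1) r(1) by (meson divide_pos_pos less_trans)
    have "\<kappa> \<le> L v - L u" using uv \<open>0 < u\<close> by (intro jump)
    also have "\<dots> \<le> L q - L p"
      using uv pq r \<open>0 < u\<close> \<open>L (x/2) \<noteq> 0\<close> assms
      by (intro L_increment_le[of r "x/2"]) (auto simp: divide_less_eq less_divide_eq)
    finally show False using pq(4) by simp
  qed
  then have "{0<..<x} \<subseteq> {y \<in> {0<..}. \<not> isCont L y}" by auto
  then have "countable {0<..<x}" using countable_not_isCont_L countable_subset by blast
  then show False using uncountable_open_interval assms by blast
qed

end

section \<open>Self-decomposable distributions\<close>

definition measure_support :: "real measure \<Rightarrow> real set" where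
  "measure_support M = {x. \<forall>U. open U \<longrightarrow> x \<in> U \<longrightarrow> 0 < measure M U}"

lemma measure_supportD: "x \<in> measure_support M \<Longrightarrow> open U \<Longrightarrow> x \<in> U \<Longrightarrow> 0 < measure M U"
  by (simp add: measure_support_def)

lemma Compl_measure_support: "- measure_support M = \<Union> {U. open U \<and> measure M U = 0}"
  by (auto simp: measure_support_def zero_less_measure_iff)

lemma closed_measure_support: "closed (measure_support M)"
  unfolding closed_def Compl_measure_support by auto

context finite_borel_measure
begin

lemma measure_Compl_measure_support: "measure M (- measure_support M) = 0"
proof -
  obtain \<U> where \<U>: "\<U> \<subseteq> {U. open U \<and> measure M U = 0}" "countable \<U>"
    "\<Union> \<U> = \<Union> {U. open U \<and> measure M U = 0}"
    using Lindelof[of "{U. open U \<and> measure M U = 0}"] by auto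
  have "(\<Union>U\<in>\<U>. U) \<in> null_sets M"
    using \<U>(1,2) by (intro null_sets_UN') (auto simp: null_sets_def emeasure_eq_measure M_is_borel)
  then show ?thesis
    unfolding Compl_measure_support \<U>(3)[symmetric] by (simp add: measure_eq_0_null_sets)
qed

lemma ex_measure_support:
  assumes "A \<in> sets borel" "0 < measure M A"
  shows "\<exists>x\<in>A. x \<in> measure_support M"
proof (rule ccontr)
  assume "\<not> ?thesis"
  then have "measure M A \<le> measure M (- measure_support M)"
    using closed_measure_support assms(1) by (intro finite_measure_mono) auto
  then show False using measure_Compl_measure_support assms(2) by simp
qed

lemma ex_isCont_cdf:
  assumes "u < v"
  shows "\<exists>x. u < x \<and> x < v \<and> isCont (cdf M) x"
proof -
  have "countable {x. measure M {x} \<noteq> 0}" using countable_support by simp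
  then have "\<exists>x\<in>{u<..<v}. x \<notin> {x. measure M {x} \<noteq> 0}"
    by (rule open_minus_countable) (use assms in auto)
  then show ?thesis by (auto simp: isCont_cdf)
qed

end

lemma measure_support_distr:
  assumes "sets M = sets borel" "continuous_on UNIV f" "x \<in> measure_support M"
  shows "f x \<in> measure_support (distr M borel f)"
  unfolding measure_support_def
proof (intro CollectI allI impI)
  fix U :: "real set" assume U: "open U" "f x \<in> U"
  have "f \<in> borel_measurable M"
    using borel_measurable_continuous_onI[OF assms(2)] by (simp add: measurable_cong_sets[OF assms(1) refl])
  then have "measure (distr M borel f) U = measure M (f -` U)"
    using U(1) sets_eq_imp_space_eq[OF assms(1)] by (simp add: measure_distr)
  moreover have "open (f -` U)" using assms(2) U(1) by (simp add: continuous_on_open_vimage)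
  ultimately show "0 < measure (distr M borel f) U"
    using measure_supportD[OF assms(3)] U(2) by simp
qed

lemma measure_support_convolution:
  assumes P: "real_distribution P" "x \<in> measure_support P" and Q: "real_distribution Q" "y \<in> measure_support Q"
  shows "x + y \<in> measure_support (P \<star> Q)"
  unfolding measure_support_def
proof (intro CollectI allI impI)
  interpret P: real_distribution P by (rule P)
  interpret Q: real_distribution Q by (rule Q)
  interpret PQ: pair_prob_space P Q ..
  have [measurable_cong]: "sets P = sets borel" "sets Q = sets borel" by simp_all
  have add [measurable]: "(\<lambda>(x, y). x + y) \<in> borel_measurable (P \<Otimes>\<^sub>M Q)" by measurable
  fix U :: "real set" assume U: "open U" "x + y \<in> U"
  have "open ((\<lambda>(x, y). x + y) -` U :: (real \<times> real) set)"
    using U(1) by (intro continuous_open_vimage) (auto simp: split_def intro!: continuous_intros)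
  moreover have "(x, y) \<in> (\<lambda>(x, y). x + y) -` U" using U(2) by simp
  ultimately obtain A B where AB: "open A" "open B" "(x, y) \<in> A \<times> B" "A \<times> B \<subseteq> (\<lambda>(x, y). x + y) -` U"
    by (rule open_prod_elim)
  have "0 < measure P A * measure Q B"
    using measure_supportD[OF P(2) AB(1)] measure_supportD[OF Q(2) AB(2)] AB(3) by simp
  also have "\<dots> = measure (P \<Otimes>\<^sub>M Q) (A \<times> B)"
    using AB(1,2) by (simp add: measure_def Q.emeasure_pair_measure_Times enn2real_mult)
  also have "\<dots> \<le> measure (P \<Otimes>\<^sub>M Q) ((\<lambda>(x, y). x + y) -` U \<inter> space (P \<Otimes>\<^sub>M Q))"
    using AB U(1) by (intro PQ.finite_measure_mono measurable_sets[OF add]) (auto simp: space_pair_measure)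
  also have "\<dots> = measure (P \<star> Q) U"
    unfolding convolution_def using U(1) by (intro measure_distr[symmetric]) auto
  finally show "0 < measure (P \<star> Q) U" .
qed

lemma cdf_convolution:
  assumes "real_distribution P" "real_distribution Q"
  shows "cdf (P \<star> Q) x = (\<integral>y. cdf Q (x - y) \<partial>P)"
proof -
  interpret P: real_distribution P by fact
  interpret Q: real_distribution Q by fact
  interpret PQ: real_distribution "P \<star> Q" by (rule real_distribution_convolution[OF assms])
  have shift: "(\<lambda>z. indicator {..x} (y + z) :: real) = indicator {..x - y}" for y
    by (auto simp: fun_eq_iff split: split_indicator)
  have "cdf (P \<star> Q) x = (\<integral>u. indicator {..x} u \<partial>(P \<star> Q))"
    by (simp add: cdf_def)
  also have "\<dots> = (\<integral>y. \<integral>z. indicator {..x} (y + z) \<partial>Q \<partial>P)"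
    by (rule integral_convolution[OF assms, of _ 1]) (auto split: split_indicator)
  also have "\<dots> = (\<integral>y. cdf Q (x - y) \<partial>P)"
    by (simp add: shift cdf_def)
  finally show ?thesis .
qed

context real_distribution
begin

lemma real_distribution_scale: "real_distribution (distr M borel (\<lambda>x. x / c))"
  by (rule real_distribution_distr) simp

lemma char_scale: "char (distr M borel (\<lambda>x. x / c)) t = char M (t / c)"
  unfolding char_def by (simp add: integral_distr)

end

lemma self_decomposable_convolution:
  assumes "self_decomposable M" "1 < \<alpha>"
  obtains K where "real_distribution K" "M = (distr M borel (\<lambda>x. x / \<alpha>) \<star> K)"
proof -
  have M: "real_distribution M" using assms(1) by (simp add: self_decomposable_def)
  obtain K where K: "real_distribution K" "\<And>x. cdf M x = (\<integral>y. cdf K (x - y) \<partial>(distr M borel (\<lambda>y. y / \<alpha>)))"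
    using assms unfolding self_decomposable_def by blast
  note scaled = real_distribution.real_distribution_scale[OF M, of \<alpha>]
  have "cdf M x = cdf (distr M borel (\<lambda>x. x / \<alpha>) \<star> K) x" for x
    unfolding cdf_convolution[OF scaled K(1)] by (rule K(2))
  then have "M = (distr M borel (\<lambda>x. x / \<alpha>) \<star> K)"
    by (intro cdf_unique[OF M real_distribution_convolution[OF scaled K(1)]]) auto
  then show ?thesis using K(1) by (intro that)
qed

lemma convolution_factors_weak_conv:
  assumes M: "real_distribution M" and nonzero: "\<And>t. char M t \<noteq> 0" and \<alpha>: "\<alpha> \<longlonglongrightarrow> 1"
    and K: "\<And>n. real_distribution (K n)" "\<And>n. M = (distr M borel (\<lambda>x. x / \<alpha> n) \<star> K n)"
  shows "weak_conv_m K (return borel 0)"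
proof -
  interpret real_distribution M by (rule M)
  have char_K: "char (K n) t = char M t / char M (t / \<alpha> n)" for n t
    using char_convolution[OF real_distribution_scale K(1)] nonzero K(2)[of n]
    by (metis char_scale nonzero_mult_div_cancel_left)
  have "(\<lambda>n. char (K n) t) \<longlonglongrightarrow> char (return borel 0) t" for t
  proof -
    have "(\<lambda>n. t / \<alpha> n) \<longlonglongrightarrow> t / 1" by (intro tendsto_divide tendsto_const \<alpha>) simp
    then have "(\<lambda>n. char M (t / \<alpha> n)) \<longlonglongrightarrow> char M t"
      using isCont_tendsto_compose[OF isCont_char[of t]] by simp
    then have "(\<lambda>n. char M t / char M (t / \<alpha> n)) \<longlonglongrightarrow> char M t / char M t"
      by (intro tendsto_divide tendsto_const nonzero)
    then show ?thesis
      using nonzero[of t] by (simp add: char_K char_def[of "return borel 0"] integral_return)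
  qed
  then show ?thesis
    by (simp add: weak_conv_m_iff_char_tendsto[OF K(1) real_distribution_return])
qed

lemma self_decomposable_eventually_shift:
  assumes sd: "self_decomposable M" and nonzero: "\<And>t. char M t \<noteq> 0"
    and \<alpha>: "\<alpha> \<longlonglongrightarrow> 1" "\<And>n. 1 < \<alpha> n" and "0 < r"
  shows "\<forall>\<^sub>F n in sequentially. \<exists>z. \<bar>z\<bar> < r \<and> (\<forall>x\<in>measure_support M. x / \<alpha> n + z \<in> measure_support M)"
proof -
  have M: "real_distribution M" using sd by (simp add: self_decomposable_def)
  then interpret real_distribution M .
  have "\<exists>K. \<forall>n. real_distribution (K n) \<and> M = (distr M borel (\<lambda>x. x / \<alpha> n) \<star> K n)"
    by (intro choice allI) (rule self_decomposable_convolution[OF sd \<alpha>(2)], blast)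
  then obtain K where K: "\<And>n. real_distribution (K n)" "\<And>n. M = (distr M borel (\<lambda>x. x / \<alpha> n) \<star> K n)"
    by blast
  have "(\<lambda>n. measure (K n) {- r<..<r}) \<longlonglongrightarrow> measure (return borel 0) {- r<..<r}"
    using \<open>0 < r\<close> by (intro weak_conv_imp_continuity_set_conv[OF K(1) real_distribution_return
          convolution_factors_weak_conv[OF M nonzero \<alpha>(1) K]])
      (auto simp: frontier_def)
  then have "\<forall>\<^sub>F n in sequentially. 0 < measure (K n) {- r<..<r}"
    by (rule order_tendstoD(1)) (use \<open>0 < r\<close> in \<open>simp add: measure_return\<close>)
  then show ?thesis
  proof eventually_elim
    case (elim n)
    interpret K: real_distribution "K n" by (rule K(1))
    obtain z where "z \<in> {- r<..<r}" and z: "z \<in> measure_support (K n)"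
      using K.ex_measure_support[OF _ elim] by auto
    then have "\<bar>z\<bar> < r" by auto
    have "x / \<alpha> n + z \<in> measure_support M" if "x \<in> measure_support M" for x
    proof -
      have "x / \<alpha> n \<in> measure_support (distr M borel (\<lambda>x. x / \<alpha> n))"
        using \<alpha>(2)[of n] that by (intro measure_support_distr) (auto intro!: continuous_intros)
      then have "x / \<alpha> n + z \<in> measure_support (distr M borel (\<lambda>x. x / \<alpha> n) \<star> K n)"
        by (intro measure_support_convolution real_distribution_scale K z)
      then show ?thesis using K(2)[of n] by simp
    qed
    with \<open>\<bar>z\<bar> < r\<close> show ?case by blast
  qed
qed

text \<open>A gap \<open>(s, t)\<close> between two points of the support is impossible: \<open>s / \<alpha> + z\<close> and \<open>t / \<alpha> + z\<close> are support
  points near \<open>s\<close> and \<open>t\<close>, but closer to each other than \<open>s\<close> and \<open>t\<close>.\<close>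

lemma self_decomposable_measure_support_dense:
  assumes sd: "self_decomposable M" and nonzero: "\<And>t. char M t \<noteq> 0"
    and st: "s \<in> measure_support M" "t \<in> measure_support M" "s < t"
  shows "\<exists>u\<in>measure_support M. s < u \<and> u < t"
proof -
  define \<alpha> where "\<alpha> n = 1 + 1 / real (Suc n)" for n
  have \<alpha>: "\<alpha> \<longlonglongrightarrow> 1" "1 < \<alpha> n" for n unfolding \<alpha>_def by real_asymp simp
  define r where "r = (t - s) / 4"
  have r: "0 < r" "t - s = 4 * r" using st by (auto simp: r_def)
  have near: "\<forall>\<^sub>F n in sequentially. \<bar>x / \<alpha> n - x\<bar> < r" for x
  proof -
    have "(\<lambda>n. x / \<alpha> n) \<longlonglongrightarrow> x / 1" by (intro tendsto_divide tendsto_const \<alpha>) simp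
    from tendstoD[OF this r(1)] show ?thesis by (simp add: dist_real_def)
  qed
  have "\<forall>\<^sub>F n in sequentially. (\<exists>z. \<bar>z\<bar> < r \<and> (\<forall>x\<in>measure_support M. x / \<alpha> n + z \<in> measure_support M))
      \<and> \<bar>s / \<alpha> n - s\<bar> < r \<and> \<bar>t / \<alpha> n - t\<bar> < r"
    by (intro eventually_conj near self_decomposable_eventually_shift[OF sd nonzero \<alpha> r(1)])
  then obtain n z where n: "\<bar>s / \<alpha> n - s\<bar> < r" "\<bar>t / \<alpha> n - t\<bar> < r" and "\<bar>z\<bar> < r"
    and shift: "\<And>x. x \<in> measure_support M \<Longrightarrow> x / \<alpha> n + z \<in> measure_support M"
    using eventually_happens' sequentially_bot by blast
  have "(t - s) / \<alpha> n < t - s" using st(3) \<alpha>(2)[of n] by (simp add: divide_less_eq)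
  then have "s < s / \<alpha> n + z \<or> t / \<alpha> n + z < t" unfolding diff_divide_distrib by linarith
  then show ?thesis
  proof
    assume "s < s / \<alpha> n + z"
    moreover have "s / \<alpha> n + z < t" using n(1) \<open>\<bar>z\<bar> < r\<close> r by linarith
    ultimately show ?thesis using shift[OF st(1)] by blast
  next
    assume "t / \<alpha> n + z < t"
    moreover have "s < t / \<alpha> n + z" using n(2) \<open>\<bar>z\<bar> < r\<close> r by linarith
    ultimately show ?thesis using shift[OF st(2)] by blast
  qed
qed

lemma self_decomposable_cdf_less:
  assumes sd: "self_decomposable M" and nonzero: "\<And>t. char M t \<noteq> 0"
    and "x < y" "0 < cdf M x" "cdf M x < 1"
  shows "cdf M x < cdf M y"
proof (rule ccontr)
  have M: "real_distribution M" using sd by (simp add: self_decomposable_def)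
  then interpret real_distribution M .
  assume "\<not> cdf M x < cdf M y"
  then have "measure M {x<..y} = 0"
    using cdf_diff_eq[OF \<open>x < y\<close>] measure_nonneg[of M "{x<..y}"] by linarith
  moreover have "measure M {x<..<y} \<le> measure M {x<..y}" by (intro finite_measure_mono) auto
  ultimately have "measure M {x<..<y} = 0" by (simp add: measure_le_0_iff)
  then have gap: "u \<notin> measure_support M" if "x < u" "u < y" for u
    using measure_supportD[of u M "{x<..<y}"] that by auto
  have "prob (- {..x}) = 1 - cdf M x" using prob_compl[of "{..x}"] by (simp add: cdf_def Compl_eq_Diff_UNIV)
  then obtain s0 t0 where "s0 \<in> measure_support M" "s0 \<le> x" "t0 \<in> measure_support M" "x < t0"
    using ex_measure_support[of "{..x}"] ex_measure_support[of "- {..x}"] assms(4,5) by (auto simp: cdf_def)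
  then have t0: "y \<le> t0" using gap[of t0] by force
  define s where "s = Sup (measure_support M \<inter> {..x})"
  define t where "t = Inf (measure_support M \<inter> {y..})"
  have s: "s \<in> measure_support M \<inter> {..x}"
    unfolding s_def using \<open>s0 \<in> measure_support M\<close> \<open>s0 \<le> x\<close>
    by (intro closed_contains_Sup closed_Int closed_measure_support) auto
  have t: "t \<in> measure_support M \<inter> {y..}"
    unfolding t_def using \<open>t0 \<in> measure_support M\<close> t0
    by (intro closed_contains_Inf closed_Int closed_measure_support) auto
  obtain u where u: "u \<in> measure_support M" "s < u" "u < t"
    using self_decomposable_measure_support_dense[OF sd nonzero] s t \<open>x < y\<close> by force
  have "u \<le> s" if "u \<le> x" unfolding s_def using u(1) that by (intro cSup_upper) auto
  moreover have "t \<le> u" if "y \<le> u" unfolding t_def using u(1) that by (intro cInf_lower) auto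
  ultimately show False using u gap[of u] by force
qed

section \<open>Quantiles and weak convergence\<close>

lemma gen_inv_cdf_le_iff:
  assumes "real_distribution M" "0 < m" "m < 1"
  shows "gen_inv (cdf M) m \<le> x \<longleftrightarrow> m \<le> cdf M x"
proof -
  interpret cdf_distribution M using assms(1) by (simp add: cdf_distribution_def)
  show ?thesis unfolding gen_inv_def by (rule pseudoinverse[OF assms(2,3), symmetric])
qed

locale approximate_quantiles =
  fixes V :: "nat \<Rightarrow> real measure" and M :: "real measure" and Z :: "nat \<Rightarrow> real \<Rightarrow> real"
  assumes real_distribution_V: "\<And>d. real_distribution (V d)"
    and real_distribution_M: "real_distribution M"
    and quantile_le: "\<And>d m y. 0 < m \<Longrightarrow> m < 1 \<Longrightarrow> m \<le> cdf (V d) y \<Longrightarrow> Z d m \<le> y"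
    and cdf_ge: "\<And>m h e. 0 < m \<Longrightarrow> m < 1 \<Longrightarrow> 0 < h \<Longrightarrow> 0 < e
      \<Longrightarrow> \<forall>\<^sub>F d in sequentially. \<forall>y. Z d m + h \<le> y \<longrightarrow> m - e \<le> cdf (V d) y"
begin

sublocale M: real_distribution M
  by (rule real_distribution_M)

lemma gen_inv_le_iff: "0 < m \<Longrightarrow> m < 1 \<Longrightarrow> gen_inv (cdf M) m \<le> x \<longleftrightarrow> m \<le> cdf M x"
  by (rule gen_inv_cdf_le_iff[OF real_distribution_M])

lemma quantile_tendsto:
  assumes weak: "weak_conv_m V M" and m: "0 < m" "m < 1"
    and strict: "\<And>x y. x < y \<Longrightarrow> 0 < cdf M x \<Longrightarrow> cdf M x < 1 \<Longrightarrow> cdf M x < cdf M y"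
  shows "(\<lambda>d. Z d m) \<longlonglongrightarrow> gen_inv (cdf M) m"
proof (rule order_tendstoI)
  let ?q = "gen_inv (cdf M) m"
  have cdf: "(\<lambda>d. cdf (V d) y) \<longlonglongrightarrow> cdf M y" if "isCont (cdf M) y" for y
    using weak that by (auto simp: weak_conv_m_def weak_conv_def)
  fix u assume "?q < u"
  then obtain y where y: "?q < y" "y < u" "isCont (cdf M) y" using M.ex_isCont_cdf by blast
  have "m < cdf M y"
  proof (cases "m = cdf M ?q")
    case True
    then show ?thesis using strict[OF y(1)] m by simp
  next
    case False
    then have "m < cdf M ?q" using gen_inv_le_iff[OF m, of ?q] by simp
    then show ?thesis using M.cdf_nondecreasing[of ?q y] y(1) by linarith
  qed
  from order_tendstoD(1)[OF cdf[OF y(3)] this] show "\<forall>\<^sub>F d in sequentially. Z d m < u"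
    by eventually_elim (rule le_less_trans[OF quantile_le[OF m less_imp_le] y(2)])
next
  let ?q = "gen_inv (cdf M) m"
  fix u assume "u < ?q"
  then obtain y where y: "u < y" "y < ?q" "isCont (cdf M) y" using M.ex_isCont_cdf by blast
  have "cdf M y < m" using gen_inv_le_iff[OF m, of y] y(2) by simp
  then obtain e where e: "0 < e" "cdf M y < m - e"
    using dense[of 0 "m - cdf M y"] by auto
  have "(\<lambda>d. cdf (V d) y) \<longlonglongrightarrow> cdf M y"
    using weak y(3) by (auto simp: weak_conv_m_def weak_conv_def)
  then have "\<forall>\<^sub>F d in sequentially. cdf (V d) y < m - e" using e(2) by (rule order_tendstoD(2))
  moreover have "\<forall>\<^sub>F d in sequentially. \<forall>x. Z d m + (y - u) \<le> x \<longrightarrow> m - e \<le> cdf (V d) x"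
    using y(1) by (intro cdf_ge[OF m _ e(1)]) simp
  ultimately show "\<forall>\<^sub>F d in sequentially. u < Z d m"
    by eventually_elim (force simp: not_le[symmetric])
qed

lemma eventually_cdf_less:
  assumes lim: "\<And>m. 0 < m \<Longrightarrow> m < 1 \<Longrightarrow> (\<lambda>d. Z d m) \<longlonglongrightarrow> gen_inv (cdf M) m" and u: "cdf M y < u"
  shows "\<forall>\<^sub>F d in sequentially. cdf (V d) y < u"
proof (cases "1 < u")
  case True
  then show ?thesis
    by (auto intro!: always_eventually le_less_trans[OF real_distribution.cdf_bounded_prob[OF real_distribution_V]])
next
  case False
  obtain m where m: "cdf M y < m" "m < u" using dense u by blast
  then have m01: "0 < m" "m < 1" using M.cdf_nonneg[of y] False by linarith+
  have "y < gen_inv (cdf M) m" using gen_inv_le_iff[OF m01, of y] m(1) by simp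
  from order_tendstoD(1)[OF lim[OF m01] this] show ?thesis
    by eventually_elim (use quantile_le[OF m01] m(2) in \<open>force simp: not_le[symmetric]\<close>)
qed

lemma eventually_less_cdf:
  assumes lim: "\<And>m. 0 < m \<Longrightarrow> m < 1 \<Longrightarrow> (\<lambda>d. Z d m) \<longlonglongrightarrow> gen_inv (cdf M) m"
    and cont: "isCont (cdf M) y" and u: "u < cdf M y"
  shows "\<forall>\<^sub>F d in sequentially. u < cdf (V d) y"
proof (cases "u < 0")
  case True
  then show ?thesis by (auto intro!: always_eventually less_le_trans[OF _ measure_nonneg] simp: cdf_def)
next
  case False
  have "(cdf M \<longlongrightarrow> cdf M y) (at_left y)"
    using cont unfolding isCont_def by (rule tendsto_within_subset) simp
  then have "\<forall>\<^sub>F x in at_left y. u < cdf M x" using u by (rule order_tendstoD(1))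
  then obtain v where "v < y" "\<And>x. v < x \<Longrightarrow> x < y \<Longrightarrow> u < cdf M x"
    unfolding eventually_at_left_field by blast
  then obtain x where x: "x < y" "u < cdf M x" using dense by blast
  obtain m where m: "u < m" "m < cdf M x" using dense x(2) by blast
  then have m01: "0 < m" "m < 1" using M.cdf_bounded_prob[of x] False by linarith+
  obtain w where w: "x < w" "w < y" using dense x(1) by blast
  obtain e where e: "0 < e" "u < m - e" using dense[of 0 "m - u"] m(1) by auto
  have "gen_inv (cdf M) m < w" using gen_inv_le_iff[OF m01, of x] m(2) w(1) by simp
  from order_tendstoD(2)[OF lim[OF m01] this] have "\<forall>\<^sub>F d in sequentially. Z d m < w" .
  moreover have "\<forall>\<^sub>F d in sequentially. \<forall>x. Z d m + (y - w) \<le> x \<longrightarrow> m - e \<le> cdf (V d) x"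
    using w(2) by (intro cdf_ge[OF m01 _ e(1)]) simp
  ultimately show ?thesis
    by eventually_elim (use e(2) in \<open>auto intro: less_le_trans\<close>)
qed

lemma weak_conv_of_quantile_tendsto:
  assumes "\<And>m. 0 < m \<Longrightarrow> m < 1 \<Longrightarrow> (\<lambda>d. Z d m) \<longlonglongrightarrow> gen_inv (cdf M) m"
  shows "weak_conv_m V M"
  unfolding weak_conv_m_def weak_conv_def
  using eventually_cdf_less[OF assms] eventually_less_cdf[OF assms] by (intro allI impI order_tendstoI) auto

theorem weak_conv_iff_quantile_tendsto:
  assumes "\<And>x y. x < y \<Longrightarrow> 0 < cdf M x \<Longrightarrow> cdf M x < 1 \<Longrightarrow> cdf M x < cdf M y"
  shows "weak_conv_m V M \<longleftrightarrow> (\<forall>m. 0 < m \<longrightarrow> m < 1 \<longrightarrow> (\<lambda>d. Z d m) \<longlonglongrightarrow> gen_inv (cdf M) m)"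
  using quantile_tendsto[OF _ _ _ assms] weak_conv_of_quantile_tendsto by blast

end

lemma smallo_iff_divide_tendsto:
  fixes f b :: "nat \<Rightarrow> real"
  assumes "\<And>d. 0 < b d"
  shows "(\<lambda>d. f d - c * b d) \<in> o(b) \<longleftrightarrow> (\<lambda>d. f d / b d) \<longlonglongrightarrow> c"
proof -
  have nonzero: "\<forall>\<^sub>F d in sequentially. b d \<noteq> 0" using assms by (auto simp: less_imp_neq[THEN not_sym])
  have "(\<lambda>d. f d - c * b d) \<in> o(b) \<longleftrightarrow> (\<lambda>d. (f d - c * b d) / b d) \<longlonglongrightarrow> 0"
    by (auto intro: smalloD_tendsto smalloI_tendsto[OF _ nonzero])
  also have "(\<lambda>d. (f d - c * b d) / b d) = (\<lambda>d. f d / b d - c)"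
    using assms by (simp add: fun_eq_iff diff_divide_distrib less_imp_neq[THEN not_sym])
  finally show ?thesis by (simp add: LIM_zero_iff)
qed

section \<open>Sums and iterated limits\<close>

lemma sum_lessThan_tendsto_0_of_dominated:
  fixes f :: "nat \<Rightarrow> nat \<Rightarrow> 'a::{real_normed_algebra, banach}"
  assumes "\<And>j. (\<lambda>d. f j d) \<longlonglongrightarrow> 0" and bound: "\<And>j d. norm (f j d) \<le> s j" and "summable s"
  shows "(\<lambda>d. \<Sum>j<d. f j d) \<longlonglongrightarrow> 0"
proof -
  define g where "g j d = (if j < d then f j d else 0)" for j d
  have "(\<lambda>d. g j d) \<longlonglongrightarrow> 0" for j
    using assms(1)[of j]
  proof (rule Lim_transform_eventually)
    show "\<forall>\<^sub>F d in sequentially. f j d = g j d"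
      using eventually_gt_at_top[of j] by eventually_elim (simp add: g_def)
  qed
  moreover have "\<forall>\<^sub>F (j, d) in sequentially \<times>\<^sub>F sequentially. norm (g j d) \<le> s j"
    using bound order_trans[OF norm_ge_zero bound] by (intro always_eventually) (auto simp: g_def)
  ultimately have "(\<lambda>d. \<Sum>j. g j d) \<longlonglongrightarrow> (\<Sum>j. 0)"
    using tannerys_theorem[of g "\<lambda>_. 0" sequentially s] assms(3) by simp
  moreover have "(\<Sum>j. g j d) = (\<Sum>j<d. f j d)" for d
    by (subst suminf_finite[of "{..<d}"]) (auto simp: g_def)
  ultimately show ?thesis by simp
qed

lemma tendsto_ereal_of_bounds:
  assumes "\<And>e. 0 < e \<Longrightarrow> \<forall>\<^sub>F x in G. ereal (s - e) \<le> f x \<and> f x \<le> ereal (s + e)"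
  shows "(f \<longlongrightarrow> ereal s) G"
proof (rule order_tendstoI)
  fix u assume "u < ereal s"
  then obtain r where r: "u < ereal r" "ereal r < ereal s" using ereal_dense2 by blast
  then have "\<forall>\<^sub>F x in G. ereal (s - (s - r)) \<le> f x \<and> f x \<le> ereal (s + (s - r))" by (intro assms) simp
  then show "\<forall>\<^sub>F x in G. u < f x" by eventually_elim (use r(1) in \<open>auto intro: less_le_trans\<close>)
next
  fix u assume "ereal s < u"
  then obtain r where r: "ereal s < ereal r" "ereal r < u" using ereal_dense2 by blast
  then have "\<forall>\<^sub>F x in G. ereal (s - (r - s)) \<le> f x \<and> f x \<le> ereal (s + (r - s))" by (intro assms) simp
  then show "\<forall>\<^sub>F x in G. f x < u" by eventually_elim (use r(2) in \<open>auto intro: le_less_trans\<close>)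
qed

lemma Limsup_Liminf_tendsto_iff:
  fixes X :: "'a \<Rightarrow> 'b \<Rightarrow> real"
  assumes "F \<noteq> bot"
  shows "((\<lambda>\<tau>. Limsup F (\<lambda>d. ereal (X d \<tau>))) \<longlongrightarrow> ereal s) G
      \<and> ((\<lambda>\<tau>. Liminf F (\<lambda>d. ereal (X d \<tau>))) \<longlongrightarrow> ereal s) G
    \<longleftrightarrow> (\<forall>e>0. \<forall>\<^sub>F \<tau> in G. \<forall>\<^sub>F d in F. \<bar>X d \<tau> - s\<bar> \<le> e)"
proof (intro iffI allI impI)
  fix e :: real assume "0 < e"
  assume lim: "((\<lambda>\<tau>. Limsup F (\<lambda>d. ereal (X d \<tau>))) \<longlongrightarrow> ereal s) G
      \<and> ((\<lambda>\<tau>. Liminf F (\<lambda>d. ereal (X d \<tau>))) \<longlongrightarrow> ereal s) G"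
  have "\<forall>\<^sub>F \<tau> in G. Limsup F (\<lambda>d. ereal (X d \<tau>)) < ereal (s + e)"
    using \<open>0 < e\<close> by (intro order_tendstoD(2)[OF conjunct1[OF lim]]) simp
  moreover have "\<forall>\<^sub>F \<tau> in G. ereal (s - e) < Liminf F (\<lambda>d. ereal (X d \<tau>))"
    using \<open>0 < e\<close> by (intro order_tendstoD(1)[OF conjunct2[OF lim]]) simp
  ultimately show "\<forall>\<^sub>F \<tau> in G. \<forall>\<^sub>F d in F. \<bar>X d \<tau> - s\<bar> \<le> e"
  proof eventually_elim
    case (elim \<tau>)
    from Limsup_lessD[OF elim(1)] less_LiminfD[OF elim(2)]
    show ?case by eventually_elim (simp add: abs_le_iff)
  qed
next
  assume close: "\<forall>e>0. \<forall>\<^sub>F \<tau> in G. \<forall>\<^sub>F d in F. \<bar>X d \<tau> - s\<bar> \<le> e"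
  have bounds: "\<forall>\<^sub>F \<tau> in G. ereal (s - e) \<le> Liminf F (\<lambda>d. ereal (X d \<tau>))
      \<and> Limsup F (\<lambda>d. ereal (X d \<tau>)) \<le> ereal (s + e)" if "0 < e" for e
  proof -
    have "\<forall>\<^sub>F \<tau> in G. \<forall>\<^sub>F d in F. \<bar>X d \<tau> - s\<bar> \<le> e" using close that by blast
    then show ?thesis
      by eventually_elim
        (auto intro!: Liminf_bounded Limsup_bounded elim!: eventually_mono simp: abs_le_iff)
  qed
  have le: "Liminf F (\<lambda>d. ereal (X d \<tau>)) \<le> Limsup F (\<lambda>d. ereal (X d \<tau>))" for \<tau>
    by (rule Liminf_le_Limsup[OF assms])
  show "((\<lambda>\<tau>. Limsup F (\<lambda>d. ereal (X d \<tau>))) \<longlongrightarrow> ereal s) G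
      \<and> ((\<lambda>\<tau>. Liminf F (\<lambda>d. ereal (X d \<tau>))) \<longlongrightarrow> ereal s) G"
    by (intro conjI tendsto_ereal_of_bounds; drule bounds)
      (auto elim!: eventually_mono intro: order_trans[OF _ le] order_trans[OF le])
qed

section \<open>Large atoms of discrete distributions\<close>

lemma measure_pmf_infsum: "measure_pmf.prob p S = (\<Sum>\<^sub>\<infinity>x\<in>S. pmf p x)"
  unfolding measure_pmf_conv_infsetsum by (rule infsetsum_infsum) auto

lemma expectation_pmf_infsum:
  fixes f :: "'a \<Rightarrow> real"
  assumes "integrable (measure_pmf p) f"
  shows "measure_pmf.expectation p f = (\<Sum>\<^sub>\<infinity>x. pmf p x * f x)"
proof -
  have "integrable (density (count_space UNIV) (pmf p)) f"
    using assms by (simp add: measure_pmf_eq_density)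
  then have "integrable (count_space UNIV) (\<lambda>x. pmf p x * f x)"
    by (subst (asm) integrable_density) auto
  then have "Infinite_Set_Sum.abs_summable_on (\<lambda>x. pmf p x * f x) UNIV" by (simp add: abs_summable_on_def)
  then show ?thesis unfolding pmf_expectation_eq_infsetsum by (rule infsetsum_infsum)
qed

definition surprisal :: "'a pmf \<Rightarrow> 'a \<Rightarrow> real" where
  "surprisal p x = - ln (pmf p x)"

definition top_mass :: "'a pmf \<Rightarrow> nat \<Rightarrow> real" where
  "top_mass p n = Sup (measure_pmf.prob p ` {S. finite S \<and> card S \<le> n})"

definition min_atoms :: "'a pmf \<Rightarrow> real \<Rightarrow> nat" where
  "min_atoms p m = (LEAST n. m \<le> top_mass p n)"

lemma surprisal_nonneg: "0 \<le> surprisal p x"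
  using pmf_le_1[of p x] pmf_nonneg[of p x] by (cases "pmf p x = 0") (auto simp: surprisal_def)

lemma surprisal_le_iff: "0 < pmf p x \<Longrightarrow> surprisal p x \<le> s \<longleftrightarrow> exp (- s) \<le> pmf p x"
  using ln_ge_iff[of "pmf p x" "- s"] by (auto simp: surprisal_def)

lemma less_surprisal_divide_iff:
  assumes "0 < c" "0 < pmf p x"
  shows "y < surprisal p x / c \<longleftrightarrow> pmf p x < exp (- y * c)"
  unfolding pos_less_divide_eq[OF assms(1)]
  using surprisal_le_iff[OF assms(2), of "y * c"] by (simp add: not_le[symmetric])

lemma prob_le_top_mass:
  assumes "finite S" "card S \<le> n"
  shows "measure_pmf.prob p S \<le> top_mass p n"
  unfolding top_mass_def using assms by (intro cSup_upper) (auto intro!: bdd_aboveI[of _ 1])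

lemma top_mass_le:
  assumes "\<And>S. finite S \<Longrightarrow> card S \<le> n \<Longrightarrow> measure_pmf.prob p S \<le> B"
  shows "top_mass p n \<le> B"
  unfolding top_mass_def using assms by (intro cSup_least) (auto intro: exI[of _ "{}"])

lemma card_large_atoms_le_exp:
  assumes "finite F" "F \<subseteq> {x. exp (- s) \<le> pmf p x}"
  shows "real (card F) \<le> exp s"
proof -
  have "real (card F) * exp (- s) = (\<Sum>x\<in>F. exp (- s))" by simp
  also have "\<dots> \<le> (\<Sum>x\<in>F. pmf p x)" using assms by (intro sum_mono) auto
  also have "\<dots> = measure_pmf.prob p F" using assms(1) by (simp add: measure_measure_pmf_finite)
  also have "\<dots> \<le> 1" by simp
  finally show ?thesis by (simp add: exp_minus field_simps)
qed

lemma finite_large_atoms: "finite {x. exp (- s) \<le> pmf p x}"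
proof (rule ccontr)
  assume "infinite {x. exp (- s) \<le> pmf p x}"
  then obtain F where "finite F" "card F = nat \<lceil>exp s\<rceil> + 1" "F \<subseteq> {x. exp (- s) \<le> pmf p x}"
    using infinite_arbitrarily_large by blast
  with card_large_atoms_le_exp[of F s p] show False by linarith
qed

lemma prob_surprisal_le_top_mass:
  "measure_pmf.prob p {x. surprisal p x \<le> s} \<le> top_mass p (card {x. exp (- s) \<le> pmf p x})"
proof -
  have "measure_pmf.prob p {x. surprisal p x \<le> s} \<le> measure_pmf.prob p {x. exp (- s) \<le> pmf p x}"
    by (rule measure_pmf.finite_measure_mono_AE)
      (auto simp: AE_measure_pmf_iff pmf_positive_iff[symmetric] surprisal_le_iff)
  then show ?thesis using prob_le_top_mass[OF finite_large_atoms order_refl] by (rule order_trans)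
qed

lemma min_atoms_le_exp:
  assumes "m \<le> measure_pmf.prob p {x. surprisal p x \<le> s}"
  shows "real (min_atoms p m) \<le> exp s"
proof -
  have "min_atoms p m \<le> card {x. exp (- s) \<le> pmf p x}"
    unfolding min_atoms_def using assms prob_surprisal_le_top_mass by (intro Least_le) (rule order_trans)
  then show ?thesis using card_large_atoms_le_exp[OF finite_large_atoms[of s p] order_refl] by linarith
qed

lemma cdf_distr_pmf: "cdf (distr (measure_pmf p) borel X) y = measure_pmf.prob p {x. X x \<le> y}"
  by (simp add: cdf_def measure_distr vimage_def)

lemma real_distribution_distr_pmf: "real_distribution (distr (measure_pmf p) borel (X :: 'a \<Rightarrow> real))"
  by (rule prob_space.real_distribution_distr[OF prob_space_measure_pmf]) simp

lemma le_top_mass_min_atoms: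
  assumes "m < 1"
  shows "m \<le> top_mass p (min_atoms p m)"
  unfolding min_atoms_def
proof (rule LeastI_ex)
  interpret K: real_distribution "distr (measure_pmf p) borel (surprisal p)"
    by (rule real_distribution_distr_pmf)
  have "\<forall>\<^sub>F y in at_top. m < measure_pmf.prob p {x. surprisal p x \<le> y}"
    using order_tendstoD(1)[OF K.cdf_lim_at_top_prob assms] by (simp add: cdf_distr_pmf)
  then obtain y where "m < measure_pmf.prob p {x. surprisal p x \<le> y}"
    using eventually_happens' trivial_limit_at_top_linorder by blast
  then show "\<exists>n. m \<le> top_mass p n"
    using prob_surprisal_le_top_mass[of p y] by (intro exI) (rule order_trans[OF less_imp_le])
qed

lemma le_prob_surprisal_add:
  assumes "m < 1"
  shows "m \<le> measure_pmf.prob p {x. surprisal p x \<le> s} + real (min_atoms p m) * exp (- s)"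
proof (rule order_trans[OF le_top_mass_min_atoms[OF assms] top_mass_le])
  fix S :: "'a set" assume S: "finite S" "card S \<le> min_atoms p m"
  let ?T = "S \<inter> {x. pmf p x < exp (- s)}"
  have "measure_pmf.prob p S \<le> measure_pmf.prob p ({x. surprisal p x \<le> s} \<union> ?T)"
    by (rule measure_pmf.finite_measure_mono_AE)
      (auto simp: AE_measure_pmf_iff pmf_positive_iff[symmetric] surprisal_le_iff)
  also have "\<dots> \<le> measure_pmf.prob p {x. surprisal p x \<le> s} + measure_pmf.prob p ?T"
    by (rule measure_Un_le) auto
  also have "measure_pmf.prob p ?T = (\<Sum>x\<in>?T. pmf p x)"
    using S by (intro measure_measure_pmf_finite) auto
  also have "\<dots> \<le> real (card ?T) * exp (- s)"
    by (rule sum_bounded_above) auto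
  also have "\<dots> \<le> real (min_atoms p m) * exp (- s)"
    using S card_mono[of S ?T] by (intro mult_right_mono) auto
  finally show "measure_pmf.prob p S \<le> measure_pmf.prob p {x. surprisal p x \<le> s} + real (min_atoms p m) * exp (- s)"
    by simp
qed

lemma min_atoms_pos:
  assumes "0 < m" "m < 1"
  shows "0 < min_atoms p m"
proof (rule ccontr)
  assume "\<not> ?thesis"
  moreover have "\<not> surprisal p x \<le> - 1" for x using surprisal_nonneg[of p x] by linarith
  ultimately show False using le_prob_surprisal_add[OF assms(2), of p "- 1"] assms(1) by simp
qed

context
  fixes p :: "nat \<Rightarrow> 'a pmf" and a b :: "nat \<Rightarrow> real" and M :: "real measure"
  assumes b: "\<And>d. 0 < b d" "filterlim b at_top sequentially" and M: "real_distribution M"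
begin

lemma cdf_normed_surprisal:
  "cdf (distr (measure_pmf (p d)) borel (\<lambda>x. (surprisal (p d) x - a d) / b d)) y
    = measure_pmf.prob (p d) {x. surprisal (p d) x \<le> a d + y * b d}"
  using b(1)[of d] by (simp add: cdf_distr_pmf divide_le_eq algebra_simps)

lemma approximate_quantiles_min_atoms:
  "approximate_quantiles (\<lambda>d. distr (measure_pmf (p d)) borel (\<lambda>x. (surprisal (p d) x - a d) / b d)) M
    (\<lambda>d m. (ln (real (min_atoms (p d) m)) - a d) / b d)"
proof (rule approximate_quantiles.intro[OF real_distribution_distr_pmf M], unfold cdf_normed_surprisal)
  fix m :: real assume m: "0 < m" "m < 1"
  show "(ln (real (min_atoms (p d) m)) - a d) / b d \<le> y"
    if "m \<le> measure_pmf.prob (p d) {x. surprisal (p d) x \<le> a d + y * b d}" for d y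
  proof -
    have "ln (real (min_atoms (p d) m)) \<le> a d + y * b d"
      using min_atoms_le_exp[OF that] min_atoms_pos[OF m, of "p d"] by (metis ln_exp ln_mono of_nat_0_less_iff)
    then show ?thesis using b(1)[of d] by (simp add: divide_le_eq algebra_simps)
  qed
  fix h e :: real assume "0 < h" "0 < e"
  have "\<forall>\<^sub>F d in sequentially. - ln e / h \<le> b d" using b(2) unfolding filterlim_at_top by blast
  then show "\<forall>\<^sub>F d in sequentially. \<forall>y. (ln (real (min_atoms (p d) m)) - a d) / b d + h \<le> y
      \<longrightarrow> m - e \<le> measure_pmf.prob (p d) {x. surprisal (p d) x \<le> a d + y * b d}"
  proof (eventually_elim, intro allI impI)
    fix d y assume "- ln e / h \<le> b d" and y: "(ln (real (min_atoms (p d) m)) - a d) / b d + h \<le> y"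
    then have "- (h * b d) \<le> ln e"
      unfolding pos_divide_le_eq[OF \<open>0 < h\<close>] by (simp add: mult.commute)
    moreover have "ln (real (min_atoms (p d) m)) - a d + h * b d \<le> y * b d"
      using mult_right_mono[OF y, of "b d"] b(1)[of d] by (simp add: distrib_right)
    ultimately have "ln (real (min_atoms (p d) m)) - (a d + y * b d) \<le> ln e" by linarith
    then have "exp (ln (real (min_atoms (p d) m)) - (a d + y * b d)) \<le> exp (ln e)"
      by (simp only: exp_le_cancel_iff)
    then have "real (min_atoms (p d) m) * exp (- (a d + y * b d)) \<le> e"
      using min_atoms_pos[OF m, of "p d"] \<open>0 < e\<close> by (simp add: exp_diff exp_minus divide_inverse del: minus_add_distrib)
    then show "m - e \<le> measure_pmf.prob (p d) {x. surprisal (p d) x \<le> a d + y * b d}"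
      using le_prob_surprisal_add[OF m(2), of "p d" "a d + y * b d"] by simp
  qed
qed

theorem min_atoms_asymptotics_iff_weak_conv:
  assumes "\<And>x y. x < y \<Longrightarrow> 0 < cdf M x \<Longrightarrow> cdf M x < 1 \<Longrightarrow> cdf M x < cdf M y"
  shows "(\<forall>m. 0 < m \<longrightarrow> m < 1 \<longrightarrow>
      (\<lambda>d. ln (real (min_atoms (p d) m)) - a d - gen_inv (cdf M) m * b d) \<in> o(b))
    \<longleftrightarrow> weak_conv_m (\<lambda>d. distr (measure_pmf (p d)) borel (\<lambda>x. (surprisal (p d) x - a d) / b d)) M"
  unfolding smallo_iff_divide_tendsto[OF b(1)]
  by (rule approximate_quantiles.weak_conv_iff_quantile_tendsto[OF approximate_quantiles_min_atoms assms, symmetric])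

end

section \<open>Products of discrete distributions\<close>

lemma surprisal_Pi_pmf:
  assumes "finite I" "f \<in> set_pmf (Pi_pmf I dflt p)"
  shows "surprisal (Pi_pmf I dflt p) f = (\<Sum>i\<in>I. surprisal (p i) (f i))"
proof -
  have f: "f \<in> PiE_dflt I dflt (set_pmf \<circ> p)"
    using assms(2) unfolding set_Pi_pmf[OF assms(1)] .
  then have "pmf (Pi_pmf I dflt p) f = (\<Prod>i\<in>I. pmf (p i) (f i))"
    using assms(1) by (intro pmf_Pi') (auto simp: PiE_dflt_def)
  moreover have "pmf (p i) (f i) \<noteq> 0" if "i \<in> I" for i
    using f that by (auto simp: PiE_dflt_def set_pmf_iff)
  ultimately show ?thesis
    using assms(1) by (simp add: surprisal_def ln_prod sum_negf)
qed

lemma char_distr_sum_Pi_pmf: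
  fixes g :: "'i \<Rightarrow> 'a \<Rightarrow> real"
  assumes "finite I"
  shows "char (distr (measure_pmf (Pi_pmf I dflt p)) borel (\<lambda>f. \<Sum>i\<in>I. g i (f i))) t
    = (\<Prod>i\<in>I. char (distr (measure_pmf (p i)) borel (g i)) t)"
proof -
  have "prob_space.indep_vars (measure_pmf (Pi_pmf I dflt p)) (\<lambda>_. borel) (\<lambda>i f. g i (f i)) I"
    by (rule prob_space.indep_vars_compose2[OF prob_space_measure_pmf indep_vars_Pi_pmf[OF assms]]) auto
  then have "char (distr (measure_pmf (Pi_pmf I dflt p)) borel (\<lambda>f. \<Sum>i\<in>I. g i (f i))) t
      = (\<Prod>i\<in>I. char (distr (measure_pmf (Pi_pmf I dflt p)) borel (\<lambda>f. g i (f i))) t)"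
    by (rule prob_space.char_distr_sum[OF prob_space_measure_pmf])
  also have "\<dots> = (\<Prod>i\<in>I. char (distr (measure_pmf (p i)) borel (g i)) t)"
  proof (rule prod.cong)
    fix i assume "i \<in> I"
    have "distr (measure_pmf (Pi_pmf I dflt p)) borel (\<lambda>f. g i (f i))
        = distr (measure_pmf (map_pmf (\<lambda>f. f i) (Pi_pmf I dflt p))) borel (g i)"
      by (simp add: map_pmf_rep_eq distr_distr comp_def)
    then show "char (distr (measure_pmf (Pi_pmf I dflt p)) borel (\<lambda>f. g i (f i))) t
        = char (distr (measure_pmf (p i)) borel (g i)) t"
      using \<open>i \<in> I\<close> by (simp add: Pi_pmf_component[OF assms])
  qed simp
  finally show ?thesis .
qed

lemma char_distr_surprisal_Pi_pmf:
  assumes "finite I"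
  shows "char (distr (measure_pmf (Pi_pmf I dflt p)) borel (\<lambda>f. (surprisal (Pi_pmf I dflt p) f - a) / b)) t
    = (\<Prod>i\<in>I. char (distr (measure_pmf (p i)) borel (\<lambda>x. surprisal (p i) x / b)) t) * iexp (- (t * (a / b)))"
proof -
  let ?P = "measure_pmf (Pi_pmf I dflt p)"
  have "char (distr ?P borel (\<lambda>f. (surprisal (Pi_pmf I dflt p) f - a) / b)) t
      = (CLINT f|?P. iexp (t * (\<Sum>i\<in>I. surprisal (p i) (f i) / b)) * iexp (- (t * (a / b))))"
    unfolding char_def
    by (subst integral_distr; (intro integral_cong_AE)?)
      (auto simp: AE_measure_pmf_iff surprisal_Pi_pmf[OF assms] sum_divide_distrib[symmetric]
        exp_add[symmetric] diff_divide_distrib algebra_simps)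
  also have "\<dots> = char (distr ?P borel (\<lambda>f. \<Sum>i\<in>I. surprisal (p i) (f i) / b)) t * iexp (- (t * (a / b)))"
    by (simp add: char_def integral_distr)
  finally show ?thesis
    unfolding char_distr_sum_Pi_pmf[OF assms, of dflt p "\<lambda>i x. surprisal (p i) x / b"] .
qed

section \<open>Eigenvalue sequences of tensor products\<close>

locale eigenvalue_sequences =
  fixes lam :: "nat \<Rightarrow> nat \<Rightarrow> real"
  assumes lam_nonneg: "\<And>j k. 1 \<le> j \<Longrightarrow> 1 \<le> k \<Longrightarrow> 0 \<le> lam j k"
    and lam_summable: "\<And>j. 1 \<le> j \<Longrightarrow> lam j summable_on {1..}"
    and lam_pos: "\<And>j. 1 \<le> j \<Longrightarrow> 0 < lam j 1"
begin

lemma trace1_pos: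
  assumes "1 \<le> j"
  shows "0 < trace1 lam j"
proof -
  have "sum (lam j) {1} \<le> infsum (lam j) {1..}"
    by (rule finite_sum_le_infsum[OF lam_summable[OF assms]]) (use lam_nonneg[OF assms] in auto)
  then show ?thesis using lam_pos[OF assms] by (simp add: trace1_def)
qed

lemma barlam_nonneg: "1 \<le> j \<Longrightarrow> 1 \<le> k \<Longrightarrow> 0 \<le> barlam lam j k"
  using lam_nonneg[of j k] trace1_pos[of j] by (simp add: barlam_def)

lemma barlam_has_sum:
  assumes "1 \<le> j"
  shows "(barlam lam j has_sum 1) {1..}"
proof -
  have "((\<lambda>k. (1 / trace1 lam j) * lam j k) has_sum (1 / trace1 lam j) * trace1 lam j) {1..}"
    unfolding trace1_def by (intro has_sum_cmult_right has_sum_infsum lam_summable[OF assms])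
  moreover have "(\<lambda>k. (1 / trace1 lam j) * lam j k) = barlam lam j" by (auto simp: fun_eq_iff barlam_def)
  ultimately show ?thesis using trace1_pos[OF assms] by simp
qed

definition eigen_pmf :: "nat \<Rightarrow> nat pmf" where
  "eigen_pmf j = embed_pmf (\<lambda>k. if 1 \<le> k then barlam lam j k else 0)"

lemma pmf_eigen_pmf:
  assumes "1 \<le> j"
  shows "pmf (eigen_pmf j) k = (if 1 \<le> k then barlam lam j k else 0)"
  unfolding eigen_pmf_def
proof (rule pmf_embed_pmf)
  let ?f = "\<lambda>k. if 1 \<le> k then barlam lam j k else 0"
  show nonneg: "0 \<le> ?f k" for k using barlam_nonneg[OF assms] by simp
  have "(?f has_sum 1) UNIV"
    using barlam_has_sum[OF assms] by (subst has_sum_cong_neutral[where T="{1..}" and g="barlam lam j"]) auto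
  then have sums: "?f sums 1" by (rule has_sum_imp_sums)
  have "(\<integral>\<^sup>+k. ennreal (?f k) \<partial>count_space UNIV) = (\<Sum>k. ennreal (?f k))"
    by (rule nn_integral_count_space_nat)
  also have "\<dots> = ennreal (\<Sum>k. ?f k)"
    by (rule suminf_ennreal2[OF nonneg sums_summable[OF sums]])
  also have "\<dots> = 1" using sums_unique[OF sums] by simp
  finally show "(\<integral>\<^sup>+k. ennreal (?f k) \<partial>count_space UNIV) = 1" .
qed

subsection \<open>The complexity as a number of atoms\<close>

definition eigen_product :: "nat \<Rightarrow> (nat \<Rightarrow> nat) pmf" where
  "eigen_product d = Pi_pmf {1..d} undefined eigen_pmf"

lemma pmf_eigen_product:
  "pmf (eigen_product d) \<kappa> = (if \<kappa> \<in> multi_idx d then prod_eig lam d \<kappa> / (\<Prod>j=1..d. trace1 lam j) else 0)"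
proof (cases "\<kappa> \<in> multi_idx d")
  case True
  then have \<kappa>: "\<And>j. j \<in> {1..d} \<Longrightarrow> 1 \<le> \<kappa> j" "\<And>j. j \<notin> {1..d} \<Longrightarrow> \<kappa> j = undefined"
    by (auto simp: multi_idx_def PiE_iff extensional_def)
  have "pmf (eigen_product d) \<kappa> = (\<Prod>j=1..d. pmf (eigen_pmf j) (\<kappa> j))"
    unfolding eigen_product_def using \<kappa> by (intro pmf_Pi') auto
  also have "\<dots> = (\<Prod>j=1..d. lam j (\<kappa> j) / trace1 lam j)"
    using \<kappa>(1) by (intro prod.cong refl) (auto simp: pmf_eigen_pmf barlam_def)
  finally show ?thesis using True by (simp add: prod_eig_def prod_dividef)
next
  case False
  then consider j where "j \<in> {1..d}" "\<not> 1 \<le> \<kappa> j" | j where "j \<notin> {1..d}" "\<kappa> j \<noteq> undefined"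
    by (auto simp: multi_idx_def PiE_iff extensional_def)
  then have "pmf (eigen_product d) \<kappa> = 0"
  proof cases
    case (1 j)
    then have "pmf (eigen_pmf j) (\<kappa> j) = 0" by (simp add: pmf_eigen_pmf)
    then show ?thesis using 1 by (auto simp: eigen_product_def pmf_Pi intro!: prod_zero bexI[of _ j])
  next
    case (2 j)
    then show ?thesis unfolding eigen_product_def by (intro pmf_Pi_outside) auto
  qed
  then show ?thesis using False by simp
qed

lemma prob_eigen_product_Int_multi_idx:
  "measure_pmf.prob (eigen_product d) (S \<inter> multi_idx d) = measure_pmf.prob (eigen_product d) S"
  by (rule measure_pmf.finite_measure_eq_AE)
    (auto simp: AE_measure_pmf_iff set_pmf_iff pmf_eigen_product split: if_splits)

lemma prod_trace1_pos: "0 < (\<Prod>j=1..d. trace1 lam j)"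
  by (intro prod_pos ballI trace1_pos) simp

lemma prod_eig_eq: "\<kappa> \<in> multi_idx d \<Longrightarrow> prod_eig lam d \<kappa> = (\<Prod>j=1..d. trace1 lam j) * pmf (eigen_product d) \<kappa>"
  using prod_trace1_pos[of d]
  by (simp only: pmf_eigen_product if_True times_divide_eq_right
      nonzero_mult_div_cancel_left[OF less_imp_neq[THEN not_sym]])

lemma trace_d_eq: "trace_d lam d = (\<Prod>j=1..d. trace1 lam j)"
proof -
  have "trace_d lam d = (\<Sum>\<^sub>\<infinity>\<kappa>\<in>multi_idx d. (\<Prod>j=1..d. trace1 lam j) * pmf (eigen_product d) \<kappa>)"
    unfolding trace_d_def by (intro infsum_cong prod_eig_eq)
  also have "\<dots> = (\<Prod>j=1..d. trace1 lam j) * measure_pmf.prob (eigen_product d) (multi_idx d)"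
    unfolding measure_pmf_infsum by (rule infsum_cmult_right')
  finally show ?thesis using prob_eigen_product_Int_multi_idx[of d UNIV] by simp
qed

lemma trace_d_pos: "0 < trace_d lam d"
  unfolding trace_d_eq by (rule prod_trace1_pos)

lemma sum_prod_eig:
  assumes "S \<subseteq> multi_idx d" "finite S"
  shows "(\<Sum>\<kappa>\<in>S. prod_eig lam d \<kappa>) = trace_d lam d * measure_pmf.prob (eigen_product d) S"
proof -
  have "(\<Sum>\<kappa>\<in>S. prod_eig lam d \<kappa>) = (\<Sum>\<kappa>\<in>S. trace_d lam d * pmf (eigen_product d) \<kappa>)"
    using assms(1) unfolding trace_d_eq by (intro sum.cong refl prod_eig_eq) auto
  then show ?thesis using assms(2) by (simp add: measure_measure_pmf_finite sum_distrib_left)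
qed

lemma top_sum_eq: "top_sum lam d n = trace_d lam d * top_mass (eigen_product d) n"
proof (rule antisym)
  let ?sums = "(\<lambda>S. \<Sum>\<kappa>\<in>S. prod_eig lam d \<kappa>) ` {S. S \<subseteq> multi_idx d \<and> finite S \<and> card S \<le> n}"
  have le: "s \<le> trace_d lam d * top_mass (eigen_product d) n" if "s \<in> ?sums" for s
    using that trace_d_pos[of d] by (auto simp: sum_prod_eig intro!: mult_left_mono prob_le_top_mass)
  show "top_sum lam d n \<le> trace_d lam d * top_mass (eigen_product d) n"
    unfolding top_sum_def by (rule cSup_least[OF _ le]) (auto intro!: exI[of _ "{}"])
  have "top_mass (eigen_product d) n \<le> top_sum lam d n / trace_d lam d"
  proof (rule top_mass_le)
    fix S :: "(nat \<Rightarrow> nat) set" assume S: "finite S" "card S \<le> n"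
    let ?S = "S \<inter> multi_idx d"
    have "card ?S \<le> n" using S card_mono[of S ?S] by simp
    then have "(\<Sum>\<kappa>\<in>?S. prod_eig lam d \<kappa>) \<le> top_sum lam d n"
      unfolding top_sum_def using S by (intro cSup_upper bdd_aboveI[OF le]) auto
    then show "measure_pmf.prob (eigen_product d) S \<le> top_sum lam d n / trace_d lam d"
      using S trace_d_pos[of d]
      by (simp add: sum_prod_eig prob_eigen_product_Int_multi_idx le_divide_eq mult.commute)
  qed
  then show "trace_d lam d * top_mass (eigen_product d) n \<le> top_sum lam d n"
    using trace_d_pos[of d] by (simp add: le_divide_eq mult.commute)
qed

lemma complexity_eq_min_atoms: "complexity lam d \<epsilon> = min_atoms (eigen_product d) (1 - \<epsilon>\<^sup>2)"
proof -
  have "tail_d lam d n \<le> \<epsilon>\<^sup>2 \<longleftrightarrow> 1 - \<epsilon>\<^sup>2 \<le> top_mass (eigen_product d) n" for n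
    using trace_d_pos[of d] by (auto simp: tail_d_def top_sum_eq diff_divide_distrib)
  then show ?thesis by (simp add: complexity_def min_atoms_def)
qed

subsection \<open>Laws of the truncated surprisals\<close>

definition trunc_surprisal :: "enat \<Rightarrow> nat \<Rightarrow> nat \<Rightarrow> real" where
  "trunc_surprisal N j k = (if enat k \<le> N then surprisal (eigen_pmf j) k else 0)"

definition scaled_law :: "enat \<Rightarrow> real \<Rightarrow> nat \<Rightarrow> real measure" where
  "scaled_law N c j = distr (measure_pmf (eigen_pmf j)) borel (\<lambda>k. trunc_surprisal N j k / c)"

lemma trunc_surprisal_nonneg: "0 \<le> trunc_surprisal N j k"
  by (simp add: trunc_surprisal_def surprisal_nonneg)

lemma trunc_surprisal_infinity: "trunc_surprisal \<infinity> j = surprisal (eigen_pmf j)"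
  by (simp add: trunc_surprisal_def fun_eq_iff)

lemma nonneg_distribution_scaled_law:
  assumes "0 < c"
  shows "nonneg_distribution (scaled_law N c j)"
proof -
  interpret real_distribution "scaled_law N c j"
    unfolding scaled_law_def by (rule real_distribution_distr_pmf)
  have "AE x in scaled_law N c j. 0 \<le> x"
    unfolding scaled_law_def using assms by (subst AE_distr_iff) (auto simp: trunc_surprisal_nonneg)
  then show ?thesis by unfold_locales
qed

lemma measure_scaled_law:
  "S \<in> sets borel \<Longrightarrow> measure (scaled_law N c j) S = measure_pmf.prob (eigen_pmf j) {k. trunc_surprisal N j k / c \<in> S}"
  by (simp add: scaled_law_def measure_distr vimage_def)

lemma measure_scaled_law_tail_le:
  assumes "0 < c" "0 < x"
  shows "measure (scaled_law N c j) {x<..} \<le> measure (scaled_law \<infinity> c j) {x<..}"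
  using assms unfolding measure_scaled_law[OF borel_open[OF open_greaterThan]]
  by (intro measure_pmf.finite_measure_mono) (auto simp: trunc_surprisal_def split: if_splits)

lemma measure_scaled_law_tail_scale:
  assumes "0 < c"
  shows "measure (scaled_law N c j) {x<..} = measure (scaled_law N 1 j) {x * c<..}"
  using assms by (simp add: measure_scaled_law less_divide_eq)

context
  fixes j :: nat and c x :: real
  assumes j: "1 \<le> j" and c: "0 < c" and x: "0 < x"
begin

lemma measure_scaled_law_tail:
  "measure (scaled_law N c j) {x<..}
    = (\<Sum>\<^sub>\<infinity>k\<in>{k. 1 \<le> k \<and> enat k \<le> N}. if barlam lam j k < exp (- x * c) then barlam lam j k else 0)"
proof -
  have "measure (scaled_law N c j) {x<..} = (\<Sum>\<^sub>\<infinity>k\<in>{k. x < trunc_surprisal N j k / c}. pmf (eigen_pmf j) k)"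
    by (simp add: measure_scaled_law measure_pmf_infsum)
  also have "\<dots> = (\<Sum>\<^sub>\<infinity>k\<in>{k. 1 \<le> k \<and> enat k \<le> N}. if barlam lam j k < exp (- x * c) then barlam lam j k else 0)"
  proof (rule infsum_cong_neutral)
    have less_iff: "x < trunc_surprisal N j k / c \<longleftrightarrow> barlam lam j k < exp (- x * c)"
      if "1 \<le> k" "enat k \<le> N" "barlam lam j k \<noteq> 0" for k
      using that less_surprisal_divide_iff[OF c, of "eigen_pmf j" k x] barlam_nonneg[OF j, of k]
      by (simp add: trunc_surprisal_def pmf_eigen_pmf[OF j])
    show "(if barlam lam j k < exp (- x * c) then barlam lam j k else 0) = 0"
      if "k \<in> {k. 1 \<le> k \<and> enat k \<le> N} - {k. x < trunc_surprisal N j k / c}" for k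
      using that less_iff[of k] by auto
    show "pmf (eigen_pmf j) k = 0"
      if "k \<in> {k. x < trunc_surprisal N j k / c} - {k. 1 \<le> k \<and> enat k \<le> N}" for k
      using that x by (auto simp: trunc_surprisal_def pmf_eigen_pmf[OF j] split: if_splits)
    show "pmf (eigen_pmf j) k = (if barlam lam j k < exp (- x * c) then barlam lam j k else 0)"
      if "k \<in> {k. x < trunc_surprisal N j k / c} \<inter> {k. 1 \<le> k \<and> enat k \<le> N}" for k
      using that less_iff[of k] by (auto simp: pmf_eigen_pmf[OF j])
  qed
  finally show ?thesis .
qed

lemma trunc_moment_scaled_law:
  assumes n: "0 < n"
  shows "(LINT y|scaled_law N c j. indicator {..x} y * y ^ n) = Mfun lam n N j (x * c) / c ^ n"
proof -
  let ?Y = "trunc_surprisal N j"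
  let ?f = "\<lambda>k. indicator {..x} (?Y k / c) * (?Y k / c) ^ n"
  have int: "integrable (measure_pmf (eigen_pmf j)) ?f"
    using c x by (intro measure_pmf.integrable_const_bound[of _ "x ^ n"])
      (auto simp: trunc_surprisal_nonneg intro!: power_mono split: split_indicator)
  have "(LINT y|scaled_law N c j. indicator {..x} y * y ^ n) = measure_pmf.expectation (eigen_pmf j) ?f"
    unfolding scaled_law_def by (rule integral_distr) auto
  also have "\<dots> = (\<Sum>\<^sub>\<infinity>k. pmf (eigen_pmf j) k * ?f k)"
    by (rule expectation_pmf_infsum[OF int])
  also have "\<dots> = (\<Sum>\<^sub>\<infinity>k\<in>{k. 1 \<le> k \<and> enat k \<le> N}. 1 / c ^ n *
      (if exp (- (x * c)) \<le> barlam lam j k then \<bar>ln (barlam lam j k)\<bar> ^ n * barlam lam j k else 0))"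
  proof (rule infsum_cong_neutral)
    fix k assume "k \<in> UNIV \<inter> {k. 1 \<le> k \<and> enat k \<le> N}"
    then have k: "1 \<le> k" "enat k \<le> N" by auto
    then have pmf: "pmf (eigen_pmf j) k = barlam lam j k" by (simp add: pmf_eigen_pmf[OF j])
    show "pmf (eigen_pmf j) k * ?f k = 1 / c ^ n *
        (if exp (- (x * c)) \<le> barlam lam j k then \<bar>ln (barlam lam j k)\<bar> ^ n * barlam lam j k else 0)"
    proof (cases "barlam lam j k = 0")
      case False
      then have pos: "0 < pmf (eigen_pmf j) k" using barlam_nonneg[OF j k(1)] pmf by simp
      have "\<bar>ln (barlam lam j k)\<bar> = ?Y k"
        using pmf pmf_le_1[of "eigen_pmf j" k] pos k(2) by (simp add: trunc_surprisal_def surprisal_def)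
      moreover have "?Y k / c \<le> x \<longleftrightarrow> exp (- (x * c)) \<le> barlam lam j k"
        using less_surprisal_divide_iff[OF c pos, of x] k(2) pmf by (simp add: trunc_surprisal_def not_less[symmetric])
      ultimately show ?thesis by (simp add: pmf power_divide split: split_indicator)
    qed (simp add: pmf)
  qed (use n j in \<open>auto simp: trunc_surprisal_def pmf_eigen_pmf\<close>)
  also have "\<dots> = 1 / c ^ n * Mfun lam n N j (x * c)"
    unfolding Mfun_def by (rule infsum_cmult_right')
  finally show ?thesis by simp
qed

lemma trunc_mean_scaled_law: "trunc_mean (scaled_law N c j) x = Mfun lam 1 N j (x * c) / c"
  using trunc_moment_scaled_law[of 1] by (simp add: trunc_mean_def)

lemma trunc_var_scaled_law:
  "trunc_var (scaled_law N c j) x = (Mfun lam 2 N j (x * c) - (Mfun lam 1 N j (x * c))\<^sup>2) / c\<^sup>2"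
  using trunc_moment_scaled_law[of 2]
  by (simp add: trunc_var_def trunc_second_moment_def trunc_mean_scaled_law power_divide diff_divide_distrib)

end

subsection \<open>Truncation of the spectrum\<close>

lemma norm_char_scaled_law_diff_le:
  assumes "1 \<le> j"
  shows "norm (char (scaled_law \<infinity> c j) t - char (scaled_law N c j) t) \<le> 2 * (\<Sum>\<^sub>\<infinity>k\<in>{k. N < enat k}. barlam lam j k)"
proof -
  have "norm (char (scaled_law \<infinity> c j) t - char (scaled_law N c j) t)
      \<le> 2 * measure_pmf.prob (eigen_pmf j) {k. trunc_surprisal \<infinity> j k / c \<noteq> trunc_surprisal N j k / c}"
    unfolding scaled_law_def by (rule order_trans[OF measure_pmf.norm_char_distr_diff_le_prob]) auto
  also have "\<dots> \<le> 2 * measure_pmf.prob (eigen_pmf j) {k. N < enat k}"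
    by (intro mult_left_mono measure_pmf.finite_measure_mono) (auto simp: trunc_surprisal_def not_le[symmetric])
  also have "measure_pmf.prob (eigen_pmf j) {k. N < enat k} = (\<Sum>\<^sub>\<infinity>k\<in>{k. N < enat k}. barlam lam j k)"
    unfolding measure_pmf_infsum
  proof (rule infsum_cong)
    fix k assume "k \<in> {k. N < enat k}"
    then have "k \<noteq> 0" by (cases "k = 0") (auto simp: zero_enat_def[symmetric])
    then show "pmf (eigen_pmf j) k = barlam lam j k" by (simp add: pmf_eigen_pmf[OF assms])
  qed
  finally show ?thesis .
qed

lemma char_scaled_law_tendsto_1:
  assumes "filterlim b at_top sequentially"
  shows "(\<lambda>d. char (scaled_law N (b d) j) t) \<longlonglongrightarrow> 1"
proof -
  interpret real_distribution "scaled_law N 1 j"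
    unfolding scaled_law_def by (rule real_distribution_distr_pmf)
  have scaled_law_eq: "scaled_law N c j = distr (scaled_law N 1 j) borel (\<lambda>x. x / c)" for c
    unfolding scaled_law_def by (simp add: distr_distr comp_def)
  have "char (scaled_law N (b d) j) t = char (scaled_law N 1 j) (t / b d)" for d
    by (subst scaled_law_eq) (rule char_scale)
  moreover have "(\<lambda>d. t / b d) \<longlonglongrightarrow> 0"
    by (rule tendsto_divide_0[OF tendsto_const filterlim_at_top_imp_at_infinity[OF assms]])
  ultimately show ?thesis
    using isCont_tendsto_compose[OF isCont_char[of 0]] by (simp add: char_zero)
qed

lemma prod_char_truncation_tendsto_0:
  assumes b: "filterlim b at_top sequentially"
    and N: "(\<lambda>j. \<Sum>\<^sub>\<infinity>k\<in>{k. N < enat k}. barlam lam j k) summable_on {1..}"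
  shows "(\<lambda>d. (\<Prod>j=1..d. char (scaled_law \<infinity> (b d) j) t) - (\<Prod>j=1..d. char (scaled_law N (b d) j) t)) \<longlonglongrightarrow> 0"
proof (rule Lim_null_comparison[OF always_eventually])
  define f where "f j d = norm (char (scaled_law \<infinity> (b d) (Suc j)) t - char (scaled_law N (b d) (Suc j)) t)" for j d
  have char_le: "norm (char (scaled_law N' c j) t) \<le> 1" for N' c j
    unfolding scaled_law_def by (intro real_distribution.cmod_char_le_1 real_distribution_distr_pmf)
  have "norm ((\<Prod>j=1..d. char (scaled_law \<infinity> (b d) j) t) - (\<Prod>j=1..d. char (scaled_law N (b d) j) t))
      \<le> (\<Sum>j=1..d. norm (char (scaled_law \<infinity> (b d) j) t - char (scaled_law N (b d) j) t))" for d
    by (rule norm_prod_diff) (rule char_le)+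
  then show "\<forall>d. norm ((\<Prod>j=1..d. char (scaled_law \<infinity> (b d) j) t) - (\<Prod>j=1..d. char (scaled_law N (b d) j) t))
      \<le> (\<Sum>j<d. f j d)"
    unfolding f_def One_nat_def by (intro allI) (simp only: sum.atLeast1_atMost_eq)
  show "(\<lambda>d. \<Sum>j<d. f j d) \<longlonglongrightarrow> 0"
  proof (rule sum_lessThan_tendsto_0_of_dominated)
    have "range Suc = {1..}" by (auto simp: image_iff gr0_conv_Suc Suc_le_eq)
    then have "(\<lambda>j. \<Sum>\<^sub>\<infinity>k\<in>{k. N < enat k}. barlam lam (Suc j) k) summable_on UNIV"
      using N summable_on_reindex[of Suc UNIV "\<lambda>j. \<Sum>\<^sub>\<infinity>k\<in>{k. N < enat k}. barlam lam j k"]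
      by (simp add: comp_def)
    then show "summable (\<lambda>j. 2 * (\<Sum>\<^sub>\<infinity>k\<in>{k. N < enat k}. barlam lam (Suc j) k))"
      by (intro summable_on_imp_summable summable_on_cmult_right)
    show "norm (f j d) \<le> 2 * (\<Sum>\<^sub>\<infinity>k\<in>{k. N < enat k}. barlam lam (Suc j) k)" for j d
      unfolding f_def real_norm_def abs_norm_cancel by (rule norm_char_scaled_law_diff_le) simp
    have "(\<lambda>d. f j d) \<longlonglongrightarrow> norm (1 - 1 :: complex)" for j
      unfolding f_def by (intro tendsto_norm tendsto_diff char_scaled_law_tendsto_1 b)
    then show "(\<lambda>d. f j d) \<longlonglongrightarrow> 0" for j by simp
  qed
qed

end

section \<open>The complexity of tensor products\<close>

lemma levy_characteristics_of_triplet: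
  assumes "levy_triplet M \<gamma> \<sigma>2 L \<nu>"
  shows "levy_characteristics \<sigma>2 L \<nu>"
  using assms by unfold_locales (auto simp: levy_triplet_def)

lemma char_eq_exp_levy_exponent:
  assumes "levy_triplet M \<gamma> \<sigma>2 L \<nu>"
  shows "char M t = exp (levy_characteristics.levy_exponent \<gamma> \<sigma>2 \<nu> t)"
  using assms
  by (simp add: levy_triplet_def levy_characteristics.levy_exponent_def[OF levy_characteristics_of_triplet[OF assms]]
      levy_kernel_def[abs_def] mult.commute)

locale tensor_product_asymptotics = eigenvalue_sequences lam + levy_characteristics \<gamma> \<sigma>2 L \<nu>
  for lam :: "nat \<Rightarrow> nat \<Rightarrow> real" and \<gamma> \<sigma>2 :: real and L :: "real \<Rightarrow> real" and \<nu> :: "real measure" +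
  fixes a b :: "nat \<Rightarrow> real" and N :: enat
  assumes b_pos: "\<And>d. 0 < b d" and b_at_top: "filterlim b at_top sequentially"
    and max_tail_tendsto_0: "\<And>\<tau>. 0 < \<tau> \<Longrightarrow>
      (\<lambda>d. Max ((\<lambda>j. \<Sum>\<^sub>\<infinity>k\<in>{1..}. if barlam lam j k < exp (- \<tau> * b d) then barlam lam j k else 0) ` {1..d})) \<longlonglongrightarrow> 0"
    and tail_summable: "(\<lambda>j. \<Sum>\<^sub>\<infinity>k\<in>{k. N < enat k}. barlam lam j k) summable_on {1..}"
begin

lemma scaled_laws_null:
  assumes "0 < \<tau>" "0 < e"
  shows "\<forall>\<^sub>F d in sequentially. \<forall>j\<in>{1..d}. measure (scaled_law N (b d) j) {\<tau><..} \<le> e"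
  using order_tendstoD(2)[OF max_tail_tendsto_0[OF assms(1)] assms(2)]
proof (eventually_elim, intro ballI)
  fix d j
  let ?tail = "\<lambda>j. \<Sum>\<^sub>\<infinity>k\<in>{1..}. if barlam lam j k < exp (- \<tau> * b d) then barlam lam j k else 0"
  assume small: "Max (?tail ` {1..d}) < e" and j: "j \<in> {1..d}"
  have "{k::nat. 1 \<le> k \<and> enat k \<le> \<infinity>} = {1..}" by auto
  then have "measure (scaled_law \<infinity> (b d) j) {\<tau><..} = ?tail j"
    using j measure_scaled_law_tail[OF _ b_pos assms(1), of j \<infinity> d] by simp
  also have "\<dots> \<le> Max (?tail ` {1..d})" using j by (intro Max_ge) auto
  finally show "measure (scaled_law N (b d) j) {\<tau><..} \<le> e"
    using small measure_scaled_law_tail_le[OF b_pos assms(1), of N d j] by linarith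
qed

sublocale null_array_limit \<gamma> \<sigma>2 L \<nu> "\<lambda>d. {1..d}" "\<lambda>d. scaled_law N (b d)" "\<lambda>d. a d / b d"
  by (intro null_array_limit.intro null_array.intro levy_characteristics_axioms)
    (auto intro: nonneg_distribution_scaled_law b_pos scaled_laws_null simp del: One_nat_def)

definition surprisal_law :: "nat \<Rightarrow> real measure" where
  "surprisal_law d = distr (measure_pmf (eigen_product d)) borel (\<lambda>\<kappa>. (surprisal (eigen_product d) \<kappa> - a d) / b d)"

lemma weak_conv_surprisal_law_iff:
  assumes "real_distribution M"
  shows "weak_conv_m surprisal_law M \<longleftrightarrow> weak_conv_m row_law M"
proof (rule weak_conv_m_cong_char[OF _ real_distribution_row_law assms])
  show "real_distribution (surprisal_law d)" for d
    unfolding surprisal_law_def by (rule real_distribution_distr_pmf)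
  fix t
  let ?prod = "\<lambda>N d. \<Prod>j=1..d. char (scaled_law N (b d) j) t"
  have "char (surprisal_law d) t = ?prod \<infinity> d * iexp (- (t * (a d / b d)))" for d
    unfolding surprisal_law_def eigen_product_def char_distr_surprisal_Pi_pmf[OF finite_atLeastAtMost]
    by (simp add: scaled_law_def trunc_surprisal_infinity)
  then have "norm (char (surprisal_law d) t - char (row_law d) t) = norm (?prod \<infinity> d - ?prod N d)" for d
    unfolding char_row_law
    by (simp add: left_diff_distrib[symmetric] norm_mult del: of_real_minus of_real_mult of_real_divide)
  then show "(\<lambda>d. char (surprisal_law d) t - char (row_law d) t) \<longlonglongrightarrow> 0"
    using tendsto_norm_zero[OF prod_char_truncation_tendsto_0[OF b_at_top tail_summable, of t]]
    by (subst tendsto_norm_zero_iff[symmetric]) simp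
qed

lemma complexity_asymptotics_iff:
  assumes M: "self_decomposable M" "\<And>t. char M t = exp (levy_exponent t)"
    and q: "\<forall>\<epsilon>\<in>{0<..<1}. q \<epsilon> = gen_inv (cdf M) (1 - \<epsilon>\<^sup>2)"
  shows "(\<forall>\<epsilon>\<in>{0<..<1}. (\<lambda>d. ln (real (complexity lam d \<epsilon>)) - a d - q \<epsilon> * b d) \<in> o(b))
    \<longleftrightarrow> weak_conv_m surprisal_law M"
proof -
  let ?asymptotics = "\<lambda>m. (\<lambda>d. ln (real (min_atoms (eigen_product d) m)) - a d - gen_inv (cdf M) m * b d) \<in> o(b)"
  have "(\<forall>\<epsilon>\<in>{0<..<1}. (\<lambda>d. ln (real (complexity lam d \<epsilon>)) - a d - q \<epsilon> * b d) \<in> o(b))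
      \<longleftrightarrow> (\<forall>\<epsilon>\<in>{0<..<1}. ?asymptotics (1 - \<epsilon>\<^sup>2))"
    using q by (intro ball_cong refl) (simp add: complexity_eq_min_atoms)
  also have "\<dots> \<longleftrightarrow> (\<forall>m\<in>(\<lambda>\<epsilon>. 1 - \<epsilon>\<^sup>2) ` {0<..<1}. ?asymptotics m)"
    by simp
  also have "(\<lambda>\<epsilon>::real. 1 - \<epsilon>\<^sup>2) ` {0<..<1} = {0<..<1}"
  proof (intro equalityI subsetI)
    fix m :: real assume "m \<in> {0<..<1}"
    then show "m \<in> (\<lambda>\<epsilon>. 1 - \<epsilon>\<^sup>2) ` {0<..<1}" by (intro image_eqI[of _ _ "sqrt (1 - m)"]) auto
  qed (auto simp: power_less_one_iff)
  also have "(\<forall>m\<in>{0<..<1}. ?asymptotics m) \<longleftrightarrow> (\<forall>m. 0 < m \<longrightarrow> m < 1 \<longrightarrow> ?asymptotics m)" by auto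
  also have "\<dots> \<longleftrightarrow> weak_conv_m surprisal_law M"
    unfolding surprisal_law_def[abs_def]
  proof (rule min_atoms_asymptotics_iff_weak_conv[OF b_pos b_at_top])
    show "real_distribution M" using M(1) by (simp add: self_decomposable_def)
    show "cdf M x < cdf M y" if "x < y" "0 < cdf M x" "cdf M x < 1" for x y
      by (rule self_decomposable_cdf_less[OF M(1) _ that]) (simp add: M(2))
  qed
  finally show ?thesis .
qed

lemma isCont_L_of_tail_convergence:
  assumes tail_convergence "0 < x"
  shows "isCont L x"
proof -
  have scale: "measure (scaled_law N 1 j) {y * b d<..} = measure (scaled_law N (b d) j) {y<..}" for j d y
    by (rule measure_scaled_law_tail_scale[OF b_pos, symmetric])
  interpret normed_tail_limit L b "\<lambda>j s. measure (scaled_law N 1 j) {s<..}"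
  proof
    show "measure (scaled_law N 1 j) {t<..} \<le> measure (scaled_law N 1 j) {s<..}" if "s \<le> t" for j s t
      using nonneg_distribution_scaled_law[of 1 N j] that by (intro nonneg_distribution.prob_tail_antimono) auto
    show "(\<lambda>d. \<Sum>j=1..d. measure (scaled_law N 1 j) {y * b d<..}) \<longlonglongrightarrow> - L y" if "0 < y" "isCont L y" for y
      using assms(1) that by (simp add: scale tail_convergence_def tail_sum_def del: One_nat_def)
    show "(\<lambda>d. measure (scaled_law N 1 d) {y * b d<..}) \<longlonglongrightarrow> 0" if "0 < y" for y
    proof (rule tendstoI)
      fix e :: real assume "0 < e"
      then have "\<forall>\<^sub>F d in sequentially. \<forall>j\<in>{1..d}. measure (scaled_law N (b d) j) {y<..} \<le> e/2"
        using that by (intro scaled_laws_null) auto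
      with eventually_ge_at_top[of 1] show "\<forall>\<^sub>F d in sequentially. dist (measure (scaled_law N 1 d) {y * b d<..}) 0 < e"
        by eventually_elim (use \<open>0 < e\<close> in \<open>force simp: scale\<close>)
    qed
  qed (rule b_pos b_at_top)+
  show ?thesis by (rule isCont_L[OF assms(2)])
qed

lemma weak_conv_row_law_iff:
  assumes "real_distribution M" "\<And>t. char M t = exp (levy_exponent t)"
  shows "weak_conv_m row_law M \<longleftrightarrow> (\<forall>x>0. (\<lambda>d. tail_sum d x) \<longlonglongrightarrow> - L x)
    \<and> (\<forall>\<tau>>0. (\<lambda>d. mean_sum d \<tau> - a d / b d) \<longlonglongrightarrow> levy_shift \<tau>) \<and> variance_convergence"
proof -
  have "tail_convergence \<longleftrightarrow> (\<forall>x>0. (\<lambda>d. tail_sum d x) \<longlonglongrightarrow> - L x)"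
    using isCont_L_of_tail_convergence unfolding tail_convergence_def by blast
  moreover have "mean_convergence \<longleftrightarrow> (\<forall>\<tau>>0. (\<lambda>d. mean_sum d \<tau> - a d / b d) \<longlonglongrightarrow> levy_shift \<tau>)" if tail_convergence
    using isCont_L_of_tail_convergence[OF that] unfolding mean_convergence_def by blast
  ultimately show ?thesis
    using weak_conv_m_row_law_iff[OF assms] by blast
qed

lemma tail_sum_eq:
  assumes "0 < x"
  shows "tail_sum d x = (\<Sum>j=1..d. \<Sum>\<^sub>\<infinity>k\<in>{k. 1 \<le> k \<and> enat k \<le> N}.
    if barlam lam j k < exp (- x * b d) then barlam lam j k else 0)"
  unfolding tail_sum_def by (intro sum.cong measure_scaled_law_tail b_pos assms) auto

lemma mean_sum_minus_eq:
  assumes "0 < \<tau>"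
  shows "mean_sum d \<tau> - a d / b d = ((\<Sum>j=1..d. Mfun lam 1 N j (\<tau> * b d)) - a d) / b d"
proof -
  have "mean_sum d \<tau> = (\<Sum>j=1..d. Mfun lam 1 N j (\<tau> * b d) / b d)"
    unfolding mean_sum_def by (intro sum.cong trunc_mean_scaled_law b_pos assms) auto
  then show ?thesis by (simp add: diff_divide_distrib sum_divide_distrib)
qed

lemma var_sum_eq:
  assumes "0 < \<tau>"
  shows "var_sum d \<tau> = (\<Sum>j=1..d. Mfun lam 2 N j (\<tau> * b d) - (Mfun lam 1 N j (\<tau> * b d))\<^sup>2) / (b d)\<^sup>2"
  unfolding var_sum_def sum_divide_distrib by (intro sum.cong trunc_var_scaled_law b_pos assms) auto

lemma variance_convergence_iff:
  "variance_convergence \<longleftrightarrow>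
    ((\<lambda>\<tau>. limsup (\<lambda>d. ereal ((\<Sum>j=1..d. Mfun lam 2 N j (\<tau> * b d) - (Mfun lam 1 N j (\<tau> * b d))\<^sup>2) / (b d)\<^sup>2)))
      \<longlongrightarrow> ereal \<sigma>2) (at_right 0)
    \<and> ((\<lambda>\<tau>. liminf (\<lambda>d. ereal ((\<Sum>j=1..d. Mfun lam 2 N j (\<tau> * b d) - (Mfun lam 1 N j (\<tau> * b d))\<^sup>2) / (b d)\<^sup>2)))
      \<longlongrightarrow> ereal \<sigma>2) (at_right 0)"
  unfolding variance_convergence_def Limsup_Liminf_tendsto_iff[OF sequentially_bot]
  by (intro all_cong1 imp_cong refl eventually_cong[OF eventually_at_right_less]) (simp add: var_sum_eq del: One_nat_def)

end

theorem theorem3: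
  fixes lam :: "nat \<Rightarrow> nat \<Rightarrow> real"
    and a b :: "nat \<Rightarrow> real"
    and M :: "real measure" and \<gamma> \<sigma>2 :: real and L :: "real \<Rightarrow> real" and \<nu> :: "real measure"
    and q :: "real \<Rightarrow> real" and N :: enat
  assumes lam_nonneg: "\<forall>j\<ge>1. \<forall>k\<ge>1. lam j k \<ge> 0"
    and lam_mono: "\<forall>j\<ge>1. \<forall>k\<ge>1. lam j (Suc k) \<le> lam j k"
    and lam_summable: "\<forall>j\<ge>1. lam j summable_on {1..}"
    and lam_pos: "\<forall>j\<ge>1. lam j 1 > 0"
    and b_pos: "\<forall>d. b d > 0"
    and b_lim: "filterlim b at_top sequentially"
    and G_sd: "self_decomposable M"
    and G_levy: "levy_triplet M \<gamma> \<sigma>2 L \<nu>"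
    and q_mono: "antimono_on {0<..<1} q"
    and q_def: "\<forall>\<epsilon>\<in>{0<..<1}. q \<epsilon> = gen_inv (cdf M) (1 - \<epsilon>\<^sup>2)"
    and small: "\<forall>\<tau>>0. (\<lambda>d. Max ((\<lambda>j. \<Sum>\<^sub>\<infinity>k\<in>{1..}.
                  (if barlam lam j k < exp (- \<tau> * b d) then barlam lam j k else 0)) ` {1..d}))
                \<longlonglongrightarrow> 0"
    and N_cond: "(\<lambda>j. \<Sum>\<^sub>\<infinity>k\<in>{k. N < enat k}. barlam lam j k) summable_on {1..}"
  shows "(\<forall>\<epsilon>\<in>{0<..<1}.
            (\<lambda>d. ln (real (complexity lam d \<epsilon>)) - a d - q \<epsilon> * b d) \<in> o(b))
     \<longleftrightarrow>
         (\<forall>x>0. (\<lambda>d. \<Sum>j=1..d. \<Sum>\<^sub>\<infinity>k\<in>{k. 1 \<le> k \<and> enat k \<le> N}.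
                   (if barlam lam j k < exp (- x * b d) then barlam lam j k else 0))
                 \<longlonglongrightarrow> - L x)
       \<and> (\<forall>\<tau>>0. (\<lambda>d. ((\<Sum>j=1..d. Mfun lam 1 N j (\<tau> * b d)) - a d) / b d)
                 \<longlonglongrightarrow> \<gamma> + (LINT x:{0<..\<tau>}|\<nu>. x ^ 3 / (1 + x\<^sup>2))
                       - (LINT x:{\<tau><..}|\<nu>. x / (1 + x\<^sup>2)))
       \<and> ((\<lambda>\<tau>. limsup (\<lambda>d. ereal ((\<Sum>j=1..d. Mfun lam 2 N j (\<tau> * b d)
                     - (Mfun lam 1 N j (\<tau> * b d))\<^sup>2) / (b d)\<^sup>2)))
             \<longlongrightarrow> ereal \<sigma>2) (at_right 0)
       \<and> ((\<lambda>\<tau>. liminf (\<lambda>d. ereal ((\<Sum>j=1..d. Mfun lam 2 N j (\<tau> * b d)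
                     - (Mfun lam 1 N j (\<tau> * b d))\<^sup>2) / (b d)\<^sup>2)))
             \<longlongrightarrow> ereal \<sigma>2) (at_right 0)"
proof -
  interpret levy_characteristics \<gamma> \<sigma>2 L \<nu> by (rule levy_characteristics_of_triplet[OF G_levy])
  interpret tensor_product_asymptotics lam \<gamma> \<sigma>2 L \<nu> a b N
    using lam_nonneg lam_summable lam_pos b_pos b_lim small N_cond by unfold_locales auto
  have char_M: "char M t = exp (levy_exponent t)" for t
    by (rule char_eq_exp_levy_exponent[OF G_levy])
  have M: "real_distribution M" using G_sd by (simp add: self_decomposable_def)
  have "(\<forall>\<epsilon>\<in>{0<..<1}. (\<lambda>d. ln (real (complexity lam d \<epsilon>)) - a d - q \<epsilon> * b d) \<in> o(b))
      \<longleftrightarrow> weak_conv_m surprisal_law M"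
    by (rule complexity_asymptotics_iff[OF G_sd char_M q_def])
  also have "\<dots> \<longleftrightarrow> weak_conv_m row_law M"
    by (rule weak_conv_surprisal_law_iff[OF M])
  also have "\<dots> \<longleftrightarrow> (\<forall>x>0. (\<lambda>d. tail_sum d x) \<longlonglongrightarrow> - L x)
      \<and> (\<forall>\<tau>>0. (\<lambda>d. mean_sum d \<tau> - a d / b d) \<longlonglongrightarrow> levy_shift \<tau>) \<and> variance_convergence"
    by (rule weak_conv_row_law_iff[OF M char_M])
  finally show ?thesis
    unfolding variance_convergence_iff levy_shift_def by (simp add: tail_sum_eq mean_sum_minus_eq del: One_nat_def)
qed

end
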